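(* There exists $\delta_M\in(0,1]$ such that for every $\delta\in(0,\delta_M)$ there exists a compact Ahlfors regular set $K\subset\mathbb{R}^2$ of dimension $\delta$ with the following properties. Let $\Omega:=\mathbb{R}^2\setminus K$ and $\sigma:=\mathscr{H}^\delta|_K$. For every $x\in\Omega$ there is a constant $C_x\ge 1$ such that the harmonic measure $\omega^x$ of $\Omega$ with pole at $x$ satisfies $$C_x^{-1}\sigma(A)\le \omega^x(A)\le C_x\,\sigma(A)\quad\text{for all (Borel) } A\subset K,$$ and the Green function $G^x$ of $\Omega$ with pole at $x$ satisfies $$C_x^{-1}\operatorname{dist}(y,K)^\delta\le G^x(y)\le C_x\operatorname{dist}(y,K)^\delta$$ for all $y$ close enough to $K$ (i.e. for all $y\in\Omega$ with $\operatorname{dist}(y,K)\le \rho_x$, for some $\rho_x>0$). Furthermore, there is $\delta_1\in(0,1/2)$ such that if $\delta<\delta_1$, then the set $K$ can be taken to be contained in a line.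
   Context: A compact set $K\subset\mathbb{R}^n$ is called Ahlfors regular of dimension $d>0$ if it contains at least two points and there are a positive measure $\mu$ on $K$ and a constant $C_0\ge1$ such that $C_0^{-1}\rho^d\le\mu(B(x,\rho))\le C_0\rho^d$ for all $x\in K$ and $0<\rho\le\operatorname{diam}(K)$. $\mathscr{H}^\delta$ is the $\delta$-dimensional Hausdorff measure and $\mathscr{H}^\delta|_K$ its restriction to $K$. Harmonic measure and the Green function are those of the usual Laplace operator: $\omega^x$ is the probability measure on $\partial\Omega=K$ that gives the value at $x$ of the bounded harmonic function in $\Omega$ (including at the point at infinity) with prescribed continuous boundary data on $K$; $G^x$ is the positive Green function for $-\Delta$ in $\Omega$ with pole at $x$, vanishing on $K$ and bounded near infinity. *)

theory Defs
  imports "HOL-Analysis.Analysis" "HOL-Probability.Probability_Measure"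
begin

(* The measure lives on the Borel subsets of K itself, whence the trace of the ball on K. *)
definition ahlfors_regular :: "real \<Rightarrow> 'a::euclidean_space set \<Rightarrow> bool" where
  "ahlfors_regular d K \<longleftrightarrow>
     compact K \<and> d > 0 \<and> (\<exists>x\<in>K. \<exists>y\<in>K. x \<noteq> y) \<and>
     (\<exists>(\<mu> :: 'a measure) C\<^sub>0 :: real.
        sets \<mu> = sets (restrict_space borel K) \<and> C\<^sub>0 \<ge> 1 \<and>
        (\<forall>x\<in>K. \<forall>\<rho>. 0 < \<rho> \<and> \<rho> \<le> diameter K \<longrightarrow>
           ennreal (\<rho> powr d / C\<^sub>0) \<le> emeasure \<mu> (ball x \<rho> \<inter> K) \<and>
           emeasure \<mu> (ball x \<rho> \<inter> K) \<le> ennreal (C\<^sub>0 * \<rho> powr d)))"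

(* The diameter of an unbounded set is an unspecified real in the library, so the covering sets
   have to be required to be bounded. Empty covering sets have diameter 0 and contribute 0. *)
definition hausdorff_pre :: "real \<Rightarrow> real \<Rightarrow> 'a::metric_space set \<Rightarrow> ennreal" where
  "hausdorff_pre d \<epsilon> A =
     (INF U \<in> {U :: nat \<Rightarrow> 'a set. A \<subseteq> (\<Union>i. U i) \<and> (\<forall>i. bounded (U i) \<and> diameter (U i) \<le> \<epsilon>)}.
        \<Sum>i. ennreal (diameter (U i) powr d))"

(* The d-dimensional Hausdorff (outer) measure, for d > 0, without a dimensional normalising
   factor. For d = 0 this would not be the counting measure, as 0 powr 0 = 0. *)
definition hausdorff_measure :: "real \<Rightarrow> 'a::metric_space set \<Rightarrow> ennreal" where
  "hausdorff_measure d A = (SUP \<epsilon> \<in> {0<..}. hausdorff_pre d \<epsilon> A)"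

definition partial_deriv :: "'a::euclidean_space \<Rightarrow> ('a \<Rightarrow> real) \<Rightarrow> 'a \<Rightarrow> real" where
  "partial_deriv b u x = deriv (\<lambda>t. u (x + t *\<^sub>R b)) 0"

definition laplacian :: "('a::euclidean_space \<Rightarrow> real) \<Rightarrow> 'a \<Rightarrow> real" where
  "laplacian u x = (\<Sum>b\<in>Basis. partial_deriv b (partial_deriv b u) x)"

(* Functions are total; on an open S the predicates below depend only on the values on S. *)
definition C2_on :: "'a::euclidean_space set \<Rightarrow> ('a \<Rightarrow> real) \<Rightarrow> bool" where
  "C2_on S u \<longleftrightarrow>
     (\<forall>x\<in>S. u differentiable (at x)) \<and>
     (\<forall>b\<in>Basis. \<forall>x\<in>S. partial_deriv b u differentiable (at x)) \<and>
     (\<forall>b\<in>Basis. \<forall>c\<in>Basis. continuous_on S (partial_deriv c (partial_deriv b u)))"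

definition harmonic_on :: "'a::euclidean_space set \<Rightarrow> ('a \<Rightarrow> real) \<Rightarrow> bool" where
  "harmonic_on S u \<longleftrightarrow> open S \<and> C2_on S u \<and> (\<forall>x\<in>S. laplacian u x = 0)"

(* Inversion in the unit circle; in the plane the Kelvin transform carries no weight. *)
definition harmonic_at_infinity :: "(real^2 \<Rightarrow> real) \<Rightarrow> bool" where
  "harmonic_at_infinity u \<longleftrightarrow>
     (\<exists>r>0. \<exists>v. harmonic_on (ball 0 r) v \<and>
        (\<forall>y \<in> ball 0 r - {0}. v y = u (y /\<^sub>R (norm y)\<^sup>2)))"

(* For the unbounded domain \<Omega> = complement of a compact set. *)
definition dirichlet_solution ::
  "(real^2) set \<Rightarrow> (real^2 \<Rightarrow> real) \<Rightarrow> (real^2 \<Rightarrow> real) \<Rightarrow> bool" where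
  "dirichlet_solution \<Omega> f u \<longleftrightarrow>
     harmonic_on \<Omega> u \<and> harmonic_at_infinity u \<and> bounded (u ` \<Omega>) \<and>
     continuous_on (closure \<Omega>) u \<and> (\<forall>z \<in> frontier \<Omega>. u z = f z)"

(* \<omega> is the harmonic measure of \<Omega> with pole at x. By the maximum principle the solution u, if it
   exists, is unique on \<Omega>. *)
definition is_harmonic_measure :: "(real^2) set \<Rightarrow> real^2 \<Rightarrow> (real^2) measure \<Rightarrow> bool" where
  "is_harmonic_measure \<Omega> x \<omega> \<longleftrightarrow>
     prob_space \<omega> \<and> sets \<omega> = sets (restrict_space borel (frontier \<Omega>)) \<and>
     (\<forall>f. continuous_on (frontier \<Omega>) f \<longrightarrow>
        (\<exists>u. dirichlet_solution \<Omega> f u \<and> u x = (\<integral>z. f z \<partial>\<omega>)))"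

(* G is the Green function of -\<Delta> in \<Omega> with pole at x: since -(1/(2 pi)) ln|y| is the fundamental
   solution of -\<Delta> in the plane, the first clause says that -\<Delta>G is the Dirac mass at x.
   The value of G at the pole itself is left unconstrained. *)
definition is_green_function :: "(real^2) set \<Rightarrow> real^2 \<Rightarrow> (real^2 \<Rightarrow> real) \<Rightarrow> bool" where
  "is_green_function \<Omega> x G \<longleftrightarrow>
     (\<exists>h. harmonic_on \<Omega> h \<and> (\<forall>y \<in> \<Omega> - {x}. G y = - (1 / (2 * pi)) * ln (dist y x) + h y)) \<and>
     (\<forall>y \<in> \<Omega> - {x}. G y > 0) \<and>
     continuous_on (closure \<Omega> - {x}) G \<and> (\<forall>z \<in> frontier \<Omega>. G z = 0) \<and>
     (\<exists>R M. \<forall>y \<in> \<Omega>. norm y \<ge> R \<longrightarrow> \<bar>G y\<bar> \<le> M)"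

end

theory Submission
  imports Defs "HOL-Complex_Analysis.Great_Picard" "HOL-Real_Asymp.Real_Asymp"
begin

text \<open>
  Given \<open>\<delta>\<close>, put \<open>L = ln 2 / \<delta>\<close> and \<open>r = exp (- L)\<close>, so that \<open>r powr \<delta> = 1 / 2\<close>. The set \<open>K\<close> is a Cantor set
  on a line that has, at each level \<open>m\<close>, \<open>2 ^ m\<close> cylinders of size about \<open>r ^ m\<close>; the natural measure \<open>M\<close>
  gives mass \<open>1 / 2 ^ m\<close> to each of them, and is therefore Ahlfors regular of dimension \<open>\<delta>\<close> and
  comparable to Hausdorff measure. What has to be arranged is that harmonic measure is comparable to
  \<open>M\<close>. For this, the length of the gap inside every cylinder is adjusted so that the logarithmic
  potential of \<open>M\<close> is \<^emph>\<open>constant\<close> on \<open>K\<close>; then \<open>M\<close> is the harmonic measure with pole at infinity. Since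
  all these sets lie on a line, one small number serves as both thresholds of the theorem.

  \<^emph>\<open>The gaps.\<close> The set is built from the top. At level \<open>m\<close>, the potential at a cylinder \<open>j\<close> is that of
  point masses \<open>1 / 2 ^ m\<close> at the centres \<open>z m i\<close> of the other cylinders, plus the contribution of
  \<open>j\<close> itself. In this contribution, half of the mass of \<open>j\<close> is seen across the gap
  \<open>len m j = r ^ m * exp (s m j)\<close>, and the gaps further down are taken at their standard sizes. The
  potential is the same for all \<open>j\<close> exactly if
  \<open>(\<Sum>i\<noteq>j. ln (dist (z m j) (z m i))) + s m j / 2 = - L * (2 ^ m - m - 1)\<close>, and this equation
  defines \<open>s m j\<close>. Comparing it with the equation for the parent of \<open>j\<close>, the large terms and the
  term \<open>s\<close> of the parent cancel, and what is left is a sum of dipole errors of size \<open>O(r)\<close>. Hence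
  the corrections \<open>s\<close> do not accumulate over the levels (\<open>well_separated_Suc\<close>), and in the limit
  the potential is constant (\<open>ker_const\<close>).

  \<^emph>\<open>Finite poles.\<close> The Green function with pole \<open>x\<close> is \<open>1 / (2 * pi)\<close> times
  \<open>- ln (dist x y) - pot \<phi> y + c\<close>, where \<open>pot \<phi>\<close> is the potential of the measure with density \<open>\<phi>\<close> with
  respect to \<open>M\<close>. It vanishes on \<open>K\<close> if the potential operator \<open>T\<close> satisfies
  \<open>T \<phi> = - ln (dist x w) + c\<close> there. On an ultrametric space with distances \<open>r ^ m\<close>, the operator \<open>T\<close>
  would be diagonal in the Haar basis, with eigenvalue \<open>L / 2 ^ m\<close> at level \<open>m\<close>; here it differs from
  that one by an operator with a bounded kernel that is regular away from the diagonal. As \<open>L\<close> is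
  large and \<open>T 1\<close> is constant, this is a small perturbation on functions whose oscillation over
  cylinders decays geometrically, and a Neumann series inverts \<open>T\<close> (\<open>T_solvable\<close>). The same operator
  solves the Dirichlet problem for locally constant data. By the symmetry of the kernel the solution
  at \<open>y\<close> is the integral of the data against the density \<open>\<Phi> y\<close> of the pole \<open>y\<close>, and uniform limits give
  all continuous data (\<open>dirichlet_solution_ex\<close>). So harmonic measure is \<open>M\<close> with density \<open>\<Phi> y\<close>.

  \<^emph>\<open>Bounds.\<close> The Green function \<open>green\<close> with pole at infinity is compared with \<open>infdist y K powr \<delta>\<close> by
  direct estimates (\<open>green_dist\<close>), and with the Green function of a finite pole by the maximum
  principle near \<open>K\<close> (\<open>Green_comparable\<close>). At the boundary the quotient of these two Green functions
  is the density \<open>\<Phi> x\<close> up to a factor \<open>2 * pi\<close>, so that this density is bounded below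
  (\<open>pole_density_lower\<close>).

  The harmonic functions that occur are real parts of holomorphic functions on every disc in their
  domain, a property that Montel's theorem transports to limits. Uniqueness of Green functions and of
  Dirichlet solutions follows from the maximum principle, with \<open>green\<close> as a barrier at infinity.
\<close>

section \<open>Partial derivatives and the weak maximum principle\<close>

lemma partial_deriv_eqI:
  fixes u :: "'a::euclidean_space \<Rightarrow> real"
  assumes "((\<lambda>t. u (x + t *\<^sub>R b)) has_real_derivative D) (at 0)"
  shows "partial_deriv b u x = D"
  using assms unfolding partial_deriv_def by (rule DERIV_imp_deriv)

lemma differentiable_along_line:
  fixes u :: "'a::euclidean_space \<Rightarrow> real"
  assumes "u differentiable (at (x + t *\<^sub>R b))"
  shows "((\<lambda>s. u (x + s *\<^sub>R b)) has_real_derivative partial_deriv b u (x + t *\<^sub>R b)) (at t)"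
proof -
  obtain u' where u': "(u has_derivative u') (at (x + t *\<^sub>R b))"
    using assms differentiable_def by blast
  have *: "((\<lambda>s. u (y + s *\<^sub>R b)) has_real_derivative u' b) (at q)" if "y + q *\<^sub>R b = x + t *\<^sub>R b" for y q
  proof -
    have "((\<lambda>s. y + s *\<^sub>R b) has_derivative (\<lambda>h. h *\<^sub>R b)) (at q)"
      by (auto intro!: derivative_eq_intros)
    then have "((\<lambda>s. u (y + s *\<^sub>R b)) has_derivative (\<lambda>h. u' (h *\<^sub>R b))) (at q)"
      using has_derivative_compose[of "\<lambda>s. y + s *\<^sub>R b" _ q UNIV u u'] u' that by simp
    moreover have "u' (h *\<^sub>R b) = u' b * h" for h
      using linear_scale[OF has_derivative_linear[OF u']] by simp
    ultimately show ?thesis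
      by (simp add: has_field_derivative_def)
  qed
  have "partial_deriv b u (x + t *\<^sub>R b) = u' b"
    by (rule partial_deriv_eqI, rule *) simp
  then show ?thesis using *[of x t] by simp
qed

lemma partial_deriv_cong_open:
  fixes u v :: "'a::euclidean_space \<Rightarrow> real"
  assumes "open S" "x \<in> S" "\<And>y. y \<in> S \<Longrightarrow> u y = v y"
  shows "partial_deriv b u x = partial_deriv b v x"
proof -
  have "open ((\<lambda>t::real. x + t *\<^sub>R b) -` S)"
    by (intro open_vimage assms continuous_intros)
  moreover have "0 \<in> (\<lambda>t::real. x + t *\<^sub>R b) -` S" using assms by simp
  ultimately have "eventually (\<lambda>t. t \<in> (\<lambda>t::real. x + t *\<^sub>R b) -` S) (nhds 0)"
    by (rule eventually_nhds_in_open)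
  then have "eventually (\<lambda>t. u (x + t *\<^sub>R b) = v (x + t *\<^sub>R b)) (nhds 0)"
    by eventually_elim (simp add: assms)
  then show ?thesis unfolding partial_deriv_def by (rule deriv_cong_ev) simp
qed

lemma partial_deriv_lin:
  fixes u v :: "'a::euclidean_space \<Rightarrow> real"
  assumes "u differentiable (at x)" "v differentiable (at x)"
  shows "partial_deriv b (\<lambda>y. \<alpha> * u y + \<beta> * v y) x = \<alpha> * partial_deriv b u x + \<beta> * partial_deriv b v x"
proof (rule partial_deriv_eqI)
  have "((\<lambda>t. u (x + t *\<^sub>R b)) has_real_derivative partial_deriv b u x) (at 0)"
       "((\<lambda>t. v (x + t *\<^sub>R b)) has_real_derivative partial_deriv b v x) (at 0)"
    using differentiable_along_line[of u x 0 b] differentiable_along_line[of v x 0 b] assms by auto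
  then show "((\<lambda>t. \<alpha> * u (x + t *\<^sub>R b) + \<beta> * v (x + t *\<^sub>R b)) has_real_derivative
      \<alpha> * partial_deriv b u x + \<beta> * partial_deriv b v x) (at 0)"
    by (auto intro!: derivative_eq_intros)
qed

lemma differentiable_lin:
  fixes u v :: "'a::euclidean_space \<Rightarrow> real"
  assumes "u differentiable (at x)" "v differentiable (at x)"
  shows "(\<lambda>y. \<alpha> * u y + \<beta> * v y) differentiable (at x)"
  by (intro differentiable_add differentiable_mult differentiable_const assms)

lemma differentiable_cong_open:
  assumes "open S" "x \<in> S" "\<And>y. y \<in> S \<Longrightarrow> u y = v y" "v differentiable (at x)"
  shows "u differentiable (at x)"
  using assms has_derivative_transform_within_open[of v _ x UNIV S u] unfolding differentiable_def by metis

lemma harmonic_on_lin: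
  fixes u v :: "'a::euclidean_space \<Rightarrow> real"
  assumes u: "harmonic_on S u" and v: "harmonic_on S v"
  shows "harmonic_on S (\<lambda>x. \<alpha> * u x + \<beta> * v x)"
proof -
  let ?w = "\<lambda>x. \<alpha> * u x + \<beta> * v x"
  have S: "open S" using u by (simp add: harmonic_on_def)
  have du: "u differentiable (at x)" and dv: "v differentiable (at x)" if "x \<in> S" for x
    using u v that by (auto simp: harmonic_on_def C2_on_def)
  have ddu: "partial_deriv b u differentiable (at x)" and ddv: "partial_deriv b v differentiable (at x)"
    if "x \<in> S" "b \<in> Basis" for x b
    using u v that by (auto simp: harmonic_on_def C2_on_def)
  have p1: "partial_deriv b ?w x = \<alpha> * partial_deriv b u x + \<beta> * partial_deriv b v x" if "x \<in> S" for b x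
    by (intro partial_deriv_lin du dv that)
  have p2: "partial_deriv c (partial_deriv b ?w) x
      = \<alpha> * partial_deriv c (partial_deriv b u) x + \<beta> * partial_deriv c (partial_deriv b v) x"
    if "x \<in> S" "b \<in> Basis" for b c x
  proof -
    have "partial_deriv c (partial_deriv b ?w) x =
        partial_deriv c (\<lambda>y. \<alpha> * partial_deriv b u y + \<beta> * partial_deriv b v y) x"
      using S that(1) p1 by (rule partial_deriv_cong_open)
    also have "\<dots> = \<alpha> * partial_deriv c (partial_deriv b u) x + \<beta> * partial_deriv c (partial_deriv b v) x"
      by (intro partial_deriv_lin ddu ddv that)
    finally show ?thesis .
  qed
  have d1: "partial_deriv b ?w differentiable (at x)" if "x \<in> S" "b \<in> Basis" for x b
    by (rule differentiable_cong_open[OF S that(1) p1]) (auto intro!: differentiable_lin ddu ddv that)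
  have "continuous_on S (partial_deriv c (partial_deriv b ?w))" if "b \<in> Basis" "c \<in> Basis" for b c
  proof -
    have "continuous_on S (\<lambda>x. \<alpha> * partial_deriv c (partial_deriv b u) x + \<beta> * partial_deriv c (partial_deriv b v) x)"
      using u v that by (intro continuous_intros) (auto simp: harmonic_on_def C2_on_def)
    then show ?thesis
      using p2 that by (subst continuous_on_cong[OF refl p2]) auto
  qed
  moreover have "laplacian ?w x = 0" if "x \<in> S" for x
  proof -
    have "laplacian ?w x = \<alpha> * laplacian u x + \<beta> * laplacian v x"
      unfolding laplacian_def using p2[OF that]
      by (simp add: sum.distrib sum_distrib_left)
    then show ?thesis using u v that by (simp add: harmonic_on_def)
  qed
  ultimately show ?thesis
    unfolding harmonic_on_def C2_on_def using S d1 differentiable_lin[OF du dv] by auto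
qed

lemma harmonic_on_cong:
  assumes u: "harmonic_on S u" and eq: "\<And>y. y \<in> S \<Longrightarrow> v y = u y"
  shows "harmonic_on S v"
proof -
  have S: "open S" using u by (simp add: harmonic_on_def)
  have p1: "partial_deriv b v x = partial_deriv b u x" if "x \<in> S" for b x
    using S that eq by (rule partial_deriv_cong_open)
  have p2: "partial_deriv c (partial_deriv b v) x = partial_deriv c (partial_deriv b u) x" if "x \<in> S" for b c x
    using S that p1 by (rule partial_deriv_cong_open)
  have "v differentiable (at x)" if "x \<in> S" for x
    by (rule differentiable_cong_open[OF S that eq]) (use u that in \<open>auto simp: harmonic_on_def C2_on_def\<close>)
  moreover have "partial_deriv b v differentiable (at x)" if "x \<in> S" "b \<in> Basis" for x b
    by (rule differentiable_cong_open[OF S that(1) p1]) (use u that in \<open>auto simp: harmonic_on_def C2_on_def\<close>)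
  moreover have "continuous_on S (partial_deriv c (partial_deriv b v))" if "b \<in> Basis" "c \<in> Basis" for b c
    using u that by (subst continuous_on_cong[OF refl p2]) (auto simp: harmonic_on_def C2_on_def)
  moreover have "laplacian v x = 0" if "x \<in> S" for x
    using u that p2[OF that] by (simp add: harmonic_on_def laplacian_def)
  ultimately show ?thesis using S unfolding harmonic_on_def C2_on_def by blast
qed

lemma harmonic_on_imp_continuous_on:
  "harmonic_on S u \<Longrightarrow> continuous_on S u"
  unfolding harmonic_on_def C2_on_def
  by (auto intro!: continuous_at_imp_continuous_on differentiable_imp_continuous_within)

lemma harmonic_on_subset:
  "harmonic_on S u \<Longrightarrow> open T \<Longrightarrow> T \<subseteq> S \<Longrightarrow> harmonic_on T u"
  unfolding harmonic_on_def C2_on_def by (blast intro: continuous_on_subset)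

lemma second_derivative_at_local_max:
  fixes f :: "real \<Rightarrow> real"
  assumes f: "\<And>t. \<bar>t\<bar> < d \<Longrightarrow> (f has_real_derivative f' t) (at t)" and "d > 0"
    and f': "(f' has_real_derivative D) (at 0)"
    and le: "\<And>t. \<bar>t\<bar> < d \<Longrightarrow> f t \<le> f 0"
  shows "D \<le> 0"
proof (rule ccontr)
  assume "\<not> D \<le> 0"
  then have "D > 0" by simp
  have f0: "f' 0 = 0"
    by (rule DERIV_local_max[OF f[of 0] \<open>d > 0\<close>]) (use le \<open>d > 0\<close> in auto)
  obtain e where e: "e > 0" "\<And>h. h > 0 \<Longrightarrow> h < e \<Longrightarrow> f' 0 < f' (0 + h)"
    using DERIV_pos_inc_right[OF f' \<open>D > 0\<close>] by blast
  define t where "t = min d e / 2"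
  have t: "0 < t" "t < d" "t < e" using e \<open>d > 0\<close> by (auto simp: t_def)
  obtain s where s: "0 < s" "s < t" "f t - f 0 = (t - 0) * f' s"
    using MVT2[of 0 t f f'] t f by force
  have "f' s > 0" using e(2)[of s] s t f0 by simp
  then have "f t > f 0" using s t by (smt (verit) mult_pos_pos)
  then show False using le[of t] t by simp
qed

text \<open>Adding \<open>\<epsilon> |x|\<^sup>2\<close> makes the Laplacian strictly positive, and then some pure second
  derivative is positive at every interior point, which an interior maximum excludes.\<close>

theorem harmonic_weak_maximum_principle:
  fixes u :: "'a::euclidean_space \<Rightarrow> real"
  assumes u: "harmonic_on S u" and bS: "bounded S" and cont: "continuous_on (closure S) u"
    and le: "\<And>x. x \<in> frontier S \<Longrightarrow> u x \<le> c" and x: "x \<in> S"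
  shows "u x \<le> c"
proof (rule field_le_epsilon)
  fix \<eta> :: real assume "\<eta> > 0"
  have S: "open S" using u by (simp add: harmonic_on_def)
  have comp: "compact (closure S)" using bS by simp
  obtain R where R: "R > 0" "\<And>y. y \<in> closure S \<Longrightarrow> norm y \<le> R"
    using bS bounded_closure bounded_pos by metis
  define \<epsilon> where "\<epsilon> = \<eta> / R\<^sup>2"
  have eps: "\<epsilon> > 0" "\<epsilon> * R\<^sup>2 = \<eta>" using \<open>\<eta> > 0\<close> R by (auto simp: \<epsilon>_def)
  define v where "v y = u y + \<epsilon> * (y \<bullet> y)" for y
  have "continuous_on (closure S) v" unfolding v_def by (intro continuous_intros cont)
  then obtain p where p: "p \<in> closure S" "\<And>y. y \<in> closure S \<Longrightarrow> v y \<le> v p"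
    using continuous_attains_sup[OF comp] x closure_subset by (metis emptyE subsetD)
  have "p \<notin> S"
  proof
    assume pS: "p \<in> S"
    obtain d where d: "d > 0" "ball p d \<subseteq> S" using S pS openE by blast
    have "partial_deriv b (partial_deriv b u) p + 2 * \<epsilon> \<le> 0" if b: "b \<in> Basis" for b
    proof (rule second_derivative_at_local_max)
      fix t :: real assume t: "\<bar>t\<bar> < d"
      then have pt: "p + t *\<^sub>R b \<in> S" using d b by (auto simp: dist_norm intro!: subsetD[OF d(2)])
      have dl: "((\<lambda>t. u (p + t *\<^sub>R b)) has_real_derivative partial_deriv b u (p + t *\<^sub>R b)) (at t)"
        using u pt by (intro differentiable_along_line) (auto simp: harmonic_on_def C2_on_def)
      have "((\<lambda>t. (p \<bullet> p) + 2 * t * (p \<bullet> b) + t\<^sup>2) has_real_derivative 2 * (p \<bullet> b) + 2 * t) (at t)"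
        by (auto intro!: derivative_eq_intros)
      moreover have "(p + t *\<^sub>R b) \<bullet> (p + t *\<^sub>R b) = (p \<bullet> p) + 2 * t * (p \<bullet> b) + t\<^sup>2" for t
        using b by (simp add: inner_add_left inner_add_right inner_commute power2_eq_square algebra_simps)
      ultimately have "((\<lambda>t. (p + t *\<^sub>R b) \<bullet> (p + t *\<^sub>R b)) has_real_derivative 2 * (p \<bullet> b) + 2 * t) (at t)"
        by simp
      from DERIV_add[OF dl DERIV_cmult[OF this, of \<epsilon>]]
      show "((\<lambda>t. v (p + t *\<^sub>R b)) has_real_derivative
          partial_deriv b u (p + t *\<^sub>R b) + \<epsilon> * (2 * (p \<bullet> b) + 2 * t)) (at t)"
        unfolding v_def .
      show "v (p + t *\<^sub>R b) \<le> v (p + 0 *\<^sub>R b)"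
        using p(2) pt closure_subset by auto
    next
      have dl: "((\<lambda>t. partial_deriv b u (p + t *\<^sub>R b)) has_real_derivative
          partial_deriv b (partial_deriv b u) (p + 0 *\<^sub>R b)) (at 0)"
        using u pS b by (intro differentiable_along_line) (auto simp: harmonic_on_def C2_on_def)
      show "((\<lambda>t. partial_deriv b u (p + t *\<^sub>R b) + \<epsilon> * (2 * (p \<bullet> b) + 2 * t)) has_real_derivative
          partial_deriv b (partial_deriv b u) p + 2 * \<epsilon>) (at 0)"
        using dl by (auto intro!: derivative_eq_intros)
    qed (use d in auto)
    then have "(\<Sum>b\<in>Basis. partial_deriv b (partial_deriv b u) p + 2 * \<epsilon>) \<le> 0"
      by (rule sum_nonpos)
    then have "laplacian u p + DIM('a) * (2 * \<epsilon>) \<le> 0"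
      by (simp add: laplacian_def sum.distrib)
    moreover have "laplacian u p = 0" using u pS by (simp add: harmonic_on_def)
    moreover have "DIM('a) * (2 * \<epsilon>) > 0" using eps by simp
    ultimately show False by linarith
  qed
  then have "p \<in> frontier S" using p(1) S by (simp add: frontier_def interior_open)
  then have "u p \<le> c" by (rule le)
  moreover have "\<epsilon> * (p \<bullet> p) \<le> \<epsilon> * R\<^sup>2"
    using R(2)[OF p(1)] eps(1) by (simp add: dot_square_norm power_mono)
  moreover have "v x \<le> v p" using p(2) x closure_subset by auto
  moreover have "\<epsilon> * (x \<bullet> x) \<ge> 0" using eps by simp
  ultimately show "u x \<le> c + \<eta>" unfolding v_def using eps(2) by linarith
qed

section \<open>Functions that are real parts of holomorphic functions on every disc\<close>

definition cx :: "real^2 \<Rightarrow> complex" where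
  "cx y = Complex (y $ 1) (y $ 2)"

lemma bounded_linear_cx: "bounded_linear cx"
proof -
  have "linear cx" by (rule linearI) (auto simp: cx_def complex_eq_iff)
  then show ?thesis by (simp add: linear_linear)
qed

lemma cx_add: "cx (x + y) = cx x + cx y" and cx_diff: "cx (x - y) = cx x - cx y"
  and cx_scale: "cx (a *\<^sub>R x) = a *\<^sub>R cx x" and cx_0 [simp]: "cx 0 = 0"
  by (auto simp: cx_def complex_eq_iff)

lemma norm_cx: "norm (cx y) = norm y"
  by (simp add: cx_def norm_vec_def L2_set_def sum_2 cmod_def)

lemma dist_cx: "dist (cx x) (cx y) = dist x y"
  by (simp add: dist_norm cx_diff[symmetric] norm_cx)

lemma vector_2_eq_axis: "(vector [a, b] :: real^2) = a *\<^sub>R axis 1 1 + b *\<^sub>R axis 2 1"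
  by (simp add: vec_eq_iff forall_2 axis_def)

lemma cx_surj: obtains y where "z = cx y"
proof
  show "z = cx (vector [Re z, Im z])" by (simp add: cx_def)
qed

lemma cx_Basis:
  assumes "b \<in> Basis"
  shows "cx b = (if b = axis 1 1 then 1 else \<i>)"
proof -
  have "b = axis 1 1 \<or> b = axis 2 1"
    using assms by (auto simp: Basis_vec_def exhaust_2) (metis exhaust_2)
  then show ?thesis
    by (auto simp: cx_def complex_eq_iff axis_def)
qed

lemma Basis_real2: "(Basis :: (real^2) set) = {axis 1 1, axis 2 1}"
  by (auto simp: Basis_vec_def) (metis exhaust_2)

text \<open>Asking for a holomorphic function on every disc inside \<open>S\<close>, and not only on a small disc around each
  point, spares the patching of local conjugates when limits are taken: a fixed disc works for the
  whole sequence.\<close>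

definition conjugable_on :: "(real^2) set \<Rightarrow> (real^2 \<Rightarrow> real) \<Rightarrow> bool" where
  "conjugable_on S u \<longleftrightarrow> open S \<and>
     (\<forall>p e. e > 0 \<and> ball p e \<subseteq> S \<longrightarrow>
        (\<exists>F. F holomorphic_on ball (cx p) e \<and> (\<forall>y\<in>ball p e. u y = Re (F (cx y)))))"

lemma conjugable_onE:
  assumes "conjugable_on S u" "e > 0" "ball p e \<subseteq> S"
  obtains F where "F holomorphic_on ball (cx p) e" "\<And>y. y \<in> ball p e \<Longrightarrow> u y = Re (F (cx y))"
  using assms unfolding conjugable_on_def by meson

lemma conjugable_onI:
  assumes "open S"
    and "\<And>p e. e > 0 \<Longrightarrow> ball p e \<subseteq> S \<Longrightarrow> \<exists>F. F holomorphic_on ball (cx p) e \<and> (\<forall>y\<in>ball p e. u y = Re (F (cx y)))"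
  shows "conjugable_on S u"
  using assms unfolding conjugable_on_def by meson

lemma conjugable_on_const: "open S \<Longrightarrow> conjugable_on S (\<lambda>_. c)"
  by (intro conjugable_onI exI[of _ "\<lambda>_. complex_of_real c"]) (auto intro!: holomorphic_intros)

lemma conjugable_on_add:
  assumes "conjugable_on S u" "conjugable_on S v"
  shows "conjugable_on S (\<lambda>y. u y + v y)"
proof (rule conjugable_onI)
  show "open S" using assms(1) by (simp add: conjugable_on_def)
  fix p :: "real^2" and e :: real assume pe: "e > 0" "ball p e \<subseteq> S"
  obtain F where F: "F holomorphic_on ball (cx p) e" "\<And>y. y \<in> ball p e \<Longrightarrow> u y = Re (F (cx y))"
    using conjugable_onE[OF assms(1) pe] by blast
  obtain G where G: "G holomorphic_on ball (cx p) e" "\<And>y. y \<in> ball p e \<Longrightarrow> v y = Re (G (cx y))"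
    using conjugable_onE[OF assms(2) pe] by blast
  show "\<exists>F. F holomorphic_on ball (cx p) e \<and> (\<forall>y\<in>ball p e. u y + v y = Re (F (cx y)))"
    using F G by (intro exI[of _ "\<lambda>z. F z + G z"]) (auto intro!: holomorphic_intros)
qed

lemma conjugable_on_cmult:
  assumes "conjugable_on S u"
  shows "conjugable_on S (\<lambda>y. c * u y)"
proof (rule conjugable_onI)
  show "open S" using assms(1) by (simp add: conjugable_on_def)
  fix p :: "real^2" and e :: real assume pe: "e > 0" "ball p e \<subseteq> S"
  obtain F where F: "F holomorphic_on ball (cx p) e" "\<And>y. y \<in> ball p e \<Longrightarrow> u y = Re (F (cx y))"
    using conjugable_onE[OF assms(1) pe] by blast
  show "\<exists>F. F holomorphic_on ball (cx p) e \<and> (\<forall>y\<in>ball p e. c * u y = Re (F (cx y)))"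
    using F by (intro exI[of _ "\<lambda>z. complex_of_real c * F z"]) (auto intro!: holomorphic_intros)
qed

lemma conjugable_on_sum:
  assumes "open S" "\<And>i. i \<in> I \<Longrightarrow> conjugable_on S (u i)"
  shows "conjugable_on S (\<lambda>y. \<Sum>i\<in>I. u i y)"
  using assms(2)
  by (induction I rule: infinite_finite_induct)
     (auto intro: conjugable_on_const[OF assms(1)] conjugable_on_add)

lemma conjugable_on_cong:
  "conjugable_on S u \<Longrightarrow> (\<And>y. y \<in> S \<Longrightarrow> u y = v y) \<Longrightarrow> conjugable_on S v"
  unfolding conjugable_on_def by (metis subsetD)

lemma conjugable_on_subset:
  "conjugable_on S u \<Longrightarrow> open T \<Longrightarrow> T \<subseteq> S \<Longrightarrow> conjugable_on T u"
  unfolding conjugable_on_def by (meson subset_trans)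

lemma conjugable_on_ln_norm_affine:
  assumes S: "open S" and nz: "\<And>y. y \<in> S \<Longrightarrow> a *\<^sub>R y + b \<noteq> 0"
  shows "conjugable_on S (\<lambda>y. ln (norm (a *\<^sub>R y + b)))"
proof (rule conjugable_onI[OF S])
  fix p :: "real^2" and e :: real assume pe: "e > 0" "ball p e \<subseteq> S"
  obtain g where g: "g holomorphic_on ball (cx p) e"
     "\<And>z. z \<in> ball (cx p) e \<Longrightarrow> exp (g z) = a *\<^sub>R z + cx b"
  proof (rule holomorphic_logarithm_exists[of "ball (cx p) e" "\<lambda>z. a *\<^sub>R z + cx b" "cx p"])
    show "(\<lambda>z. a *\<^sub>R z + cx b) holomorphic_on ball (cx p) e"
      unfolding scaleR_conv_of_real by (intro holomorphic_intros)
    show "a *\<^sub>R z + cx b \<noteq> 0" if "z \<in> ball (cx p) e" for z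
    proof -
      obtain y where y: "z = cx y" by (rule cx_surj)
      have "y \<in> S" using that pe y by (auto simp: dist_cx)
      then have "norm (cx (a *\<^sub>R y + b)) \<noteq> 0" using nz by (simp add: norm_cx)
      then show ?thesis by (auto simp: y cx_add cx_scale)
    qed
  qed (use pe in auto)
  have "ln (norm (a *\<^sub>R y + b)) = Re (g (cx y))" if "y \<in> ball p e" for y
  proof -
    have "exp (Re (g (cx y))) = norm (exp (g (cx y)))" by simp
    also have "\<dots> = norm (cx (a *\<^sub>R y + b))" using g(2)[of "cx y"] that by (simp add: dist_cx cx_add cx_scale)
    finally show ?thesis by (metis ln_exp norm_cx)
  qed
  then show "\<exists>F. F holomorphic_on ball (cx p) e \<and> (\<forall>y\<in>ball p e. ln (norm (a *\<^sub>R y + b)) = Re (F (cx y)))"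
    using g by blast
qed

lemma conjugable_derivative:
  assumes F: "F holomorphic_on ball (cx p) e" and u: "\<And>y. y \<in> ball p e \<Longrightarrow> u y = Re (F (cx y))"
    and y: "y \<in> ball p e"
  shows "(u has_derivative (\<lambda>h. Re (deriv F (cx y) * cx h))) (at y)"
proof -
  have "cx y \<in> ball (cx p) e" using y by (simp add: dist_cx)
  then have "(F has_field_derivative deriv F (cx y)) (at (cx y))"
    using F holomorphic_derivI open_ball by blast
  then have "(F has_derivative (\<lambda>h. deriv F (cx y) * h)) (at (cx y))"
    by (simp add: has_field_derivative_def)
  moreover have "(cx has_derivative cx) (at y)"
    by (rule bounded_linear_imp_has_derivative[OF bounded_linear_cx])
  ultimately have "((\<lambda>y. F (cx y)) has_derivative (\<lambda>h. deriv F (cx y) * cx h)) (at y)"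
    using has_derivative_compose[of cx cx y UNIV F] by simp
  then have "((\<lambda>y. Re (F (cx y))) has_derivative (\<lambda>h. Re (deriv F (cx y) * cx h))) (at y)"
    by (rule has_derivative_Re)
  then show ?thesis
    by (rule has_derivative_transform_within_open[OF _ open_ball y]) (simp add: u)
qed

lemma conjugable_partial_deriv:
  assumes F: "F holomorphic_on ball (cx p) e" and u: "\<And>y. y \<in> ball p e \<Longrightarrow> u y = Re (F (cx y))"
    and y: "y \<in> ball p e"
  shows "partial_deriv b u y = Re (cx b * deriv F (cx y))"
proof (rule partial_deriv_eqI)
  have "((\<lambda>t. y + t *\<^sub>R b) has_derivative (\<lambda>h. h *\<^sub>R b)) (at 0)"
    by (auto intro!: derivative_eq_intros)
  then have "((\<lambda>t. u (y + t *\<^sub>R b)) has_derivative (\<lambda>h. Re (deriv F (cx y) * cx (h *\<^sub>R b)))) (at 0)"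
    using has_derivative_compose[of "\<lambda>t. y + t *\<^sub>R b" _ 0 UNIV u] conjugable_derivative[OF F u y] by simp
  moreover have "Re (deriv F (cx y) * cx (h *\<^sub>R b)) = Re (cx b * deriv F (cx y)) * h" for h
    by (simp add: cx_scale algebra_simps)
  ultimately show "((\<lambda>t. u (y + t *\<^sub>R b)) has_real_derivative Re (cx b * deriv F (cx y))) (at 0)"
    by (simp add: has_field_derivative_def)
qed

lemma conjugable_on_imp_differentiable:
  assumes "conjugable_on S u" "x \<in> S"
  shows "u differentiable (at x)"
proof -
  obtain e where e: "e > 0" "ball x e \<subseteq> S" using assms openE conjugable_on_def by metis
  show ?thesis
    using conjugable_onE[OF assms(1) e] conjugable_derivative[of _ x e u x] e(1)
    by (metis centre_in_ball differentiable_def)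
qed

text \<open>A partial derivative of \<open>Re F\<close> is the real part of \<open>F'\<close> or of \<open>\<i> * F'\<close>, so that the class is closed
  under partial derivatives and its members are smooth.\<close>

lemma conjugable_on_partial_deriv:
  assumes "conjugable_on S u"
  shows "conjugable_on S (partial_deriv b u)"
proof (rule conjugable_onI)
  show "open S" using assms by (simp add: conjugable_on_def)
  fix p :: "real^2" and e :: real assume pe: "e > 0" "ball p e \<subseteq> S"
  obtain F where F: "F holomorphic_on ball (cx p) e" "\<And>y. y \<in> ball p e \<Longrightarrow> u y = Re (F (cx y))"
    using conjugable_onE[OF assms pe] by blast
  show "\<exists>G. G holomorphic_on ball (cx p) e \<and> (\<forall>y\<in>ball p e. partial_deriv b u y = Re (G (cx y)))"
    using conjugable_partial_deriv[OF F] F(1)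
    by (intro exI[of _ "\<lambda>z. cx b * deriv F z"]) (auto intro!: holomorphic_intros)
qed

theorem conjugable_on_imp_harmonic_on:
  assumes u: "conjugable_on S u"
  shows "harmonic_on S u"
proof -
  have S: "open S" using u by (simp add: conjugable_on_def)
  have "laplacian u x = 0" if x: "x \<in> S" for x
  proof -
    obtain e where e: "e > 0" "ball x e \<subseteq> S" using S x openE by metis
    obtain F where F: "F holomorphic_on ball (cx x) e" "\<And>y. y \<in> ball x e \<Longrightarrow> u y = Re (F (cx y))"
      using conjugable_onE[OF u e] by blast
    have "partial_deriv b (partial_deriv b u) x = Re (cx b * (cx b * deriv (deriv F) (cx x)))" for b
    proof -
      have G: "(\<lambda>z. cx b * deriv F z) holomorphic_on ball (cx x) e"
        by (intro holomorphic_intros F) auto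
      have "partial_deriv b (partial_deriv b u) x = Re (cx b * deriv (\<lambda>z. cx b * deriv F z) (cx x))"
        by (rule conjugable_partial_deriv[OF G conjugable_partial_deriv[OF F]]) (use e in auto)
      also have "deriv (\<lambda>z. cx b * deriv F z) (cx x) = cx b * deriv (deriv F) (cx x)"
        by (rule deriv_cmult, rule holomorphic_on_imp_differentiable_at[OF _ open_ball])
           (use e F in \<open>auto intro!: holomorphic_intros\<close>)
      finally show ?thesis .
    qed
    moreover have "axis 1 1 \<noteq> (axis 2 1 :: real^2)" by (simp add: axis_eq_axis)
    ultimately show ?thesis
      unfolding laplacian_def by (simp add: Basis_real2 cx_Basis)
  qed
  moreover have "continuous_on S v" if "conjugable_on S v" for v
    by (intro continuous_at_imp_continuous_on ballI differentiable_imp_continuous_within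
        conjugable_on_imp_differentiable[OF that])
  ultimately show ?thesis
    unfolding harmonic_on_def C2_on_def
    using S u by (auto intro: conjugable_on_imp_differentiable conjugable_on_partial_deriv)
qed

lemma conjugable_on_imp_continuous_on: "conjugable_on S u \<Longrightarrow> continuous_on S u"
  by (rule harmonic_on_imp_continuous_on) (rule conjugable_on_imp_harmonic_on)

text \<open>If \<open>u n = Re (F n)\<close> converge, then the functions \<open>exp (F n)\<close>, of modulus \<open>exp (u n)\<close>, are
  locally bounded, so that by Montel's theorem a subsequence converges to a holomorphic function
  whose modulus is the exponential of the limit. A logarithm of it has the limit as real part. This
  needs no control of the imaginary parts.\<close>

theorem conjugable_on_uniform_limit:
  assumes u: "\<And>n. conjugable_on S (u n)"
    and lim: "\<And>C. compact C \<Longrightarrow> C \<subseteq> S \<Longrightarrow> uniform_limit C u v sequentially"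
  shows "conjugable_on S v"
proof (rule conjugable_onI)
  show S: "open S" using u[of 0] by (simp add: conjugable_on_def)
  fix p :: "real^2" and e :: real assume pe: "e > 0" "ball p e \<subseteq> S"
  let ?B = "ball (cx p) e"
  have "\<forall>n. \<exists>F. F holomorphic_on ?B \<and> (\<forall>y\<in>ball p e. u n y = Re (F (cx y)))"
    using conjugable_onE[OF u pe] by metis
  then obtain F where F: "\<And>n. F n holomorphic_on ?B" "\<And>n y. y \<in> ball p e \<Longrightarrow> u n y = Re (F n (cx y))"
    by metis
  define E where "E n z = exp (F n z)" for n z
  have normE: "norm (E n (cx y)) = exp (u n y)" if "y \<in> ball p e" for n y
    using F(2)[OF that] by (simp add: E_def)
  obtain g q where g: "g holomorphic_on ?B" "strict_mono q"
      "\<And>z. z \<in> ?B \<Longrightarrow> (\<lambda>n. E (q n) z) \<longlonglongrightarrow> g z"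
  proof (rule Montel[of ?B "range E" E])
    show "h holomorphic_on ?B" if "h \<in> range E" for h
      using that F(1) unfolding E_def by (auto intro!: holomorphic_intros)
    fix C assume C: "compact C" "C \<subseteq> ?B"
    have "\<exists>b. \<forall>z\<in>C. norm (F n z) \<le> b" for n
    proof -
      have "continuous_on C (F n)" using F(1)[of n] C(2)
        using holomorphic_on_imp_continuous_on holomorphic_on_subset by blast
      then have "bounded (F n ` C)" using C(1) compact_continuous_image compact_imp_bounded by blast
      then show ?thesis by (auto simp: bounded_iff)
    qed
    then obtain b where b: "\<And>n z. z \<in> C \<Longrightarrow> norm (F n z) \<le> b n" by metis
    define C' where "C' = (\<lambda>z. vector [Re z, Im z] :: real^2) ` C"
    have "continuous_on C (\<lambda>z. vector [Re z, Im z] :: real^2)"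
      unfolding vector_2_eq_axis by (intro continuous_intros)
    then have "compact C'" unfolding C'_def by (rule compact_continuous_image[OF _ C(1)])
    moreover have C'_iff: "y \<in> C' \<longleftrightarrow> cx y \<in> C" for y
    proof -
      have "cx (vector [Re z, Im z]) = z" for z by (simp add: cx_def)
      moreover have "vector [Re (cx y), Im (cx y)] = y" by (simp add: cx_def vec_eq_iff forall_2)
      ultimately show ?thesis unfolding C'_def by (metis (no_types, lifting) image_iff)
    qed
    moreover have "C' \<subseteq> S"
    proof
      fix y assume "y \<in> C'"
      then have "cx y \<in> ball (cx p) e" using C(2) C'_iff by blast
      then have "y \<in> ball p e" by (simp add: dist_cx)
      then show "y \<in> S" using pe(2) by blast
    qed
    ultimately have "\<forall>\<^sub>F n in sequentially. \<forall>y\<in>C'. dist (u n y) (v y) < 1 / 2"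
      by (intro uniform_limitD[OF lim]) auto
    then obtain N where N: "\<And>n y. n \<ge> N \<Longrightarrow> y \<in> C' \<Longrightarrow> dist (u n y) (v y) < 1 / 2"
      unfolding eventually_sequentially by blast
    have "norm (E n z) \<le> exp ((\<Sum>i\<le>N. \<bar>b i\<bar>) + 1)" if z: "z \<in> C" for n z
    proof -
      obtain y where y: "z = cx y" by (rule cx_surj)
      have yb: "y \<in> ball p e" and yC: "y \<in> C'" using z C y C'_iff by (auto simp: dist_cx)
      have le: "u i y \<le> (\<Sum>i\<le>N. \<bar>b i\<bar>)" if "i \<le> N" for i
      proof -
        have "u i y \<le> norm (F i z)" using F(2)[OF yb] y complex_Re_le_cmod by simp
        also have "\<dots> \<le> \<bar>b i\<bar>" using b[OF z, of i] by simp
        also have "\<dots> \<le> (\<Sum>i\<le>N. \<bar>b i\<bar>)" using that by (intro member_le_sum) auto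
        finally show ?thesis .
      qed
      have "u n y \<le> (\<Sum>i\<le>N. \<bar>b i\<bar>) + 1"
      proof (cases "n \<le> N")
        case False
        then have "dist (u n y) (v y) < 1/2" "dist (u N y) (v y) < 1/2" using N yC by auto
        then have "u n y \<le> u N y + 1" unfolding dist_real_def by linarith
        then show ?thesis using le[of N] by simp
      qed (use le[of n] in simp)
      then show ?thesis using normE[OF yb] y by simp
    qed
    then show "\<exists>B. \<forall>h\<in>range E. \<forall>z\<in>C. norm (h z) \<le> B" by auto
  qed auto
  have ng: "norm (g (cx y)) = exp (v y)" if y: "y \<in> ball p e" for y
  proof -
    have "(\<lambda>n. norm (E (q n) (cx y))) \<longlonglongrightarrow> norm (g (cx y))"
      using g(3)[of "cx y"] y by (intro tendsto_norm) (simp add: dist_cx)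
    moreover have "(\<lambda>n. u n y) \<longlonglongrightarrow> v y"
      by (rule tendsto_uniform_limitI[OF lim[of "{y}"]]) (use y pe in auto)
    then have "(\<lambda>n. u (q n) y) \<longlonglongrightarrow> v y"
      using LIMSEQ_subseq_LIMSEQ[OF _ g(2)] by (simp add: o_def)
    then have "(\<lambda>n. norm (E (q n) (cx y))) \<longlonglongrightarrow> exp (v y)"
      unfolding normE[OF y] by (rule tendsto_exp)
    ultimately show ?thesis by (rule LIMSEQ_unique)
  qed
  obtain G where G: "G holomorphic_on ?B" "\<And>z. z \<in> ?B \<Longrightarrow> exp (G z) = g z"
  proof (rule holomorphic_logarithm_exists[of ?B g "cx p"])
    show "g z \<noteq> 0" if "z \<in> ?B" for z
    proof -
      obtain y where y: "z = cx y" by (rule cx_surj)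
      have "norm (g z) = exp (v y)" using ng[of y] that y by (simp add: dist_cx)
      then show ?thesis by force
    qed
  qed (use g pe in auto)
  have "v y = Re (G (cx y))" if y: "y \<in> ball p e" for y
  proof -
    have "exp (Re (G (cx y))) = exp (v y)"
      using G(2)[of "cx y"] ng[OF y] y by (metis dist_cx mem_ball norm_exp_eq_Re)
    then show ?thesis by simp
  qed
  then show "\<exists>F. F holomorphic_on ?B \<and> (\<forall>y\<in>ball p e. v y = Re (F (cx y)))" using G by blast
qed

text \<open>By the open mapping theorem, a holomorphic \<open>F\<close> on a disc whose real part is nonnegative and vanishes at
  the centre is constant. So the zeros of \<open>u\<close> form an open set.\<close>

theorem conjugable_on_positive:
  assumes u: "conjugable_on S u" and "connected S" and nonneg: "\<And>y. y \<in> S \<Longrightarrow> u y \<ge> 0"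
    and ex: "q \<in> S" "u q > 0" and y: "y \<in> S"
  shows "u y > 0"
proof -
  have S: "open S" using u by (simp add: conjugable_on_def)
  define Z where "Z = {y \<in> S. u y = 0}"
  have "open Z"
  proof (subst open_subopen, rule ballI)
    fix p assume "p \<in> Z"
    then have p: "p \<in> S" "u p = 0" by (auto simp: Z_def)
    obtain e where e: "e > 0" "ball p e \<subseteq> S" using S p openE by metis
    obtain F where F: "F holomorphic_on ball (cx p) e" "\<And>y. y \<in> ball p e \<Longrightarrow> u y = Re (F (cx y))"
      using conjugable_onE[OF u e] by blast
    have "F constant_on ball (cx p) e"
    proof (rule ccontr)
      assume "\<not> F constant_on ball (cx p) e"
      then have "open (F ` ball (cx p) e)"
        using open_mapping_thm[OF F(1) open_ball connected_ball open_ball] by blast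
      moreover have "F (cx p) \<in> F ` ball (cx p) e" using e by auto
      ultimately obtain d where d: "d > 0" "ball (F (cx p)) d \<subseteq> F ` ball (cx p) e"
        using openE by blast
      have "F (cx p) - of_real (d/2) \<in> ball (F (cx p)) d" using d by (simp add: dist_norm)
      then obtain z where z: "z \<in> ball (cx p) e" "F z = F (cx p) - of_real (d/2)" using d(2) by (metis imageE subsetD)
      obtain y where y: "z = cx y" by (rule cx_surj)
      have yb: "y \<in> ball p e" using z y by (simp add: dist_cx)
      have "u y = u p - d / 2" using F(2)[OF yb] F(2)[of p] z y e by simp
      then show False using p d nonneg[of y] yb e by auto
    qed
    then obtain c where c: "\<And>z. z \<in> ball (cx p) e \<Longrightarrow> F z = c" by (auto simp: constant_on_def)
    have "u y = 0" if "y \<in> ball p e" for y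
      using F(2)[OF that] F(2)[of p] c[of "cx y"] c[of "cx p"] that p e by (simp add: dist_cx)
    then show "\<exists>T. open T \<and> p \<in> T \<and> T \<subseteq> Z"
      using e by (intro exI[of _ "ball p e"]) (auto simp: Z_def)
  qed
  moreover have "open {y \<in> S. u y > 0}"
  proof -
    have "open (S \<inter> u -` {0<..})"
      by (rule continuous_open_preimage[OF conjugable_on_imp_continuous_on[OF u] S]) simp
    moreover have "S \<inter> u -` {0<..} = {y \<in> S. u y > 0}" by auto
    ultimately show ?thesis by simp
  qed
  moreover have "Z \<inter> {y \<in> S. u y > 0} \<inter> S = {}" "S \<subseteq> Z \<union> {y \<in> S. u y > 0}"
    using nonneg by (auto simp: Z_def order_le_less)
  ultimately have "Z \<inter> S = {} \<or> {y \<in> S. u y > 0} \<inter> S = {}"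
    using \<open>connected S\<close> connectedD by metis
  then have "Z = {}" using ex by (auto simp: Z_def)
  then show ?thesis using y nonneg[OF y] by (auto simp: Z_def order_le_less)
qed

text \<open>All distances below are compared through their logarithms, with an error relative to \<open>a\<close>.\<close>

lemma abs_ln_diff_le:
  fixes a b :: real
  assumes "a > 0" "\<bar>b - a\<bar> \<le> a / 2"
  shows "\<bar>ln b - ln a\<bar> \<le> 2 * \<bar>b - a\<bar> / a"
proof -
  define x where "x = (b - a) / a"
  have x: "\<bar>x\<bar> \<le> 1 / 2" "b = a * (1 + x)" "\<bar>x\<bar> = \<bar>b - a\<bar> / a"
    using assms by (auto simp: x_def field_simps)
  have "\<bar>ln (1 + x) - x\<bar> \<le> 2 * x\<^sup>2" by (rule abs_ln_one_plus_x_minus_x_bound[OF x(1)])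
  moreover have "2 * x\<^sup>2 \<le> \<bar>x\<bar>"
    using mult_mono[OF x(1) order_refl, of "\<bar>x\<bar>"] by (simp add: power2_eq_square abs_mult[symmetric])
  ultimately have "\<bar>ln (1 + x)\<bar> \<le> 2 * \<bar>x\<bar>" by linarith
  moreover have "ln b - ln a = ln (1 + x)" using x(1) assms(1) by (subst x(2)) (simp add: ln_mult)
  ultimately show ?thesis using x(3) by simp
qed

lemma sum_dyadic_children:
  fixes F :: "nat \<Rightarrow> real"
  assumes "j < 2 ^ Suc m"
  shows "(\<Sum>i\<in>{..<2 ^ Suc m} - {j}. F i) =
    F (if even j then j + 1 else j - 1) + (\<Sum>i\<in>{..<2 ^ m} - {j div 2}. F (2 * i) + F (2 * i + 1))"
proof -
  let ?s = "if even j then j + 1 else j - 1"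
  have all: "(\<Sum>i<2 ^ Suc m. F i) = (\<Sum>i<2 ^ m. F (2 * i) + F (2 * i + 1))"
  proof -
    have "(\<Sum>i<2 * n. F i) = (\<Sum>i<n. F (2 * i) + F (2 * i + 1))" for n :: nat
      by (induction n) (auto simp: algebra_simps)
    from this[of "2 ^ m"] show ?thesis by simp
  qed
  have p: "j div 2 < 2 ^ m" using assms by auto
  have "(\<Sum>i<2 ^ Suc m. F i) = F j + (\<Sum>i\<in>{..<2 ^ Suc m} - {j}. F i)"
    using assms by (intro sum.remove) auto
  moreover have "(\<Sum>i<2 ^ m. F (2 * i) + F (2 * i + 1)) =
      (F (2 * (j div 2)) + F (2 * (j div 2) + 1)) + (\<Sum>i\<in>{..<2 ^ m} - {j div 2}. F (2 * i) + F (2 * i + 1))"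
    using p by (intro sum.remove) auto
  moreover have "F (2 * (j div 2)) + F (2 * (j div 2) + 1) = F j + F ?s"
    by (cases "even j") (simp_all add: add.commute)
  ultimately show ?thesis using all by simp
qed

lemma dyadic_sibling:
  fixes i j :: nat
  assumes "i div 2 = j div 2" "i \<noteq> j"
  shows "i = (if even j then j + 1 else j - 1)"
proof -
  define p where "p = j div 2"
  have "i = 2 * p + i mod 2" "j = 2 * p + j mod 2"
    using mult_div_mod_eq[of 2 i] mult_div_mod_eq[of 2 j] assms(1) unfolding p_def by simp_all
  then show ?thesis
    using assms(2) by (cases "even i"; cases "even j") (auto simp: even_iff_mod_2_eq_zero odd_iff_mod_2_eq_one)
qed

text \<open>The proof needs \<open>exp (- L)\<close> to be small and \<open>L\<close> to be large compared with a few absolute constants;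
  the bound 100 leaves room in all of these places.\<close>

locale cantor =
  fixes L :: real
  assumes L: "L \<ge> 100"
begin

definition r :: real where "r = exp (- L)"

lemma r_pos [simp]: "r > 0" and r_nonneg [simp]: "r \<ge> 0" and r_neq_0 [simp]: "r \<noteq> 0" by (simp_all add: r_def)

lemma r_small: "r \<le> 1 / 1000"
proof -
  have "exp L \<ge> 1 + L + L\<^sup>2 / 2" using L by (intro exp_lower_Taylor_quadratic) auto
  moreover have "L\<^sup>2 \<ge> 100\<^sup>2" using L by (intro power_mono) auto
  ultimately have "exp L \<ge> 1000" using L by simp
  then show ?thesis unfolding r_def exp_minus by (simp add: field_simps)
qed

lemma r_pow: "r ^ m = exp (- L * m)"
  by (simp add: r_def exp_of_nat_mult[symmetric] algebra_simps)

lemma ln_r_pow: "ln (r ^ m) = - L * m"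
  by (simp add: r_pow)

text \<open>The centres of the cylinders: those of the two children of \<open>j\<close> are placed symmetrically around \<open>z m j\<close>.
  Their distance is \<open>len m j\<close>, written out here because it depends on the centres of level \<open>m\<close>. Only
  the indices below \<open>2 ^ m\<close> are meaningful at level \<open>m\<close>.\<close>

primrec z :: "nat \<Rightarrow> nat \<Rightarrow> real^2" where
  "z 0 = (\<lambda>j. 0)"
| "z (Suc m) = (\<lambda>j. z m (j div 2) + ((if even j then - 1/2 else 1/2) *
      (r ^ m * exp (- 2 * ((\<Sum>i\<in>{..<2 ^ m} - {j div 2}. ln (dist (z m (j div 2)) (z m i)))
        + L * (2 ^ m - real m - 1))))) *\<^sub>R axis 1 1)"

definition s :: "nat \<Rightarrow> nat \<Rightarrow> real" where
  "s m j = - 2 * ((\<Sum>i\<in>{..<2 ^ m} - {j}. ln (dist (z m j) (z m i))) + L * (2 ^ m - real m - 1))"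

definition len :: "nat \<Rightarrow> nat \<Rightarrow> real" where
  "len m j = r ^ m * exp (s m j)"

lemma z_Suc: "z (Suc m) j = z m (j div 2) + ((if even j then - 1/2 else 1/2) * len m (j div 2)) *\<^sub>R axis 1 1"
  by (simp add: len_def s_def)

declare z.simps(2) [simp del]

lemma len_pos: "len m j > 0" by (simp add: len_def)

lemma dist_z_parent: "dist (z (Suc m) j) (z m (j div 2)) = len m (j div 2) / 2"
  using len_pos[of m "j div 2"] by (simp add: z_Suc dist_norm abs_mult)

lemma dist_z_sibling: "dist (z (Suc m) j) (z (Suc m) (if even j then j + 1 else j - 1)) = len m (j div 2)"
proof -
  let ?i = "if even j then j + 1 else j - 1"
  have "?i div 2 = j div 2" "even ?i = odd j" by presburger+
  then have "z (Suc m) j - z (Suc m) ?i = ((if even j then - 1 else 1) * len m (j div 2)) *\<^sub>R axis 1 1"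
    by (cases "even j") (simp_all add: z_Suc algebra_simps flip: scaleR_add_left)
  then show ?thesis using len_pos[of m "j div 2"] by (simp add: dist_norm)
qed

text \<open>The invariant of the construction. The sum controls at once the smallest distance between centres
  and all first-order errors that arise when a cylinder is replaced by its centre; the nearest
  neighbour, at distance about \<open>r ^ (m - 1)\<close>, dominates it.\<close>

definition well_separated :: "nat \<Rightarrow> bool" where
  "well_separated m \<longleftrightarrow> (\<forall>j<2 ^ m. \<bar>s m j\<bar> \<le> 18 * r \<and>
     (\<forall>i<2 ^ m. i \<noteq> j \<longrightarrow> z m i \<noteq> z m j) \<and>
     (\<Sum>i\<in>{..<2 ^ m} - {j}. r ^ m / dist (z m j) (z m i)) \<le> 2 * r)"

lemma well_separated_0: "well_separated 0"
  by (simp add: well_separated_def s_def)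

lemma len_bounds:
  assumes "\<bar>s m j\<bar> \<le> 18 * r"
  shows "(98/100) * r ^ m \<le> len m j" "len m j \<le> (102/100) * r ^ m"
proof -
  have "\<bar>s m j\<bar> \<le> (18/1000)" using assms r_small by linarith
  then have "exp (s m j) \<ge> (98/100)" using exp_ge_add_one_self[of "s m j"] by linarith
  then show "(98/100) * r ^ m \<le> len m j"
    using mult_left_mono[of "(98/100)" "exp (s m j)" "r ^ m"] by (simp add: len_def mult.commute)
  have "exp (s m j) \<le> exp (18/1000)" using \<open>\<bar>s m j\<bar> \<le> (18/1000)\<close> by simp
  also have "\<dots> \<le> 1 + (18/1000) + (18/1000)\<^sup>2" by (rule exp_bound) auto
  also have "\<dots> \<le> (102/100)" by (simp add: power2_eq_square)
  finally show "len m j \<le> (102/100) * r ^ m"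
    using mult_left_mono[of "exp (s m j)" "(102/100)" "r ^ m"] by (simp add: len_def mult.commute)
qed

lemma separation:
  assumes "well_separated m" "i < 2 ^ m" "j < 2 ^ m" "i \<noteq> j"
  shows "r ^ m \<le> 2 * r * dist (z m j) (z m i)"
proof -
  have d: "dist (z m j) (z m i) > 0" using assms by (auto simp: well_separated_def)
  have "r ^ m / dist (z m j) (z m i) \<le> (\<Sum>i\<in>{..<2 ^ m} - {j}. r ^ m / dist (z m j) (z m i))"
    using assms by (intro member_le_sum) auto
  also have "\<dots> \<le> 2 * r" using assms by (auto simp: well_separated_def)
  finally show ?thesis using d by (simp add: field_simps)
qed

lemma dist_z_cousins:
  assumes ws: "well_separated m" and j: "j < 2 ^ Suc m" and i: "i < 2 ^ Suc m" and ne: "i div 2 \<noteq> j div 2"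
  shows "\<bar>dist (z (Suc m) j) (z (Suc m) i) - dist (z m (j div 2)) (z m (i div 2))\<bar> \<le> (102/100) * r ^ m"
    "r ^ m \<le> 2 * r * dist (z m (j div 2)) (z m (i div 2))"
proof -
  have j': "j div 2 < 2 ^ m" and i': "i div 2 < 2 ^ m" using i j by auto
  have "len m (j div 2) \<le> (102/100) * r ^ m" "len m (i div 2) \<le> (102/100) * r ^ m"
    using ws i' j' by (intro len_bounds(2); simp add: well_separated_def)+
  then show "\<bar>dist (z (Suc m) j) (z (Suc m) i) - dist (z m (j div 2)) (z m (i div 2))\<bar> \<le> (102/100) * r ^ m"
    using dist_z_parent[of m j] dist_z_parent[of m i]
    by (smt (verit, best) dist_commute dist_triangle field_sum_of_halves)
  show "r ^ m \<le> 2 * r * dist (z m (j div 2)) (z m (i div 2))"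
    using separation[OF ws i' j' ne] .
qed

text \<open>Here the definition of \<open>s\<close> pays off. In \<open>s (Suc m) j\<close>, the sibling contributes the logarithm of
  \<open>len m p\<close>, which contains \<open>s m p\<close> once; the pairs of children of the other parents contribute twice
  the logarithms that make up \<open>s m p\<close>. The two occurrences of \<open>s m p\<close> cancel, and
  \<open>s (Suc m) j = - 2 * E\<close> with a sum \<open>E\<close> of the errors made by replacing children by their parents.\<close>

lemma well_separated_Suc:
  assumes ws: "well_separated m"
  shows "well_separated (Suc m)"
  unfolding well_separated_def
proof (intro allI impI conjI)
  fix j :: nat assume j: "j < 2 ^ Suc m"
  define p where "p = j div 2"
  have p: "p < 2 ^ m" using j by (auto simp: p_def)
  let ?I = "{..<2 ^ m} - {p}"
  let ?d = "\<lambda>i. dist (z m p) (z m i)" and ?d' = "\<lambda>i. dist (z (Suc m) j) (z (Suc m) i)"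
  have dpos: "?d i > 0" if "i \<in> ?I" for i using ws p that by (auto simp: well_separated_def)
  have close: "\<bar>?d' i - ?d (i div 2)\<bar> \<le> (102/100) * r ^ m" "r ^ m \<le> 2 * r * ?d (i div 2)"
    if "i div 2 \<in> ?I" for i
    using dist_z_cousins[OF ws j, of i] that by (auto simp: p_def)
  have close2: "\<bar>?d' i - ?d (i div 2)\<bar> \<le> (1/100) * ?d (i div 2)" if "i div 2 \<in> ?I" for i
  proof -
    have "2 * r * ?d (i div 2) \<le> 2 * (1/1000) * ?d (i div 2)"
      using r_small by (intro mult_right_mono) auto
    then show ?thesis using close[OF that] by linarith
  qed
  have lenp: "(98/100) * r ^ m \<le> len m p"
    by (rule len_bounds(1)) (use ws p in \<open>simp add: well_separated_def\<close>)
  let ?sib = "if even j then j + 1 else j - 1"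
  have sib: "?d' ?sib = len m p" unfolding p_def by (rule dist_z_sibling)
  have A: "(\<Sum>i\<in>?I. r ^ m / ?d i) \<le> 2 * r" using ws p by (auto simp: well_separated_def)
  have nbr: "i = ?sib" if "i div 2 = p" "i \<noteq> j" for i
    using that unfolding p_def by (rule dyadic_sibling)
  show "z (Suc m) i \<noteq> z (Suc m) j" if "i < 2 ^ Suc m" "i \<noteq> j" for i
  proof (cases "i div 2 = p")
    case True
    then have "i = ?sib" using nbr that(2) by blast
    then have "dist (z (Suc m) j) (z (Suc m) i) > 0" using sib len_pos[of m p] by simp
    then show ?thesis by auto
  next
    case False
    then have I: "i div 2 \<in> ?I" using that by auto
    then show ?thesis using close2[OF I] dpos[OF I] by auto
  qed
  show "(\<Sum>i\<in>{..<2 ^ Suc m} - {j}. r ^ Suc m / ?d' i) \<le> 2 * r"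
  proof -
    have tm: "r ^ Suc m / ?d' i \<le> (11/10) * r * (r ^ m / ?d (i div 2))" if "i div 2 \<in> ?I" for i
    proof -
      have "?d' i \<ge> (99/100) * ?d (i div 2)" using close2[OF that] by linarith
      then have "r ^ Suc m / ?d' i \<le> r ^ Suc m / ((99/100) * ?d (i div 2))"
        using dpos[OF that] by (intro divide_left_mono) (auto intro!: mult_pos_pos)
      also have "\<dots> \<le> (11/10) * r * (r ^ m / ?d (i div 2))"
        using dpos[OF that] by (simp add: field_simps)
      finally show ?thesis .
    qed
    have "(\<Sum>i\<in>{..<2 ^ Suc m} - {j}. r ^ Suc m / ?d' i) =
        r ^ Suc m / len m p + (\<Sum>i\<in>?I. r ^ Suc m / ?d' (2 * i) + r ^ Suc m / ?d' (2 * i + 1))"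
      using sum_dyadic_children[OF j, of "\<lambda>i. r ^ Suc m / ?d' i"] sib by (simp add: p_def)
    also have "\<dots> \<le> (11/10) * r + (\<Sum>i\<in>?I. (22/10) * r * (r ^ m / ?d i))"
    proof (intro add_mono sum_mono)
      have "r ^ Suc m \<le> (11/10) * r * ((98/100) * r ^ m)" by simp
      also have "\<dots> \<le> (11/10) * r * len m p" using lenp by (intro mult_left_mono) auto
      finally show "r ^ Suc m / len m p \<le> (11/10) * r" using len_pos[of m p] by (simp add: field_simps)
      fix i assume "i \<in> ?I"
      then show "r ^ Suc m / ?d' (2 * i) + r ^ Suc m / ?d' (2 * i + 1) \<le> (22/10) * r * (r ^ m / ?d i)"
        using tm[of "2 * i"] tm[of "2 * i + 1"] by simp
    qed
    also have "\<dots> = (11/10) * r + (22/10) * r * (\<Sum>i\<in>?I. r ^ m / ?d i)" by (simp add: sum_distrib_left)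
    also have "\<dots> \<le> (11/10) * r + (22/10) * r * (2 * r)" using A by (intro add_left_mono mult_left_mono) auto
    also have "\<dots> \<le> (11/10) * r + (22/10) * r * (2 * (1/1000))" using r_small by (intro add_left_mono mult_left_mono) auto
    also have "\<dots> \<le> 2 * r" by simp
    finally show ?thesis .
  qed
  show "\<bar>s (Suc m) j\<bar> \<le> 18 * r"
  proof -
    define E where "E = (\<Sum>i\<in>?I. (ln (?d' (2 * i)) - ln (?d i)) + (ln (?d' (2 * i + 1)) - ln (?d i)))"
    have tm: "\<bar>ln (?d' i) - ln (?d (i div 2))\<bar> \<le> (204/100) * (r ^ m / ?d (i div 2))" if "i div 2 \<in> ?I" for i
    proof -
      have "\<bar>ln (?d' i) - ln (?d (i div 2))\<bar> \<le> 2 * \<bar>?d' i - ?d (i div 2)\<bar> / ?d (i div 2)"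
        using close2[OF that] dpos[OF that] by (intro abs_ln_diff_le) linarith+
      also have "\<dots> \<le> 2 * ((102/100) * r ^ m) / ?d (i div 2)"
        using close[OF that] dpos[OF that] by (intro divide_right_mono mult_left_mono) auto
      finally show ?thesis by simp
    qed
    have "\<bar>E\<bar> \<le> (\<Sum>i\<in>?I. (408/100) * (r ^ m / ?d i))"
      unfolding E_def
    proof (intro order_trans[OF sum_abs] sum_mono)
      fix i assume "i \<in> ?I"
      then show "\<bar>(ln (?d' (2 * i)) - ln (?d i)) + (ln (?d' (2 * i + 1)) - ln (?d i))\<bar> \<le> (408/100) * (r ^ m / ?d i)"
        using tm[of "2 * i"] tm[of "2 * i + 1"] by simp
    qed
    also have "\<dots> = (408/100) * (\<Sum>i\<in>?I. r ^ m / ?d i)" by (simp add: sum_distrib_left)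
    also have "\<dots> \<le> (408/100) * (2 * r)" using A by (intro mult_left_mono) auto
    finally have E: "\<bar>E\<bar> \<le> (816/100) * r" by simp
    have S: "(\<Sum>i\<in>{..<2 ^ Suc m} - {j}. ln (?d' i)) = ln (len m p) + (2 * (\<Sum>i\<in>?I. ln (?d i)) + E)"
    proof -
      have "(\<Sum>i\<in>{..<2 ^ Suc m} - {j}. ln (?d' i)) =
        ln (len m p) + (\<Sum>i\<in>?I. ln (?d' (2 * i)) + ln (?d' (2 * i + 1)))"
        using sum_dyadic_children[OF j, of "\<lambda>i. ln (?d' i)"] sib by (simp add: p_def)
      also have "(\<Sum>i\<in>?I. ln (?d' (2 * i)) + ln (?d' (2 * i + 1))) = 2 * (\<Sum>i\<in>?I. ln (?d i)) + E"
        unfolding E_def sum_distrib_left sum.distrib[symmetric] by (intro sum.cong) auto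
      finally show ?thesis .
    qed
    have "ln (len m p) = - L * m + s m p"
      by (simp add: len_def ln_mult ln_r_pow)
    then have "s (Suc m) j = - 2 * E"
      unfolding s_def[of "Suc m"] S by (simp add: s_def algebra_simps)
    then show ?thesis using E by simp
  qed
qed

lemma well_separated: "well_separated m"
  by (induction m) (simp_all add: well_separated_0 well_separated_Suc)

lemma s_bound: "j < 2 ^ m \<Longrightarrow> \<bar>s m j\<bar> \<le> 18 * r"
  and z_sum: "j < 2 ^ m \<Longrightarrow> (\<Sum>i\<in>{..<2 ^ m} - {j}. r ^ m / dist (z m j) (z m i)) \<le> 2 * r"
  using well_separated[of m] by (auto simp: well_separated_def)

lemmas z_separation = separation[OF well_separated]


section \<open>The Cantor set and its natural measure\<close>

definition cell :: "nat \<Rightarrow> nat \<Rightarrow> (real^2) set" where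
  "cell m j = cball (z m j) (r ^ m)"

definition K :: "(real^2) set" where
  "K = (\<Inter>m. \<Union>j<2 ^ m. cell m j)"

definition idx :: "nat \<Rightarrow> real^2 \<Rightarrow> nat" where
  "idx m x = (THE j. j < 2 ^ m \<and> x \<in> cell m j)"

lemma r_pow_Suc_le: "r ^ Suc m \<le> r ^ m / 1000"
  using r_small mult_right_mono[of r "1/1000" "r ^ m"] by simp

lemma len_lower: "j < 2 ^ m \<Longrightarrow> (98/100) * r ^ m \<le> len m j"
  and len_upper: "j < 2 ^ m \<Longrightarrow> len m j \<le> (102/100) * r ^ m"
  using len_bounds[OF s_bound] by auto

lemma cell_nested:
  assumes "j < 2 ^ Suc m"
  shows "cell (Suc m) j \<subseteq> cell m (j div 2)"
proof -
  have "j div 2 < 2 ^ m" using assms by auto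
  from len_upper[OF this] have "dist (z (Suc m) j) (z m (j div 2)) + r ^ Suc m \<le> r ^ m"
    using r_pow_Suc_le[of m] zero_le_power[OF r_nonneg, of m]
    unfolding dist_z_parent by linarith
  then show ?thesis unfolding cell_def
    by (metis add.commute cball_subset_cball_iff dist_commute)
qed

lemma z_far:
  assumes "i < 2 ^ m" "j < 2 ^ m" "i \<noteq> j"
  shows "500 * r ^ m \<le> dist (z m j) (z m i)"
proof -
  have "r ^ m \<le> 2 * r * dist (z m j) (z m i)" using z_separation[OF assms] .
  also have "\<dots> \<le> 2 * (1/1000) * dist (z m j) (z m i)" using r_small by (intro mult_right_mono) auto
  finally show ?thesis by simp
qed

lemma cell_disjoint:
  assumes "i < 2 ^ m" "j < 2 ^ m" "x \<in> cell m i" "x \<in> cell m j"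
  shows "i = j"
proof (rule ccontr)
  assume "i \<noteq> j"
  then have "500 * r ^ m \<le> dist (z m j) (z m i)" using z_far assms by blast
  also have "\<dots> \<le> 2 * r ^ m"
    using assms(3,4) dist_triangle[of "z m j" "z m i" x] by (simp add: cell_def dist_commute)
  finally show False using zero_less_power[OF r_pos, of m] by simp
qed

lemma idx_eqI: "j < 2 ^ m \<Longrightarrow> x \<in> cell m j \<Longrightarrow> idx m x = j"
  unfolding idx_def using cell_disjoint by blast

lemma idx_props:
  assumes "x \<in> K"
  shows "idx m x < 2 ^ m" "x \<in> cell m (idx m x)"
proof -
  obtain j where "j < 2 ^ m" "x \<in> cell m j" using assms by (auto simp: K_def)
  then show "idx m x < 2 ^ m" "x \<in> cell m (idx m x)" using idx_eqI by auto
qed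

lemma dist_z_idx: "x \<in> K \<Longrightarrow> dist x (z m (idx m x)) \<le> r ^ m"
  using idx_props(2)[of x m] by (simp add: cell_def dist_commute)

lemma idx_Suc_div: 
  assumes "x \<in> K"
  shows "idx (Suc m) x div 2 = idx m x"
proof (rule idx_eqI[symmetric])
  show "idx (Suc m) x div 2 < 2 ^ m" using idx_props(1)[OF assms, of "Suc m"] by auto
  show "x \<in> cell m (idx (Suc m) x div 2)" using cell_nested idx_props[OF assms, of "Suc m"] by blast
qed

lemma same_cell_dist:
  assumes "x \<in> K" "w \<in> K" "idx m x = idx m w"
  shows "dist x w \<le> 2 * r ^ m"
  using dist_z_idx[OF assms(1), of m] dist_z_idx[OF assms(2), of m] assms(3)
    dist_triangle[of x w "z m (idx m x)"] by (simp add: dist_commute)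

lemma split_dist:
  assumes "x \<in> K" "w \<in> K" "idx m x = idx m w" "idx (Suc m) x \<noteq> idx (Suc m) w"
  shows "(96/100) * r ^ m \<le> dist x w" "dist x w \<le> (104/100) * r ^ m"
proof -
  let ?i = "idx (Suc m) x" and ?j = "idx (Suc m) w"
  have "?i div 2 = ?j div 2" using assms idx_Suc_div by simp
  then have "?j = (if even ?i then ?i + 1 else ?i - 1)"
    using assms(4) by (intro dyadic_sibling) auto
  then have d: "dist (z (Suc m) ?i) (z (Suc m) ?j) = len m (idx m x)"
    using dist_z_sibling[of m ?i] idx_Suc_div[OF assms(1)] by simp
  have "\<bar>dist x w - dist (z (Suc m) ?i) (z (Suc m) ?j)\<bar> \<le> 2 * r ^ Suc m"
    using dist_z_idx[OF assms(1), of "Suc m"] dist_z_idx[OF assms(2), of "Suc m"]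
      dist_triangle[of x w "z (Suc m) ?i"] dist_triangle[of "z (Suc m) ?i" w "z (Suc m) ?j"]
      dist_triangle[of "z (Suc m) ?i" "z (Suc m) ?j" x] dist_triangle[of x "z (Suc m) ?j" w]
    by (simp only: dist_commute[of _ x] dist_commute[of w "z (Suc m) ?j"] abs_le_iff) linarith
  then show "(96/100) * r ^ m \<le> dist x w" "dist x w \<le> (104/100) * r ^ m"
    unfolding d using r_pow_Suc_le[of m] len_lower[OF idx_props(1)[OF assms(1)], of m]
      len_upper[OF idx_props(1)[OF assms(1)], of m] zero_less_power[OF r_pos, of m] by linarith+
qed

lemma r_pow_tendsto_0: "(\<lambda>m. r ^ m) \<longlonglongrightarrow> 0"
  using r_small by (intro LIMSEQ_power_zero) auto

lemma idx_separates:
  assumes "x \<in> K" "w \<in> K" "x \<noteq> w"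
  shows "\<exists>m. idx m x \<noteq> idx m w"
proof (rule ccontr)
  assume "\<not> ?thesis"
  then have "dist x w \<le> 2 * r ^ m" for m using same_cell_dist[OF assms(1,2)] by auto
  moreover have "(\<lambda>m. 2 * r ^ m) \<longlonglongrightarrow> 2 * 0" by (intro tendsto_mult_left r_pow_tendsto_0)
  ultimately have "dist x w \<le> 2 * 0" using LIMSEQ_le_const by blast
  then show False using assms(3) by simp
qed

lemma cell_borel [measurable]: "cell m j \<in> sets borel"
  by (simp add: cell_def)

lemma closed_K: "closed K"
  unfolding K_def cell_def by (intro closed_INT ballI closed_UN) auto

lemma K_borel [measurable]: "K \<in> sets borel"
  using closed_K by simp

lemma K_subset_cball: "K \<subseteq> cball 0 1"
  using dist_z_idx[of _ 0] idx_props(1)[of _ 0] by (auto simp: dist_commute)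

lemma compact_K: "compact K"
  using closed_K K_subset_cball bounded_subset[OF bounded_cball] by (auto simp: compact_eq_bounded_closed)

lemma z_line: "z m j \<in> span {axis 1 1}"
  by (induction m arbitrary: j) (simp_all add: z_Suc span_add span_mul span_base span_zero)

lemma K_line: "K \<subseteq> span {axis 1 1}"
proof
  fix x assume x: "x \<in> K"
  have "(\<lambda>m. z m (idx m x)) \<longlonglongrightarrow> x"
    unfolding tendsto_dist_iff[of _ x]
    by (rule Lim_null_comparison[OF _ r_pow_tendsto_0]) (use dist_z_idx[OF x] in \<open>simp add: dist_commute\<close>)
  then show "x \<in> span {axis 1 1}"
    by (rule closed_sequentially[OF closed_span z_line])
qed

text \<open>The point with binary address \<open>t\<close> is \<open>X t\<close>. It turns Lebesgue measure on the unit interval into the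
  natural measure, because the numbers whose first \<open>m\<close> binary digits are given form an interval of
  length \<open>1 / 2 ^ m\<close>.\<close>

definition digit :: "nat \<Rightarrow> real \<Rightarrow> nat" where
  "digit m t = nat \<lfloor>2 ^ m * t\<rfloor>"

lemma digit_iff:
  assumes "0 \<le> t"
  shows "digit m t = j \<longleftrightarrow> real j / 2 ^ m \<le> t \<and> t < (real j + 1) / 2 ^ m"
proof -
  have "digit m t = j \<longleftrightarrow> \<lfloor>2 ^ m * t\<rfloor> = int j" using assms by (auto simp: digit_def)
  also have "\<dots> \<longleftrightarrow> real j \<le> 2 ^ m * t \<and> 2 ^ m * t < real j + 1" by (simp add: floor_eq_iff)
  finally show ?thesis by (simp add: field_simps)
qed

lemma digit_less: "0 \<le> t \<Longrightarrow> t < 1 \<Longrightarrow> digit m t < 2 ^ m"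
  by (simp add: digit_def nat_less_iff floor_less_iff)

lemma digit_Suc_div: "digit (Suc m) t div 2 = digit m t"
proof -
  have "\<lfloor>2 ^ m * t\<rfloor> = \<lfloor>2 ^ Suc m * t\<rfloor> div 2"
    using floor_divide_real_eq_div[of 2 "2 ^ Suc m * t"] by simp
  then show ?thesis by (simp add: digit_def nat_div_distrib')
qed

definition X :: "real \<Rightarrow> real^2" where
  "X t = (SOME x. x \<in> (\<Inter>m. cell m (digit m t)))"

lemma X_in_cell:
  assumes "0 \<le> t" "t < 1"
  shows "X t \<in> cell m (digit m t)"
proof -
  have "decseq (\<lambda>m. cell m (digit m t))"
    by (rule decseq_SucI) (metis assms cell_nested digit_Suc_div digit_less)
  then have "(\<Inter>m. cell m (digit m t)) \<noteq> {}"
    by (intro compact_nest) (auto simp: cell_def decseq_def not_less)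
  then have "X t \<in> (\<Inter>m. cell m (digit m t))" unfolding X_def by (metis some_in_eq)
  then show ?thesis by blast
qed

lemma X_in_K: "0 \<le> t \<Longrightarrow> t < 1 \<Longrightarrow> X t \<in> K"
  unfolding K_def using X_in_cell digit_less by blast

lemma idx_X: "0 \<le> t \<Longrightarrow> t < 1 \<Longrightarrow> idx m (X t) = digit m t"
  by (intro idx_eqI digit_less X_in_cell)

definition U :: "real measure" where
  "U = restrict_space lborel {0..<1}"

definition M :: "(real^2) measure" where
  "M = distr U (restrict_space borel K) X"

lemma space_U [simp]: "space U = {0..<1}"
  by (simp add: U_def space_restrict_space)

lemma X_measurable: "X \<in> U \<rightarrow>\<^sub>M restrict_space borel K"
proof (rule measurable_restrict_space2)
  show "X \<in> space U \<rightarrow> K" using X_in_K by auto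
  have "X \<in> borel_measurable U"
  proof (rule borel_measurable_LIMSEQ_metric)
    show "(\<lambda>t. z m (digit m t)) \<in> borel_measurable U" for m
    proof -
      have "digit m \<in> U \<rightarrow>\<^sub>M count_space UNIV"
        unfolding digit_def U_def by (intro measurable_restrict_space1) measurable
      then show ?thesis by (rule measurable_compose) simp
    qed
    show "(\<lambda>m. z m (digit m t)) \<longlonglongrightarrow> X t" if "t \<in> space U" for t
      unfolding tendsto_dist_iff[of _ "X t"]
      by (rule Lim_null_comparison[OF _ r_pow_tendsto_0]) (use X_in_cell[of t] that in \<open>simp add: cell_def\<close>)
  qed
  then show "X \<in> borel_measurable U" .
qed

lemma space_M [simp]: "space M = K" and sets_M: "sets M = sets (restrict_space borel K)"
  by (simp_all add: M_def space_restrict_space)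

sublocale U: prob_space U
  by (rule prob_spaceI) (simp add: U_def emeasure_restrict_space space_restrict_space)

sublocale M: prob_space M
  unfolding M_def by (rule U.prob_space_distr[OF X_measurable])

lemma idx_cylinder: "j < 2 ^ m \<Longrightarrow> {x \<in> K. idx m x = j} = K \<inter> cell m j"
  using idx_eqI[of j m] idx_props(2)[of _ m] by blast

lemma idx_cylinder_sets: "{x \<in> K. idx m x = j} \<in> sets M"
proof (cases "j < 2 ^ m")
  case True
  then show ?thesis using idx_cylinder[OF True] by (auto simp: sets_M sets_restrict_space)
next
  case False
  then have "{x \<in> K. idx m x = j} = {}" using idx_props(1) by auto
  then show ?thesis by (simp only: sets.empty_sets)
qed

lemma idx_measurable: "idx m \<in> M \<rightarrow>\<^sub>M count_space UNIV"
proof (subst measurable_count_space_eq_countable)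
  show "countable (UNIV :: nat set)" by simp
  show "idx m \<in> space M \<rightarrow> UNIV \<and> (\<forall>a\<in>UNIV. idx m -` {a} \<inter> space M \<in> sets M)"
    using idx_cylinder_sets[of m] by (auto simp: vimage_def Int_def conj_commute)
qed

lemma idx_prob:
  assumes "j < 2 ^ m"
  shows "measure M {x \<in> space M. idx m x = j} = 1 / 2 ^ m"
proof -
  let ?A = "{x \<in> K. idx m x = j}"
  have A: "?A \<in> sets (restrict_space borel K)" using idx_cylinder_sets sets_M by simp
  have "(real j + 1) / 2 ^ m \<le> 1"
  proof -
    have "real (j + 1) \<le> real (2 ^ m)" using assms by (simp only: of_nat_le_iff)
    then show ?thesis by simp
  qed
  moreover have "t \<ge> 0" if "real j / 2 ^ m \<le> t" for t :: real
    using order_trans[OF _ that, of 0] by simp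
  moreover have "t \<in> X -` ?A \<longleftrightarrow> real j / 2 ^ m \<le> t \<and> t < (real j + 1) / 2 ^ m" if "0 \<le> t" "t < 1" for t
    using X_in_K[OF that] idx_X[OF that] digit_iff[OF that(1)] by simp
  ultimately have "X -` ?A \<inter> space U = {real j / 2 ^ m ..< (real j + 1) / 2 ^ m}"
    by (intro set_eqI) (metis (no_types, lifting) Int_iff atLeastLessThan_iff less_le_trans space_U)
  then have "measure M ?A = measure U {real j / 2 ^ m ..< (real j + 1) / 2 ^ m}"
    unfolding M_def by (simp add: measure_distr[OF X_measurable A])
  also have "\<dots> = measure lborel {real j / 2 ^ m ..< (real j + 1) / 2 ^ m}"
    unfolding U_def using \<open>(real j + 1) / 2 ^ m \<le> 1\<close> order_trans[of 0 "real j / 2 ^ m"]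
    by (subst measure_restrict_space) auto
  also have "\<dots> = 1 / 2 ^ m" by (simp add: field_simps)
  finally show ?thesis by simp
qed

end

section \<open>Integral operators with a nearly ultrametric kernel\<close>

text \<open>The estimates below compare a level \<open>m\<close> with a reference level \<open>n\<close>. The ratio 3/4 is chosen such that
  \<open>2 ^ m * (3/4) ^ (m - n)\<close> grows faster than \<open>2 ^ n * (m - n)\<close>, the growth of a logarithmic
  kernel.\<close>

lemma tent_sum:
  fixes n :: nat
  shows "summable (\<lambda>m. (3/4::real) ^ ((n - m) + (m - n)))" "(\<Sum>m. (3/4::real) ^ ((n - m) + (m - n))) \<le> 7"
proof -
  let ?f = "\<lambda>m. (3/4::real) ^ ((n - m) + (m - n))"
  have tail: "(\<lambda>m. ?f (m + n)) = (\<lambda>m. (3/4) ^ m)" by (auto simp: fun_eq_iff)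
  have "summable (\<lambda>m. ?f (m + n))" unfolding tail by (rule summable_geometric) simp
  then show sm: "summable ?f" by (rule summable_iff_shift[THEN iffD1])
  have "(\<Sum>m<n. ?f m) = (\<Sum>m<n. (3/4) ^ (n - m))" by (rule sum.cong) auto
  also have "\<dots> \<le> 3"
  proof (induction n)
    case (Suc n)
    have "(\<Sum>m<Suc n. (3/4::real) ^ (Suc n - m)) = (3/4) * (\<Sum>m<n. (3/4::real) ^ (n - m)) + 3/4"
      by (simp add: Suc_diff_le sum_distrib_left)
    then show ?case using Suc by simp
  qed simp
  finally have "(\<Sum>m<n. ?f m) \<le> 3" .
  moreover have "(\<Sum>m. ?f (m + n)) = 4" unfolding tail by (subst suminf_geometric) auto
  ultimately show "(\<Sum>m. ?f m) \<le> 7"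
    using suminf_split_initial_segment[OF sm, of n] by linarith
qed

text \<open>An abstract dyadic tree: \<open>idx m x\<close> is the number of the cylinder of level \<open>m\<close> that contains \<open>x\<close>, and
  the children of the cylinder \<open>j\<close> have the numbers \<open>2 * j\<close> and \<open>2 * j + 1\<close>.\<close>

locale dyadic_space = prob_space M for M :: "'a measure" +
  fixes idx :: "nat \<Rightarrow> 'a \<Rightarrow> nat"
  assumes idx_measurable [measurable]: "idx m \<in> M \<rightarrow>\<^sub>M count_space UNIV"
    and idx_less: "x \<in> space M \<Longrightarrow> idx m x < 2 ^ m"
    and idx_div: "x \<in> space M \<Longrightarrow> idx (Suc m) x div 2 = idx m x"
    and idx_prob: "j < 2 ^ m \<Longrightarrow> prob {x \<in> space M. idx m x = j} = 1 / 2 ^ m"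
    and idx_separates: "x \<in> space M \<Longrightarrow> y \<in> space M \<Longrightarrow> x \<noteq> y \<Longrightarrow> \<exists>m. idx m x \<noteq> idx m y"
begin

definition cyl :: "nat \<Rightarrow> 'a \<Rightarrow> 'a set" where
  "cyl m x = {y \<in> space M. idx m y = idx m x}"

definition ring :: "nat \<Rightarrow> 'a \<Rightarrow> 'a set" where
  "ring m x = cyl m x - cyl (Suc m) x"

lemma cyl_sets [measurable]: "cyl m x \<in> sets M"
  unfolding cyl_def by measurable

lemma ring_sets [measurable]: "ring m x \<in> sets M"
  unfolding ring_def by measurable

lemma cyl_subset_space: "cyl m x \<subseteq> space M" by (auto simp: cyl_def)

lemma prob_cyl: "x \<in> space M \<Longrightarrow> prob (cyl m x) = 1 / 2 ^ m"
  unfolding cyl_def by (rule idx_prob) (rule idx_less)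

lemma cyl_self: "x \<in> space M \<Longrightarrow> x \<in> cyl m x" by (simp add: cyl_def)

lemma cyl_eq: "y \<in> cyl m x \<Longrightarrow> cyl m y = cyl m x" by (auto simp: cyl_def)

lemma cyl_Suc: "x \<in> space M \<Longrightarrow> cyl (Suc m) x \<subseteq> cyl m x"
proof
  fix y assume x: "x \<in> space M" and y: "y \<in> cyl (Suc m) x"
  then have "y \<in> space M" "idx (Suc m) y div 2 = idx (Suc m) x div 2" by (auto simp: cyl_def)
  then show "y \<in> cyl m x" using idx_div[of y m] idx_div[OF x, of m] by (simp add: cyl_def)
qed

lemma cyl_mono: "x \<in> space M \<Longrightarrow> m \<le> n \<Longrightarrow> cyl n x \<subseteq> cyl m x"
  by (rule lift_Suc_antimono_le[of "\<lambda>n. cyl n x"]) (auto dest: cyl_Suc)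

lemma cyl_0: "x \<in> space M \<Longrightarrow> cyl 0 x = space M"
  unfolding cyl_def using idx_less[of _ 0] by force

lemma prob_ring: "x \<in> space M \<Longrightarrow> prob (ring m x) = 1 / 2 ^ Suc m"
  unfolding ring_def by (subst finite_measure_Diff) (auto simp: prob_cyl cyl_Suc)

lemma ring_ex:
  assumes "x \<in> space M" "w \<in> space M" "w \<noteq> x"
  obtains m where "w \<in> ring m x"
proof -
  define n where "n = (LEAST m. w \<notin> cyl m x)"
  have ex: "\<exists>m. w \<notin> cyl m x" using idx_separates[OF assms(2,1,3)] by (auto simp: cyl_def)
  have n: "w \<notin> cyl n x" unfolding n_def using ex by (rule LeastI_ex)
  have "n \<noteq> 0" using n cyl_0[OF assms(1)] assms(2) by (cases n) auto
  then obtain m where m: "n = Suc m" using not0_implies_Suc by blast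
  then have "w \<in> cyl m x" using not_less_Least[of m "\<lambda>m. w \<notin> cyl m x"] n_def by auto
  then show ?thesis using that[of m] n m by (simp add: ring_def)
qed

lemma ring_in_cyl: "x \<in> space M \<Longrightarrow> w \<in> ring m x \<Longrightarrow> w \<in> cyl n x \<longleftrightarrow> n \<le> m"
  using cyl_mono[of x n m] cyl_mono[of x "Suc m" n] by (auto simp: ring_def not_less_eq_eq[symmetric])

lemma singleton_eq: "x \<in> space M \<Longrightarrow> {x} = (\<Inter>m. cyl m x)"
proof (intro equalityI subsetI)
  fix w assume x: "x \<in> space M" and w: "w \<in> (\<Inter>m. cyl m x)"
  then have "w \<in> space M" using cyl_subset_space by blast
  then have "w = x" using idx_separates[of w x] x w by (auto simp: cyl_def)
  then show "w \<in> {x}" by simp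
qed (auto simp: cyl_self)

lemma singleton_sets: "x \<in> space M \<Longrightarrow> {x} \<in> sets M"
  by (subst singleton_eq) auto

lemma AE_neq: 
  assumes "x \<in> space M"
  shows "AE w in M. w \<noteq> x"
proof -
  have "prob {x} \<le> (1/2) ^ m" for m
    using finite_measure_mono[of "{x}" "cyl m x"] prob_cyl[OF assms, of m] cyl_self[OF assms, of m]
    by (simp add: power_one_over)
  then have "prob {x} \<le> 0"
    by (intro LIMSEQ_le_const[OF LIMSEQ_power_zero[of "1/2::real"]]) auto
  then have "emeasure M {x} = 0" by (simp add: emeasure_eq_measure measure_le_0_iff)
  then have "{x} \<in> null_sets M" using singleton_sets[OF assms] by auto
  then show ?thesis by (rule AE_I') auto
qed

text \<open>Up to the null set consisting of \<open>x\<close>, the space is the disjoint union of the sets \<open>ring m x\<close> of points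
  that separate from \<open>x\<close> after level \<open>m\<close>, and these have mass \<open>1 / 2 ^ Suc m\<close>.\<close>

lemma ring_integral:
  fixes c :: "nat \<Rightarrow> real"
  assumes x: "x \<in> space M" and h [measurable]: "h \<in> borel_measurable M"
    and c: "\<And>m. 0 \<le> c m" "summable (\<lambda>m. c m / 2 ^ Suc m)"
    and bd: "\<And>m w. w \<in> ring m x \<Longrightarrow> \<bar>h w\<bar> \<le> c m"
  shows "integrable M h" "\<bar>\<integral>w. h w \<partial>M\<bar> \<le> (\<Sum>m. c m / 2 ^ Suc m)"
proof -
  define H where "H w = (\<Sum>m. ennreal (c m) * indicator (ring m x) w)" for w
  have AE: "AE w in M. ennreal (norm (h w)) \<le> H w"
  proof (rule AE_mp[OF AE_neq[OF x]], rule AE_I2, rule impI)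
    fix w assume "w \<in> space M" "w \<noteq> x"
    then obtain m where m: "w \<in> ring m x" using ring_ex[OF x] by blast
    have "ennreal (norm (h w)) \<le> ennreal (c m) * indicator (ring m x) w"
      using bd[OF m] m by (simp add: ennreal_leI)
    also have "\<dots> = (\<Sum>i\<in>{m}. ennreal (c i) * indicator (ring i x) w)"
      by (simp del: sum_mult_indicator)
    also have "\<dots> \<le> H w" unfolding H_def by (rule sum_le_suminf) auto
    finally show "ennreal (norm (h w)) \<le> H w" .
  qed
  have "(\<integral>\<^sup>+w. norm (h w) \<partial>M) \<le> (\<integral>\<^sup>+w. H w \<partial>M)" by (rule nn_integral_mono_AE[OF AE])
  also have "\<dots> = (\<Sum>m. ennreal (c m) * emeasure M (ring m x))"
    unfolding H_def by (subst nn_integral_suminf) (auto simp: nn_integral_cmult)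
  also have "\<dots> = (\<Sum>m. ennreal (c m / 2 ^ Suc m))"
    using c(1) by (intro suminf_cong) (simp add: emeasure_eq_measure prob_ring[OF x] ennreal_mult[symmetric])
  also have "\<dots> = ennreal (\<Sum>m. c m / 2 ^ Suc m)"
    using c by (intro suminf_ennreal2) auto
  finally have bound: "(\<integral>\<^sup>+w. norm (h w) \<partial>M) \<le> ennreal (\<Sum>m. c m / 2 ^ Suc m)" .
  then show int: "integrable M h"
    by (intro integrableI_bounded) (auto intro: le_less_trans)
  have "ennreal \<bar>\<integral>w. h w \<partial>M\<bar> \<le> (\<integral>\<^sup>+w. norm (h w) \<partial>M)"
    using integral_norm_bound_ennreal[OF int] by simp
  also note bound
  finally show "\<bar>\<integral>w. h w \<partial>M\<bar> \<le> (\<Sum>m. c m / 2 ^ Suc m)"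
    using c by (subst (asm) ennreal_le_iff) (auto intro!: suminf_nonneg)
qed

lemma ring_integral_tent:
  fixes D :: real
  assumes x: "x \<in> space M" and h: "h \<in> borel_measurable M" and D: "D \<ge> 0"
    and bd: "\<And>m w. w \<in> ring m x \<Longrightarrow> \<bar>h w\<bar> \<le> D * 2 ^ m * (3/4) ^ ((n - m) + (m - n))"
  shows "integrable M h" "\<bar>\<integral>w. h w \<partial>M\<bar> \<le> 4 * D"
proof -
  define c where "c m = D * 2 ^ m * (3/4) ^ ((n - m) + (m - n))" for m
  have eq: "(\<lambda>m. c m / 2 ^ Suc m) = (\<lambda>m. D / 2 * (3/4) ^ ((n - m) + (m - n)))"
    by (auto simp: c_def fun_eq_iff)
  have c0: "0 \<le> c m" for m using D by (simp add: c_def)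
  have cs: "summable (\<lambda>m. c m / 2 ^ Suc m)" unfolding eq by (intro summable_mult tent_sum)
  have bd': "\<And>m w. w \<in> ring m x \<Longrightarrow> \<bar>h w\<bar> \<le> c m" unfolding c_def by (rule bd)
  show "integrable M h" by (rule ring_integral(1)[OF x h c0 cs bd'])
  have "\<bar>\<integral>w. h w \<partial>M\<bar> \<le> (\<Sum>m. c m / 2 ^ Suc m)" by (rule ring_integral(2)[OF x h c0 cs bd'])
  also have "\<dots> = D / 2 * (\<Sum>m. (3/4) ^ ((n - m) + (m - n)))"
    unfolding eq by (intro suminf_mult tent_sum)
  also have "\<dots> \<le> D / 2 * 7" using D by (intro mult_left_mono tent_sum) auto
  finally show "\<bar>\<integral>w. h w \<partial>M\<bar> \<le> 4 * D" using D by linarith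
qed

text \<open>With respect to the metric \<open>r ^ m\<close> on the tree this is Hoelder continuity. It is the class in which the
  potential operator is inverted: data with \<open>b = 1/4\<close> have solutions with \<open>b = 1/2\<close>, since the inverse
  loses a factor \<open>2 ^ n\<close> at level \<open>n\<close>.\<close>

definition osc :: "real \<Rightarrow> real \<Rightarrow> ('a \<Rightarrow> real) \<Rightarrow> bool" where
  "osc C b f \<longleftrightarrow> (\<forall>n. \<forall>x\<in>space M. \<forall>y\<in>cyl n x. \<bar>f x - f y\<bar> \<le> C * b ^ n)"

lemma oscD: "osc C b f \<Longrightarrow> x \<in> space M \<Longrightarrow> y \<in> cyl n x \<Longrightarrow> \<bar>f x - f y\<bar> \<le> C * b ^ n"
  by (auto simp: osc_def)

lemma osc_bound: "osc C b f \<Longrightarrow> x \<in> space M \<Longrightarrow> y \<in> space M \<Longrightarrow> \<bar>f x - f y\<bar> \<le> C"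
  using oscD[of C b f x y 0] cyl_0 by auto

lemma osc_nonneg: "osc C b f \<Longrightarrow> C \<ge> 0"
proof -
  assume f: "osc C b f"
  obtain x where "x \<in> space M" using not_empty by blast
  then show "C \<ge> 0" using osc_bound[OF f, of x x] by simp
qed

lemma osc_measurable:
  assumes f: "osc C b f" and b: "0 \<le> b" "b < 1"
  shows "f \<in> borel_measurable M"
proof (rule borel_measurable_LIMSEQ_metric)
  define p where "p n j = (SOME y. y \<in> space M \<and> idx n y = j)" for n j
  have p: "p n (idx n x) \<in> cyl n x" if "x \<in> space M" for n x
  proof -
    have "p n (idx n x) \<in> space M \<and> idx n (p n (idx n x)) = idx n x"
      unfolding p_def by (rule someI[of _ x]) (use that in simp)
    then show ?thesis by (simp add: cyl_def)
  qed
  show "(\<lambda>x. f (p n (idx n x))) \<in> borel_measurable M" for n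
    by (rule measurable_compose[OF idx_measurable]) simp
  show "(\<lambda>n. f (p n (idx n x))) \<longlonglongrightarrow> f x" if x: "x \<in> space M" for x
  proof -
    have "(\<lambda>n. C * b ^ n) \<longlonglongrightarrow> C * 0" using b by (intro tendsto_mult_left LIMSEQ_power_zero) auto
    then have lim: "(\<lambda>n. C * b ^ n) \<longlonglongrightarrow> 0" by simp
    have "norm (f (p n (idx n x)) - f x) \<le> C * b ^ n" for n
      using oscD[OF f x p[OF x, of n]] by (simp add: abs_minus_commute)
    then have "(\<lambda>n. f (p n (idx n x)) - f x) \<longlonglongrightarrow> 0"
      by (intro Lim_null_comparison[OF _ lim] always_eventually allI)
    then show ?thesis by (rule LIM_zero_cancel)
  qed
qed

lemma osc_bounded:
  assumes "osc C b f"
  obtains B where "B \<ge> 0" "\<And>x. x \<in> space M \<Longrightarrow> \<bar>f x\<bar> \<le> B"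
proof -
  obtain x0 where x0: "x0 \<in> space M" using not_empty by blast
  have "\<bar>f x\<bar> \<le> C + \<bar>f x0\<bar>" if "x \<in> space M" for x
    using osc_bound[OF assms that x0] by linarith
  then show ?thesis using that[of "C + \<bar>f x0\<bar>"] osc_nonneg[OF assms] by auto
qed

lemma bounded_integrable:
  fixes f :: "'a \<Rightarrow> real"
  assumes "f \<in> borel_measurable M" "\<And>x. x \<in> space M \<Longrightarrow> \<bar>f x\<bar> \<le> B"
  shows "integrable M f"
  by (rule integrable_const_bound[of f B]) (use assms in auto)

lemma osc_integrable: "osc C b f \<Longrightarrow> 0 \<le> b \<Longrightarrow> b < 1 \<Longrightarrow> integrable M f"
  by (metis bounded_integrable osc_measurable osc_bounded)

lemma osc_add:
  "osc C b f \<Longrightarrow> osc C' b g \<Longrightarrow> osc (C + C') b (\<lambda>x. f x + g x)"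
  unfolding osc_def by (smt (verit) distrib_right)

lemma osc_const: "osc 0 b (\<lambda>x. a)"
  by (simp add: osc_def)

definition P :: "nat \<Rightarrow> ('a \<Rightarrow> real) \<Rightarrow> 'a \<Rightarrow> real" where
  "P m f x = (\<integral>w. indicator (cyl m x) w * f w \<partial>M)"

text \<open>\<open>E m f\<close> is the conditional expectation of \<open>f\<close> given the cylinders of level \<open>m\<close>.\<close>

definition E :: "nat \<Rightarrow> ('a \<Rightarrow> real) \<Rightarrow> 'a \<Rightarrow> real" where
  "E m f x = 2 ^ m * P m f x"

lemma E_cong_cyl: "y \<in> cyl m x \<Longrightarrow> E m f y = E m f x"
  by (simp add: E_def P_def cyl_eq)

lemma E_cong_cyl': "x \<in> space M \<Longrightarrow> y \<in> cyl n x \<Longrightarrow> m \<le> n \<Longrightarrow> E m f y = E m f x"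
  using E_cong_cyl cyl_mono by blast

lemma indicator_integrable: "integrable M f \<Longrightarrow> integrable M (\<lambda>w. indicator (cyl m x) w * f w :: real)"
  using integrable_mult_indicator[of "cyl m x" M f] by simp

lemma E_close:
  assumes x: "x \<in> space M" and f: "integrable M f" and c: "\<And>y. y \<in> cyl m x \<Longrightarrow> \<bar>a - f y\<bar> \<le> c"
  shows "\<bar>E m f x - a\<bar> \<le> c"
proof -
  have c0: "c \<ge> 0" using c[OF cyl_self[OF x]] by linarith
  have ind: "integrable M (\<lambda>w. indicator (cyl m x) w :: real)"
    by (rule bounded_integrable[of _ 1]) (auto simp: indicator_def)
  have "(\<integral>w. indicator (cyl m x) w * a \<partial>M) = a / 2 ^ m"
    using prob_cyl[OF x, of m] by simp
  then have "P m f x - a / 2 ^ m = (\<integral>w. indicator (cyl m x) w * f w - indicator (cyl m x) w * a \<partial>M)"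
    unfolding P_def using indicator_integrable[OF f] ind by (subst Bochner_Integration.integral_diff) auto
  also have "\<bar>\<dots>\<bar> \<le> (\<integral>w. indicator (cyl m x) w * c \<partial>M)"
  proof (rule order_trans[OF integral_abs_bound integral_mono])
    show "integrable M (\<lambda>w. \<bar>indicator (cyl m x) w * f w - indicator (cyl m x) w * a\<bar>)"
      using indicator_integrable[OF f] ind by (intro integrable_abs Bochner_Integration.integrable_diff) auto
    show "integrable M (\<lambda>w. indicator (cyl m x) w * c)" using ind by simp
    show "\<bar>indicator (cyl m x) w * f w - indicator (cyl m x) w * a\<bar> \<le> indicator (cyl m x) w * c" for w
      using c[of w] c0 by (auto simp: indicator_def abs_minus_commute)
  qed
  also have "\<dots> = c / 2 ^ m" using prob_cyl[OF x, of m] by simp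
  finally have "\<bar>P m f x - a / 2 ^ m\<bar> * 2 ^ m \<le> c / 2 ^ m * 2 ^ m" by (intro mult_right_mono) auto
  moreover have "\<bar>P m f x - a / 2 ^ m\<bar> * 2 ^ m = \<bar>(P m f x - a / 2 ^ m) * 2 ^ m\<bar>" by (simp add: abs_mult)
  ultimately show ?thesis by (simp add: E_def field_simps)
qed

lemma E_measurable [measurable]: "E m f \<in> borel_measurable M"
proof -
  define e where "e j = 2 ^ m * (\<integral>w. indicator {y \<in> space M. idx m y = j} w * f w \<partial>M)" for j
  have "E m f = (\<lambda>x. e (idx m x))" by (auto simp: fun_eq_iff E_def P_def e_def cyl_def)
  moreover have "(\<lambda>x. e (idx m x)) \<in> borel_measurable M"
    by (rule measurable_compose[OF idx_measurable]) simp
  ultimately show ?thesis by simp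
qed

lemma integral_blocks:
  fixes g :: "'a \<Rightarrow> real"
  assumes g: "integrable M g"
  shows "(\<integral>w. g w \<partial>M) = (\<Sum>j<2 ^ m. \<integral>w. indicator {y \<in> space M. idx m y = j} w * g w \<partial>M)"
proof -
  define F where "F j = {y \<in> space M. idx m y = j}" for j
  have F: "F j \<in> sets M" for j unfolding F_def by measurable
  have "(\<integral>w. g w \<partial>M) = (\<integral>w. (\<Sum>j<2 ^ m. indicator (F j) w * g w) \<partial>M)"
  proof (rule Bochner_Integration.integral_cong[OF refl])
    fix w assume w: "w \<in> space M"
    have "(\<Sum>j<2 ^ m. indicator (F j) w :: real) = (\<Sum>j<2 ^ m. if j = idx m w then 1 else 0)"
      using w by (intro sum.cong) (auto simp: F_def)
    also have "\<dots> = 1" using idx_less[OF w, of m] by simp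
    finally show "g w = (\<Sum>j<2 ^ m. indicator (F j) w * g w)"
      unfolding sum_distrib_right[symmetric] by simp
  qed
  also have "\<dots> = (\<Sum>j<2 ^ m. \<integral>w. indicator (F j) w * g w \<partial>M)"
    using integrable_mult_indicator[OF F g] by (intro Bochner_Integration.integral_sum) simp
  finally show ?thesis by (simp add: F_def)
qed

lemma block_ex:
  assumes "j < 2 ^ m"
  obtains y where "y \<in> space M" "idx m y = j"
proof -
  have "prob {y \<in> space M. idx m y = j} \<noteq> 0" using idx_prob[OF assms] by simp
  then have "{y \<in> space M. idx m y = j} \<noteq> {}" by force
  then show ?thesis using that by blast
qed

lemma integral_tower:
  assumes f: "integrable M f" and k: "k \<le> m" and x: "x \<in> space M" and Ef: "integrable M (E m f)"
  shows "P k (E m f) x = P k f x"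
proof -
  define F where "F j = {y \<in> space M. idx m y = j}" for j
  have [measurable]: "F j \<in> sets M" for j unfolding F_def by measurable
  have decomp: "P k g x = (\<Sum>j<2 ^ m. \<integral>w. indicator (F j) w * (indicator (cyl k x) w * g w) \<partial>M)"
    if g: "integrable M g" for g
    unfolding P_def F_def by (rule integral_blocks[OF indicator_integrable[OF g]])
  have "(\<integral>w. indicator (F j) w * (indicator (cyl k x) w * E m f w) \<partial>M) =
      (\<integral>w. indicator (F j) w * (indicator (cyl k x) w * f w) \<partial>M)" if j: "j < 2 ^ m" for j
  proof -
    obtain y where y: "y \<in> space M" "idx m y = j" by (rule block_ex[OF j])
    have Fj: "F j = cyl m y" using y by (auto simp: F_def cyl_def)
    show ?thesis
    proof (cases "y \<in> cyl k x")
      case True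
      then have sub: "F j \<subseteq> cyl k x" unfolding Fj using cyl_mono[OF y(1) k] cyl_eq by blast
      have "(\<integral>w. indicator (F j) w * (indicator (cyl k x) w * E m f w) \<partial>M) =
          (\<integral>w. indicator (cyl m y) w * E m f y \<partial>M)"
        using sub E_cong_cyl[of _ m y f] by (intro Bochner_Integration.integral_cong) (auto simp: indicator_def Fj)
      also have "\<dots> = P m f y" using prob_cyl[OF y(1), of m] by (simp add: E_def)
      also have "\<dots> = (\<integral>w. indicator (F j) w * (indicator (cyl k x) w * f w) \<partial>M)"
        unfolding P_def using sub by (intro Bochner_Integration.integral_cong) (auto simp: indicator_def Fj)
      finally show ?thesis .
    next
      case False
      have "w \<notin> cyl k x" if "w \<in> F j" for w
      proof
        assume "w \<in> cyl k x"
        moreover have "w \<in> cyl k y" using that cyl_mono[OF y(1) k] Fj by blast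
        ultimately have "cyl k y = cyl k x" using cyl_eq by metis
        then show False using False cyl_self[OF y(1), of k] by simp
      qed
      then have "indicator (F j) w * (indicator (cyl k x) w * a) = (0::real)" for w a
        by (auto simp: indicator_def)
      then show ?thesis by (simp only:)
    qed
  qed
  then show ?thesis unfolding decomp[OF f] decomp[OF Ef] by (intro sum.cong) auto
qed

end


lemma le_three_halves_power: "real m \<le> (3/2) ^ m"
proof (induction m)
  case (Suc m)
  show ?case
  proof (cases "m \<le> 1")
    case True
    then have "m = 0 \<or> m = 1" by auto
    then show ?thesis by (auto simp: power2_eq_square)
  next
    case False
    then have "real (Suc m) \<le> (3/2) * real m" by simp
    also have "\<dots> \<le> (3/2) ^ Suc m" using Suc by simp
    finally show ?thesis .
  qed
qed simp

text \<open>A kernel that is \<open>L\<close> times the depth of the last common cylinder of its arguments, up to a bounded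
  error which varies slowly off the diagonal.\<close>

locale dyadic_kernel = dyadic_space M idx
  for M :: "'a measure" and idx :: "nat \<Rightarrow> 'a \<Rightarrow> nat" +
  fixes k :: "'a \<Rightarrow> 'a \<Rightarrow> real" and L \<rho> :: real
  assumes L_ge: "L \<ge> 100" and rho: "0 < \<rho>" "\<rho> \<le> 1 / 1000"
    and k_measurable: "x \<in> space M \<Longrightarrow> k x \<in> borel_measurable M"
    and k_ring: "x \<in> space M \<Longrightarrow> w \<in> ring m x \<Longrightarrow> \<bar>k x w - L * real m\<bar> \<le> 1 / 2"
    and k_cont: "x \<in> space M \<Longrightarrow> y \<in> cyl n x \<Longrightarrow> w \<in> ring m x \<Longrightarrow> m < n \<Longrightarrow>
        \<bar>k x w - k y w\<bar> \<le> 5 * \<rho> ^ (n - m)"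
begin

text \<open>The depth as a series of indicator functions, which can be integrated term by term.\<close>

definition depth :: "'a \<Rightarrow> 'a \<Rightarrow> real" where
  "depth x w = (\<Sum>m. indicator (cyl (Suc m) x) w)"

definition k1 :: "'a \<Rightarrow> 'a \<Rightarrow> real" where
  "k1 x w = (if w = x then 0 else k x w - L * depth x w)"

definition T :: "('a \<Rightarrow> real) \<Rightarrow> 'a \<Rightarrow> real" where
  "T \<phi> x = (\<integral>w. k x w * \<phi> w \<partial>M)"

definition T1 :: "('a \<Rightarrow> real) \<Rightarrow> 'a \<Rightarrow> real" where
  "T1 \<phi> x = (\<integral>w. k1 x w * \<phi> w \<partial>M)"

lemma indicator_cyl_ring:
  assumes "x \<in> space M" "w \<in> ring m x"
  shows "indicator (cyl (Suc i) x) w = (if i < m then 1 else (0::real))"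
  using ring_in_cyl[OF assms, of "Suc i"] by (auto simp: indicator_def)

lemma depth_ring:
  assumes "x \<in> space M" "w \<in> ring m x"
  shows "depth x w = real m"
proof -
  have "depth x w = (\<Sum>i<m. indicator (cyl (Suc i) x) w)"
    unfolding depth_def by (rule suminf_finite) (auto simp: indicator_cyl_ring[OF assms])
  also have "\<dots> = (\<Sum>i<m. 1)" by (intro sum.cong) (auto simp: indicator_cyl_ring[OF assms])
  finally show ?thesis by simp
qed

lemma depth_measurable [measurable]: "depth x \<in> borel_measurable M"
  unfolding depth_def by measurable

lemma k1_measurable:
  assumes x: "x \<in> space M"
  shows "k1 x \<in> borel_measurable M"
  unfolding k1_def
proof (rule measurable_If)
  have "{w \<in> space M. w = x} = {x}" using x by auto
  then show "{w \<in> space M. w = x} \<in> sets M" using singleton_sets[OF x] by simp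
  show "(\<lambda>w. k x w - L * depth x w) \<in> borel_measurable M"
    using k_measurable[OF x] by (intro borel_measurable_diff borel_measurable_times) auto
qed simp

lemma k1_bound:
  assumes x: "x \<in> space M" and w: "w \<in> space M"
  shows "\<bar>k1 x w\<bar> \<le> 1 / 2"
proof (cases "w = x")
  case False
  then obtain m where m: "w \<in> ring m x" using ring_ex[OF x w] by blast
  show ?thesis using k_ring[OF x m] depth_ring[OF x m] False by (simp add: k1_def)
qed (simp add: k1_def)

lemma k_bound:
  assumes x: "x \<in> space M" and w: "w \<in> ring m x"
  shows "\<bar>k x w\<bar> \<le> (L + 1) * 2 ^ m * (3/4) ^ ((0 - m) + (m - 0))"
proof -
  have "(2::real) ^ m * (3/4) ^ m = (3/2) ^ m" by (simp add: power_mult_distrib[symmetric])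
  moreover have "(1::real) \<le> (3/2) ^ m" by simp
  then have "L * m + 1 \<le> L * (3/2) ^ m + (3/2) ^ m"
    using L_ge le_three_halves_power[of m] by (intro add_mono mult_left_mono) auto
  moreover have "\<bar>k x w\<bar> \<le> L * m + 1" using k_ring[OF x w] L_ge
    using mult_nonneg_nonneg[of L "real m"] by linarith
  ultimately show ?thesis by (simp add: algebra_simps)
qed

lemma k_integrable: "x \<in> space M \<Longrightarrow> integrable M (k x)"
  by (rule ring_integral_tent(1)[OF _ k_measurable, of x x "L + 1" 0]) (use L_ge k_bound in auto)

lemma k_abs_integral: 
  assumes x: "x \<in> space M"
  shows "(\<integral>w. \<bar>k x w\<bar> \<partial>M) \<le> 4 * (L + 1)"
proof -
  have "\<bar>\<integral>w. \<bar>k x w\<bar> \<partial>M\<bar> \<le> 4 * (L + 1)"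
    by (rule ring_integral_tent(2)[OF x, of _ _ 0]) (use L_ge k_bound[OF x] k_measurable[OF x] in auto)
  then show ?thesis by linarith
qed

lemma times_bounded_integrable:
  fixes g :: "'a \<Rightarrow> real"
  assumes g: "integrable M g" and m [measurable]: "\<phi> \<in> borel_measurable M"
    and B: "\<And>w. w \<in> space M \<Longrightarrow> \<bar>\<phi> w\<bar> \<le> B"
  shows "integrable M (\<lambda>w. g w * \<phi> w)"
proof (rule Bochner_Integration.integrable_bound[of M "\<lambda>w. g w * B"])
  show "integrable M (\<lambda>w. g w * B)" using g by simp
  show "(\<lambda>w. g w * \<phi> w) \<in> borel_measurable M" using g by measurable
  show "AE w in M. norm (g w * \<phi> w) \<le> norm (g w * B)"
    using B by (intro AE_I2) (auto simp: abs_mult intro!: mult_left_mono order_trans[OF B])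
qed

lemma k1_integrable: "x \<in> space M \<Longrightarrow> integrable M (k1 x)"
  by (rule bounded_integrable[OF k1_measurable k1_bound])

text \<open>Integrating the series for \<open>depth\<close> splits \<open>T\<close> into the ultrametric operator
  \<open>\<phi> \<mapsto> L * (\<Sum>i. P (Suc i) \<phi>)\<close> and an operator \<open>T1\<close> with bounded kernel.\<close>

lemma T_decomp:
  assumes x: "x \<in> space M" and m [measurable]: "\<phi> \<in> borel_measurable M"
    and B: "\<And>w. w \<in> space M \<Longrightarrow> \<bar>\<phi> w\<bar> \<le> B"
  shows "T \<phi> x = L * (\<Sum>i. P (Suc i) \<phi> x) + T1 \<phi> x"
proof -
  have B0: "B \<ge> 0" using B[OF x] by linarith
  have phi: "integrable M \<phi>" by (rule bounded_integrable[OF m B])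
  let ?f = "\<lambda>i w. indicator (cyl (Suc i) x) w * \<phi> w"
  have int: "integrable M (?f i)" for i by (rule indicator_integrable[OF phi])
  have AEs: "AE w in M. summable (\<lambda>i. norm (?f i w)) \<and> (\<Sum>i. ?f i w) = depth x w * \<phi> w"
  proof (rule AE_mp[OF AE_neq[OF x]], rule AE_I2, rule impI)
    fix w assume "w \<in> space M" "w \<noteq> x"
    then obtain m where m: "w \<in> ring m x" using ring_ex[OF x] by blast
    note ind = indicator_cyl_ring[OF x m]
    have 1: "summable (\<lambda>i. norm (?f i w))"
      by (rule summable_finite[of "{..<m}"]) (auto simp: ind)
    have "(\<Sum>i. ?f i w) = (\<Sum>i<m. ?f i w)"
      by (rule suminf_finite) (auto simp: ind)
    also have "\<dots> = (\<Sum>i<m. \<phi> w)" by (intro sum.cong) (auto simp: ind)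
    also have "\<dots> = depth x w * \<phi> w" by (simp add: depth_ring[OF x m])
    finally show "summable (\<lambda>i. norm (?f i w)) \<and> (\<Sum>i. ?f i w) = depth x w * \<phi> w" using 1 by simp
  qed
  have AE1: "AE w in M. summable (\<lambda>i. norm (?f i w))" using AEs by eventually_elim simp
  have AE2: "AE w in M. (\<Sum>i. ?f i w) = depth x w * \<phi> w" using AEs by eventually_elim simp
  have le: "(\<integral>w. norm (?f i w) \<partial>M) \<le> B * (1/2) ^ Suc i" for i
  proof -
    have "(\<integral>w. norm (?f i w) \<partial>M) \<le> (\<integral>w. indicator (cyl (Suc i) x) w * B \<partial>M)"
    proof (rule integral_mono)
      show "integrable M (\<lambda>w. norm (?f i w))" by (intro integrable_norm int)
      show "integrable M (\<lambda>w. indicator (cyl (Suc i) x) w * B)"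
        using indicator_integrable[of "\<lambda>_. B"] by simp
      show "norm (?f i w) \<le> indicator (cyl (Suc i) x) w * B" if "w \<in> space M" for w
        using B[OF that] by (auto simp: indicator_def)
    qed
    also have "\<dots> = B * (1/2) ^ Suc i" using prob_cyl[OF x, of "Suc i"] by (simp add: power_one_over)
    finally show ?thesis .
  qed
  have sm: "summable (\<lambda>i. \<integral>w. norm (?f i w) \<partial>M)"
    by (rule summable_comparison_test'[of "\<lambda>i. B * (1/2) ^ Suc i" 0])
       (use le in \<open>auto intro!: summable_mult complete_algebra_summable_geometric simp del: power_Suc simp: summable_Suc_iff\<close>)
  have i1: "integrable M (\<lambda>w. depth x w * \<phi> w)"
    by (rule integrable_cong_AE_imp[OF integrable_suminf[OF int AE1 sm]]) (use AE2 in auto)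
  have i2: "(\<integral>w. depth x w * \<phi> w \<partial>M) = (\<Sum>i. P (Suc i) \<phi> x)"
  proof -
    have "(\<integral>w. depth x w * \<phi> w \<partial>M) = (\<integral>w. (\<Sum>i. ?f i w) \<partial>M)"
      by (rule integral_cong_AE) (use AE2 in auto)
    also have "\<dots> = (\<Sum>i. P (Suc i) \<phi> x)" unfolding P_def by (rule integral_suminf[OF int AE1 sm])
    finally show ?thesis .
  qed
  have i3: "integrable M (\<lambda>w. k1 x w * \<phi> w)"
    by (rule times_bounded_integrable[OF k1_integrable[OF x] m B])
  have "T \<phi> x = (\<integral>w. L * (depth x w * \<phi> w) + k1 x w * \<phi> w \<partial>M)"
    unfolding T_def
  proof (rule integral_cong_AE)
    show "AE w in M. k x w * \<phi> w = L * (depth x w * \<phi> w) + k1 x w * \<phi> w"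
      using AE_neq[OF x] by eventually_elim (auto simp: k1_def algebra_simps)
    show "(\<lambda>w. k x w * \<phi> w) \<in> borel_measurable M" using k_measurable[OF x] by measurable
    show "(\<lambda>w. L * (depth x w * \<phi> w) + k1 x w * \<phi> w) \<in> borel_measurable M"
      using k1_measurable[OF x] by measurable
  qed
  also have "\<dots> = L * (\<Sum>i. P (Suc i) \<phi> x) + T1 \<phi> x"
    using i1 i3 by (simp add: T1_def i2)
  finally show ?thesis .
qed

end

locale balanced_kernel = dyadic_kernel +
  assumes k_const: "x \<in> space M \<Longrightarrow> (\<integral>w. k x w \<partial>M) = L"
begin

lemma T1_one: 
  assumes x: "x \<in> space M"
  shows "(\<integral>w. k1 x w \<partial>M) = 0"
proof -
  have "P (Suc i) (\<lambda>_. 1) x = (1/2) ^ Suc i" for i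
    using prob_cyl[OF x, of "Suc i"] by (simp add: P_def power_one_over)
  then have "(\<Sum>i. P (Suc i) (\<lambda>_. 1) x) = 1"
    using sums_unique[OF power_half_series] by (simp only:)
  then show ?thesis using T_decomp[OF x, of "\<lambda>_. 1" 1] k_const[OF x] by (simp add: T_def T1_def)
qed

text \<open>Because \<open>T1\<close> annihilates constants, \<open>\<phi> x\<close> may be subtracted from \<open>\<phi>\<close> before estimating. The cylinder of
  \<open>x\<close> and \<open>y\<close> then has mass \<open>1 / 2 ^ n\<close> and contributes \<open>C / 4 ^ n\<close>, up to a constant factor; the
  points outside contribute no more, thanks to the slow variation of the kernel. The factor \<open>L\<close> does
  not appear in the bound.\<close>

lemma T1_osc:
  assumes phi: "osc C (1/2) \<phi>"
  shows "osc (4 * C) (1/4) (T1 \<phi>)"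
  unfolding osc_def
proof (intro allI ballI)
  fix n x y assume x: "x \<in> space M" and y: "y \<in> cyl n x"
  have yM: "y \<in> space M" using y cyl_subset_space by blast
  have C0: "C \<ge> 0" by (rule osc_nonneg[OF phi])
  have [measurable]: "\<phi> \<in> borel_measurable M" by (rule osc_measurable[OF phi]) auto
  note [measurable] = k1_measurable[OF x] k1_measurable[OF yM]
  obtain B where B: "\<And>w. w \<in> space M \<Longrightarrow> \<bar>\<phi> w\<bar> \<le> B" using osc_bounded[OF phi] by blast
  have i: "integrable M (\<lambda>w. k1 v w * \<phi> w)" if "v \<in> space M" for v
    by (rule times_bounded_integrable[OF k1_integrable[OF that] _ B]) auto
  let ?h = "\<lambda>w. (k1 x w - k1 y w) * (\<phi> w - \<phi> x)"
  have "T1 \<phi> x - T1 \<phi> y = (\<integral>w. k1 x w * \<phi> w - k1 y w * \<phi> w \<partial>M)"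
    unfolding T1_def using i[OF x] i[OF yM] by simp
  also have "\<dots> = (\<integral>w. k1 x w * \<phi> w - k1 y w * \<phi> w \<partial>M) - (\<integral>w. (k1 x w - k1 y w) * \<phi> x \<partial>M)"
    using k1_integrable[OF x] k1_integrable[OF yM] T1_one[OF x] T1_one[OF yM] by simp
  also have "\<dots> = (\<integral>w. ?h w \<partial>M)"
    using i[OF x] i[OF yM] k1_integrable[OF x] k1_integrable[OF yM]
    by (subst Bochner_Integration.integral_diff[symmetric]) (auto simp: algebra_simps)
  finally have eq: "T1 \<phi> x - T1 \<phi> y = (\<integral>w. ?h w \<partial>M)" .
  have "\<bar>\<integral>w. ?h w \<partial>M\<bar> \<le> 4 * (C * (1/4) ^ n)"
  proof (rule ring_integral_tent(2)[OF x, of _ _ n])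
    show "?h \<in> borel_measurable M" by measurable
    show "0 \<le> C * (1/4) ^ n" using C0 by simp
    fix m w assume w: "w \<in> ring m x"
    then have wM: "w \<in> space M" and wc: "w \<in> cyl m x" using cyl_subset_space by (auto simp: ring_def)
    have p: "\<bar>\<phi> w - \<phi> x\<bar> \<le> C * (1/2) ^ m" using oscD[OF phi x wc] by (simp add: abs_minus_commute)
    show "\<bar>?h w\<bar> \<le> C * (1/4) ^ n * 2 ^ m * (3/4) ^ (n - m + (m - n))"
    proof (cases "m < n")
      case True
      have wr: "w \<in> ring m y"
      proof -
        have "y \<in> cyl m x" "y \<in> cyl (Suc m) x"
          using y True cyl_mono[OF x, of m n] cyl_mono[OF x, of "Suc m" n] by auto
        then show ?thesis using w by (simp add: ring_def cyl_eq)
      qed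
      have ne: "w \<noteq> x" "w \<noteq> y" using w wr x yM cyl_self by (auto simp: ring_def)
      have "\<bar>k1 x w - k1 y w\<bar> \<le> 5 * \<rho> ^ (n - m)"
        using k_cont[OF x y w True] ne depth_ring[OF x w] depth_ring[OF yM wr] by (simp add: k1_def)
      also have "\<dots> \<le> 5 * (1/1000) ^ (n - m)" using rho by (intro mult_left_mono power_mono) auto
      finally have "\<bar>?h w\<bar> \<le> 5 * (1/1000) ^ (n - m) * (C * (1/2) ^ m)"
        unfolding abs_mult using p by (intro mult_mono) auto
      moreover have "5 * (1/1000) ^ (n - m) \<le> (1/4) ^ (n - m) * (3/4::real) ^ (n - m)"
      proof -
        define d where "d = n - m - 1"
        have d: "n - m = Suc d" using True by (simp add: d_def)
        have "(1/1000::real) ^ d \<le> (3/16) ^ d" by (rule power_mono) auto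
        then have "5 * (1/1000) ^ Suc d \<le> (3/16::real) ^ Suc d"
        proof -
          have "0 \<le> (3/16::real) ^ d" by simp
          then show ?thesis using \<open>(1/1000::real) ^ d \<le> (3/16) ^ d\<close> unfolding power_Suc by linarith
        qed
        then show ?thesis by (simp add: d power_mult_distrib[symmetric])
      qed
      then have "5 * (1/1000) ^ (n - m) * (C * (1/2) ^ m) \<le> ((1/4) ^ (n - m) * (3/4) ^ (n - m)) * (C * (1/2) ^ m)"
        using C0 by (intro mult_right_mono) auto
      moreover have "((1/4) ^ (n - m) * (3/4) ^ (n - m)) * (C * (1/2) ^ m) =
          C * (1/4) ^ n * 2 ^ m * (3/4) ^ (n - m + (m - n))"
      proof -
        have "(1/4::real) ^ n = (1/4) ^ (n - m) * (1/4) ^ m"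
          using True by (simp add: power_add[symmetric])
        moreover have "(1/4::real) ^ m * 2 ^ m = (1/2) ^ m" by (simp add: power_mult_distrib[symmetric])
        ultimately show ?thesis using True by simp
      qed
      ultimately show ?thesis by linarith
    next
      case False
      have "\<bar>k1 x w - k1 y w\<bar> \<le> 1" using k1_bound[OF x wM] k1_bound[OF yM wM] by linarith
      then have "\<bar>?h w\<bar> \<le> 1 * (C * (1/2) ^ m)" unfolding abs_mult using p by (intro mult_mono) auto
      also have "\<dots> \<le> C * (1/4) ^ n * 2 ^ m * (3/4) ^ (m - n)"
      proof -
        define d where "d = m - n"
        have m: "m = n + d" using False by (simp add: d_def)
        have "(1/2::real) ^ d \<le> (3/2) ^ d" by (rule power_mono) auto
        then have "C * ((1/2) ^ n * (1/2) ^ d) \<le> C * ((1/2) ^ n * (3/2) ^ d)"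
          using C0 by (intro mult_left_mono) auto
        moreover have "(1/4::real) ^ n * (2 ^ n * 2 ^ d) * (3/4) ^ d = (1/2) ^ n * (3/2) ^ d"
          by (simp add: power_mult_distrib[symmetric] mult.assoc[symmetric])
        ultimately show ?thesis by (simp add: m power_add mult.assoc)
      qed
      finally show ?thesis using False by simp
    qed
  qed
  then show "\<bar>T1 \<phi> x - T1 \<phi> y\<bar> \<le> 4 * C * (1/4) ^ n" unfolding eq by (simp add: mult.assoc)
qed


text \<open>The operator \<open>\<phi> \<mapsto> L * (\<Sum>i. P (Suc i) \<phi>)\<close> multiplies the martingale difference \<open>\<Delta> m\<close> by
  \<open>L / 2 ^ m\<close>; dividing by this factor, \<open>S\<close> inverts it on functions of mean zero.\<close>

definition \<Delta> :: "nat \<Rightarrow> ('a \<Rightarrow> real) \<Rightarrow> 'a \<Rightarrow> real" where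
  "\<Delta> m f x = E (Suc m) f x - E m f x"

definition S :: "('a \<Rightarrow> real) \<Rightarrow> 'a \<Rightarrow> real" where
  "S f x = (\<Sum>m. 2 ^ m * \<Delta> m f x) / L"

lemma L_pos: "L > 0" using L_ge by simp

lemma E_near:
  assumes f: "osc C (1/4) f" and x: "x \<in> space M"
  shows "\<bar>E m f x - f x\<bar> \<le> C * (1/4) ^ m"
  by (rule E_close[OF x osc_integrable[OF f]]) (use oscD[OF f x] in auto)

lemma Delta_bound:
  assumes f: "osc C (1/4) f" and x: "x \<in> space M"
  shows "\<bar>2 ^ m * \<Delta> m f x\<bar> \<le> 2 * C * (1/2) ^ m"
proof -
  have "C * (1/4) ^ Suc m \<le> C * (1/4) ^ m" using osc_nonneg[OF f] by simp
  then have "\<bar>\<Delta> m f x\<bar> \<le> 2 * (C * (1/4) ^ m)"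
    using E_near[OF f x, of m] E_near[OF f x, of "Suc m"] unfolding \<Delta>_def by linarith
  then have "2 ^ m * \<bar>\<Delta> m f x\<bar> \<le> 2 ^ m * (2 * (C * (1/4) ^ m))" by (intro mult_left_mono) auto
  also have "\<dots> = 2 * C * (1/2) ^ m"
    using power_mult_distrib[of "2::real" "1/4" m] by (simp add: algebra_simps)
  finally show ?thesis by (simp add: abs_mult)
qed

lemma geom_half: "summable (\<lambda>m. c * (1/2::real) ^ m)" "(\<Sum>m. c * (1/2::real) ^ m) = 2 * c"
  by (auto intro!: summable_mult summable_geometric simp: suminf_mult suminf_geometric summable_geometric)

lemma Delta_summable:
  assumes f: "osc C (1/4) f" and x: "x \<in> space M"
  shows "summable (\<lambda>m. 2 ^ m * \<Delta> m f x)"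
  by (rule summable_comparison_test'[OF geom_half(1), of 0]) (use Delta_bound[OF f x] in auto)

lemma S_bound:
  assumes f: "osc C (1/4) f" and x: "x \<in> space M"
  shows "\<bar>S f x\<bar> \<le> 4 * C / L"
proof -
  have "norm (\<Sum>m. 2 ^ m * \<Delta> m f x) \<le> (\<Sum>m. (2 * C) * (1/2) ^ m)"
    using Delta_bound[OF f x] by (intro norm_suminf_le geom_half) simp
  then have "\<bar>\<Sum>m. 2 ^ m * \<Delta> m f x\<bar> \<le> 4 * C" unfolding geom_half(2) by simp
  then show ?thesis using L_pos by (simp add: S_def abs_divide divide_right_mono)
qed

lemma S_osc:
  assumes f: "osc C (1/4) f"
  shows "osc (8 * C / L) (1/2) (S f)"
  unfolding osc_def
proof (intro allI ballI)
  fix n x y assume x: "x \<in> space M" and y: "y \<in> cyl n x"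
  have yM: "y \<in> space M" using y cyl_subset_space by blast
  let ?a = "\<lambda>v m. 2 ^ m * \<Delta> m f v"
  have eq: "?a x m = ?a y m" if "m < n" for m
    using E_cong_cyl'[OF x y, of m f] E_cong_cyl'[OF x y, of "Suc m" f] that by (simp add: \<Delta>_def)
  have tail: "\<bar>\<Sum>m. ?a v (m + n)\<bar> \<le> 4 * C * (1/2) ^ n" if v: "v \<in> space M" for v
  proof -
    have "norm (\<Sum>m. ?a v (m + n)) \<le> (\<Sum>m. (2 * C * (1/2) ^ n) * (1/2) ^ m)"
      using Delta_bound[OF f v, of "_ + n"] by (intro norm_suminf_le geom_half) (simp add: power_add mult_ac)
    then show ?thesis unfolding geom_half(2) by simp
  qed
  have "(\<Sum>m<n. ?a x m) = (\<Sum>m<n. ?a y m)" by (intro sum.cong refl eq) simp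
  then have "(\<Sum>m. ?a x m) - (\<Sum>m. ?a y m) = (\<Sum>m. ?a x (m + n)) - (\<Sum>m. ?a y (m + n))"
    using suminf_split_initial_segment[OF Delta_summable[OF f x], of n]
      suminf_split_initial_segment[OF Delta_summable[OF f yM], of n]
    by linarith
  then have "\<bar>(\<Sum>m. ?a x m) - (\<Sum>m. ?a y m)\<bar> \<le> 8 * C * (1/2) ^ n"
    using tail[OF x] tail[OF yM] by linarith
  then have "\<bar>(\<Sum>m. ?a x m) - (\<Sum>m. ?a y m)\<bar> / L \<le> 8 * C * (1/2) ^ n / L"
    using L_pos by (intro divide_right_mono) auto
  then show "\<bar>S f x - S f y\<bar> \<le> 8 * C / L * (1/2) ^ n"
    using L_pos by (simp add: S_def diff_divide_distrib[symmetric] abs_divide)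
qed

lemma Delta_measurable [measurable]: "\<Delta> m f \<in> borel_measurable M"
  unfolding \<Delta>_def by measurable

lemma E_integrable:
  assumes f: "osc C (1/4) f"
  shows "integrable M (E m f)"
proof -
  obtain B where B: "\<And>x. x \<in> space M \<Longrightarrow> \<bar>f x\<bar> \<le> B" using osc_bounded[OF f] by blast
  have "(1/4::real) ^ m \<le> 1" by (simp add: power_le_one)
  then have C: "C * (1/4) ^ m \<le> C" using osc_nonneg[OF f] mult_left_mono by fastforce
  have "\<bar>E m f x\<bar> \<le> C + B" if x: "x \<in> space M" for x
    using E_near[OF f x, of m] B[OF x] C by linarith
  then show ?thesis by (intro bounded_integrable) auto
qed

lemma P_Delta:
  assumes f: "osc C (1/4) f" and x: "x \<in> space M"
  shows "P l (\<Delta> m f) x = (if m < l then \<Delta> m f x / 2 ^ l else 0)"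
proof (cases "m < l")
  case True
  have "P l (\<Delta> m f) x = (\<integral>w. indicator (cyl l x) w * \<Delta> m f x \<partial>M)"
    unfolding P_def
  proof (rule Bochner_Integration.integral_cong[OF refl])
    fix w
    show "indicator (cyl l x) w * \<Delta> m f w = indicator (cyl l x) w * \<Delta> m f x"
      using E_cong_cyl'[OF x, of w l m f] E_cong_cyl'[OF x, of w l "Suc m" f] True
      by (cases "w \<in> cyl l x") (auto simp: \<Delta>_def)
  qed
  then show ?thesis using True prob_cyl[OF x, of l] by simp
next
  case False
  have i: "integrable M f" by (rule osc_integrable[OF f]) auto
  have "P l (\<Delta> m f) x = P l (E (Suc m) f) x - P l (E m f) x"
    unfolding P_def \<Delta>_def right_diff_distrib
    by (intro Bochner_Integration.integral_diff indicator_integrable E_integrable[OF f])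
  also have "\<dots> = 0"
    using integral_tower[OF i _ x E_integrable[OF f], of l "Suc m"] integral_tower[OF i _ x E_integrable[OF f], of l m] False
    by simp
  finally show ?thesis using False by simp
qed

lemma P_S:
  assumes f: "osc C (1/4) f" and x: "x \<in> space M"
  shows "P l (S f) x = (\<Sum>m<l. 2 ^ m * \<Delta> m f x) / 2 ^ l / L"
proof -
  let ?g = "\<lambda>m w. indicator (cyl l x) w * (2 ^ m * \<Delta> m f w)"
  have Di: "integrable M (\<lambda>w. 2 ^ m * \<Delta> m f w)" for m
    by (rule bounded_integrable[OF _ Delta_bound[OF f]]) auto
  have int: "integrable M (?g m)" for m by (rule indicator_integrable[OF Di])
  have sm: "AE w in M. summable (\<lambda>m. norm (?g m w))"
  proof (rule AE_I2)
    fix w assume w: "w \<in> space M"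
    show "summable (\<lambda>m. norm (?g m w))"
      by (rule summable_comparison_test'[OF geom_half(1), of 0])
         (use Delta_bound[OF f w] osc_nonneg[OF f] in \<open>auto simp: indicator_def\<close>)
  qed
  have le: "(\<integral>w. norm (?g m w) \<partial>M) \<le> 2 * C * (1/2) ^ m" for m
  proof -
    have "(\<integral>w. norm (?g m w) \<partial>M) \<le> (\<integral>w. 2 * C * (1/2) ^ m \<partial>M)"
    proof (rule integral_mono)
      show "norm (?g m w) \<le> 2 * C * (1/2) ^ m" if "w \<in> space M" for w
        using Delta_bound[OF f that, of m] osc_nonneg[OF f] by (auto simp: indicator_def)
    qed (use int in auto)
    then show ?thesis by (simp add: prob_space)
  qed
  have sm2: "summable (\<lambda>m. \<integral>w. norm (?g m w) \<partial>M)"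
    by (rule summable_comparison_test'[OF geom_half(1), of 0]) (use le in auto)
  have "L * P l (S f) x = (\<integral>w. L * (indicator (cyl l x) w * S f w) \<partial>M)"
    unfolding P_def by simp
  also have "\<dots> = (\<integral>w. (\<Sum>m. ?g m w) \<partial>M)"
  proof (rule Bochner_Integration.integral_cong[OF refl])
    fix w assume w: "w \<in> space M"
    have "(\<Sum>m. ?g m w) = indicator (cyl l x) w * (\<Sum>m. 2 ^ m * \<Delta> m f w)"
      by (rule suminf_mult[OF Delta_summable[OF f w]])
    then show "L * (indicator (cyl l x) w * S f w) = (\<Sum>m. ?g m w)" using L_pos by (simp add: S_def)
  qed
  also have "\<dots> = (\<Sum>m. \<integral>w. ?g m w \<partial>M)" by (rule integral_suminf[OF int sm sm2])
  also have "\<dots> = (\<Sum>m. 2 ^ m * P l (\<Delta> m f) x)"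
  proof (intro suminf_cong)
    fix m
    have "(\<integral>w. ?g m w \<partial>M) = (\<integral>w. 2 ^ m * (indicator (cyl l x) w * \<Delta> m f w) \<partial>M)"
      by (intro Bochner_Integration.integral_cong) auto
    then show "(\<integral>w. ?g m w \<partial>M) = 2 ^ m * P l (\<Delta> m f) x" by (simp add: P_def)
  qed
  also have "\<dots> = (\<Sum>m<l. 2 ^ m * P l (\<Delta> m f) x)"
    by (rule suminf_finite) (auto simp: P_Delta[OF f x])
  also have "\<dots> = (\<Sum>m<l. 2 ^ m * \<Delta> m f x / 2 ^ l)"
    by (intro sum.cong) (auto simp: P_Delta[OF f x])
  finally have "L * P l (S f) x = (\<Sum>m<l. 2 ^ m * \<Delta> m f x) / 2 ^ l" by (simp only: sum_divide_distrib)
  then have "(\<Sum>m<l. 2 ^ m * \<Delta> m f x) / 2 ^ l / L = L * P l (S f) x / L" by (simp only:)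
  then show ?thesis using L_pos by simp
qed

lemma summation_by_parts:
  fixes a :: "nat \<Rightarrow> real"
  shows "(\<Sum>i<N. (\<Sum>m<Suc i. 2 ^ m * a m) / 2 ^ Suc i) = (\<Sum>m<N. a m) - (\<Sum>m<N. 2 ^ m * a m) / 2 ^ N"
proof (induction N)
  case (Suc N)
  have "(A + 2 ^ N * a N) / 2 ^ Suc N = (A / 2 ^ N + a N) / 2" for A
    by (simp add: add_divide_distrib)
  then have "(\<Sum>m<Suc N. 2 ^ m * a m) / 2 ^ Suc N = ((\<Sum>m<N. 2 ^ m * a m) / 2 ^ N + a N) / 2"
    unfolding sum.lessThan_Suc by blast
  moreover have "s + y = t + u - y" if "y = (q + u) / 2" "s = t - q" for q s t u y :: real
    using that by simp
  ultimately show ?case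
    using Suc unfolding sum.lessThan_Suc[of "\<lambda>i. (\<Sum>m<Suc i. 2 ^ m * a m) / 2 ^ Suc i"] sum.lessThan_Suc[of a]
    by blast
qed simp

text \<open>By \<open>P_S\<close> the series on the left is a double sum of martingale differences, and summation by parts
  turns its partial sums into \<open>E N f x - E 0 f x\<close> up to a term that tends to zero.\<close>

lemma T0_S:
  assumes f: "osc C (1/4) f" and x: "x \<in> space M"
  shows "L * (\<Sum>i. P (Suc i) (S f) x) = f x - E 0 f x"
proof -
  let ?a = "\<lambda>m. \<Delta> m f x"
  have E_lim: "(\<lambda>N. E N f x) \<longlonglongrightarrow> f x"
  proof -
    have "(\<lambda>m. C * (1/4) ^ m) \<longlonglongrightarrow> C * 0" by (intro tendsto_mult_left LIMSEQ_power_zero) auto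
    then have lim: "(\<lambda>m. C * (1/4) ^ m) \<longlonglongrightarrow> 0" by simp
    have "(\<lambda>N. E N f x - f x) \<longlonglongrightarrow> 0"
      by (rule Lim_null_comparison[OF _ lim]) (use E_near[OF f x] in auto)
    then show ?thesis by (rule LIM_zero_cancel)
  qed
  have tele: "(\<Sum>m<N. ?a m) = E N f x - E 0 f x" for N
    unfolding \<Delta>_def by (rule sum_lessThan_telescope)
  have "(\<lambda>N. (\<Sum>m<N. 2 ^ m * ?a m)) \<longlonglongrightarrow> (\<Sum>m. 2 ^ m * ?a m)"
    by (rule summable_LIMSEQ[OF Delta_summable[OF f x]])
  moreover have "(\<lambda>N. (1/2::real) ^ N) \<longlonglongrightarrow> 0" by (rule LIMSEQ_power_zero) simp
  ultimately have "(\<lambda>N. (\<Sum>m<N. 2 ^ m * ?a m) * (1/2) ^ N) \<longlonglongrightarrow> (\<Sum>m. 2 ^ m * ?a m) * 0"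
    by (rule tendsto_mult)
  moreover have "B * (1/2) ^ N = B / 2 ^ N" for B :: real and N by (simp add: power_one_over)
  ultimately have "(\<lambda>N. (\<Sum>m<N. 2 ^ m * ?a m) / 2 ^ N) \<longlonglongrightarrow> 0" by simp
  then have "(\<lambda>N. E N f x - E 0 f x - (\<Sum>m<N. 2 ^ m * ?a m) / 2 ^ N) \<longlonglongrightarrow> f x - E 0 f x - 0"
    by (intro tendsto_diff E_lim tendsto_const)
  then have "(\<lambda>N. \<Sum>i<N. (\<Sum>m<Suc i. 2 ^ m * ?a m) / 2 ^ Suc i) \<longlonglongrightarrow> f x - E 0 f x"
    unfolding summation_by_parts tele by simp
  then have "(\<lambda>i. (\<Sum>m<Suc i. 2 ^ m * ?a m) / 2 ^ Suc i) sums (f x - E 0 f x)" unfolding sums_def .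
  then have "(\<lambda>i. (\<Sum>m<Suc i. 2 ^ m * ?a m) / 2 ^ Suc i / L) sums ((f x - E 0 f x) / L)" by (rule sums_divide)
  then have "(\<Sum>i. P (Suc i) (S f) x) = (f x - E 0 f x) / L"
    unfolding P_S[OF f x] by (rule sums_unique[symmetric])
  then show ?thesis using L_pos by simp
qed

lemma E_0_const: "x \<in> space M \<Longrightarrow> y \<in> space M \<Longrightarrow> E 0 f x = E 0 f y"
  by (simp add: E_def P_def cyl_0)

text \<open>One step of the Neumann series: \<open>S\<close> gains a factor \<open>1 / L\<close>, so that \<open>T1 (S f)\<close> is small compared with
  \<open>f\<close>. The mean value of \<open>f\<close> only contributes a constant.\<close>

lemma S_residual:
  assumes f: "osc C (1/4) f"
  shows "osc (C / 2) (1/4) (\<lambda>x. f x - T (S f) x)"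
  unfolding osc_def
proof (intro allI ballI)
  fix n x y assume x: "x \<in> space M" and y: "y \<in> cyl n x"
  have yM: "y \<in> space M" using y cyl_subset_space by blast
  have "S f \<in> borel_measurable M" by (rule osc_measurable[OF S_osc[OF f]]) auto
  note T_decomp[OF _ this S_bound[OF f]]
  then have T: "f v - T (S f) v = E 0 f x - T1 (S f) v" if "v \<in> space M" for v
    using T0_S[OF f that] that E_0_const[OF that x] by simp
  have "\<bar>T1 (S f) x - T1 (S f) y\<bar> \<le> 4 * (8 * C / L) * (1/4) ^ n"
    using oscD[OF T1_osc[OF S_osc[OF f]] x y] .
  also have "\<dots> \<le> C / 2 * (1/4) ^ n"
  proof (rule mult_right_mono)
    have "32 * C \<le> C / 2 * L" using mult_left_mono[OF L_ge osc_nonneg[OF f]] osc_nonneg[OF f] by simp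
    then show "4 * (8 * C / L) \<le> C / 2" using L_pos by (simp add: field_simps)
  qed simp
  finally show "\<bar>(f x - T (S f) x) - (f y - T (S f) y)\<bar> \<le> C / 2 * (1/4) ^ n"
    unfolding T[OF x] T[OF yM] by linarith
qed

text \<open>The residuals \<open>F i\<close> of the successive approximations have oscillations that decay like \<open>1 / 2 ^ i\<close>, so
  the corrections \<open>S (F i)\<close> can be summed. The limit of the residuals has no oscillation, hence is the
  constant \<open>c\<close>.\<close>

theorem T_solvable:
  assumes f: "osc C (1/4) f"
  obtains \<phi> C' c where "osc C' (1/2) \<phi>" "\<And>x. x \<in> space M \<Longrightarrow> T \<phi> x = f x + c"
proof -
  define F where "F i = ((\<lambda>g x. g x - T (S g) x) ^^ i) f" for i
  have F0: "F 0 = f" and FS: "F (Suc i) = (\<lambda>x. F i x - T (S (F i)) x)" for i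
    by (auto simp: F_def)
  have osc: "osc (C * (1/2) ^ i) (1/4) (F i)" for i
    by (induction i) (use S_residual in \<open>force simp: F0 FS f\<close>)+
  define \<phi> where "\<phi> x = (\<Sum>i. S (F i) x)" for x
  have bd: "\<bar>S (F i) x\<bar> \<le> (4 * C / L) * (1/2) ^ i" if "x \<in> space M" for i x
    using S_bound[OF osc that] by (simp add: mult.assoc)
  have sm: "summable (\<lambda>i. S (F i) x)" if "x \<in> space M" for x
    by (rule summable_comparison_test'[OF geom_half(1)[of "4 * C / L"], of 0]) (use bd[OF that] in simp)
  have osc_phi: "osc (16 * C / L) (1/2) \<phi>"
    unfolding osc_def
  proof (intro allI ballI)
    fix n x y assume x: "x \<in> space M" and y: "y \<in> cyl n x"
    have yM: "y \<in> space M" using y cyl_subset_space by blast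
    have "\<phi> x - \<phi> y = (\<Sum>i. S (F i) x - S (F i) y)"
      unfolding \<phi>_def by (rule suminf_diff[OF sm[OF x] sm[OF yM]])
    also have "norm \<dots> \<le> (\<Sum>i. (8 * C / L * (1/2) ^ n) * (1/2) ^ i)"
      using oscD[OF S_osc[OF osc] x y] by (intro norm_suminf_le geom_half) (simp add: mult_ac)
    finally show "\<bar>\<phi> x - \<phi> y\<bar> \<le> 16 * C / L * (1/2) ^ n" unfolding geom_half(2) by simp
  qed
  have T_phi: "(\<lambda>n. F 0 x - F n x) \<longlonglongrightarrow> T \<phi> x" if x: "x \<in> space M" for x
  proof -
    have [measurable]: "S (F i) \<in> borel_measurable M" for i
      by (rule osc_measurable[OF S_osc[OF osc]]) auto
    let ?g = "\<lambda>i w. k x w * S (F i) w"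
    have int: "integrable M (?g i)" for i
      by (rule times_bounded_integrable[OF k_integrable[OF x] _ bd]) auto
    have sm1: "AE w in M. summable (\<lambda>i. norm (?g i w))"
    proof (rule AE_I2)
      fix w assume w: "w \<in> space M"
      have "summable (\<lambda>i. norm (S (F i) w))"
        by (rule summable_comparison_test'[OF geom_half(1)[of "4 * C / L"], of 0]) (use bd[OF w] in simp)
      then show "summable (\<lambda>i. norm (?g i w))" by (simp add: abs_mult summable_mult)
    qed
    have le: "(\<integral>w. norm (?g i w) \<partial>M) \<le> ((\<integral>w. \<bar>k x w\<bar> \<partial>M) * (4 * C / L)) * (1/2) ^ i" for i
    proof -
      have "(\<integral>w. norm (?g i w) \<partial>M) \<le> (\<integral>w. \<bar>k x w\<bar> * ((4 * C / L) * (1/2) ^ i) \<partial>M)"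
      proof (rule integral_mono)
        show "norm (?g i w) \<le> \<bar>k x w\<bar> * ((4 * C / L) * (1/2) ^ i)" if "w \<in> space M" for w
          unfolding real_norm_def abs_mult by (rule mult_left_mono[OF bd[OF that]]) simp
      qed (use int k_integrable[OF x] in auto)
      then show ?thesis by simp
    qed
    have sm2: "summable (\<lambda>i. \<integral>w. norm (?g i w) \<partial>M)"
      by (rule summable_comparison_test'[OF geom_half(1)[of "(\<integral>w. \<bar>k x w\<bar> \<partial>M) * (4 * C / L)"], of 0])
         (use le in simp)
    have "T \<phi> x = (\<integral>w. (\<Sum>i. ?g i w) \<partial>M)"
      unfolding T_def \<phi>_def
      by (intro Bochner_Integration.integral_cong refl suminf_mult[symmetric] sm)
    moreover have "(\<lambda>i. \<integral>w. ?g i w \<partial>M) sums (\<integral>w. (\<Sum>i. ?g i w) \<partial>M)"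
      by (rule sums_integral[OF int sm1 sm2])
    ultimately have "(\<lambda>i. T (S (F i)) x) sums T \<phi> x" by (simp add: T_def)
    moreover have "(\<Sum>i<n. T (S (F i)) x) = F 0 x - F n x" for n
      by (induction n) (auto simp: FS)
    ultimately show ?thesis by (simp add: sums_def)
  qed
  obtain x0 where x0: "x0 \<in> space M" using not_empty by blast
  have "T \<phi> x = f x + (T \<phi> x0 - f x0)" if x: "x \<in> space M" for x
  proof -
    have "(\<lambda>n. (F 0 x - F n x) - (F 0 x0 - F n x0)) \<longlonglongrightarrow> T \<phi> x - T \<phi> x0"
      by (intro tendsto_diff T_phi x x0)
    moreover have "(\<lambda>n. F n x - F n x0) \<longlonglongrightarrow> 0"
    proof (rule Lim_null_comparison)
      show "\<forall>\<^sub>F n in sequentially. norm (F n x - F n x0) \<le> C * (1/2) ^ n"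
        using osc_bound[OF osc x x0] by (intro always_eventually) simp
      have "(\<lambda>n. C * (1/2) ^ n) \<longlonglongrightarrow> C * 0" by (intro tendsto_mult_left LIMSEQ_power_zero) auto
      then show "(\<lambda>n. C * (1/2) ^ n) \<longlonglongrightarrow> 0" by simp
    qed
    then have "(\<lambda>n. (f x - f x0) - (F n x - F n x0)) \<longlonglongrightarrow> (f x - f x0) - 0"
      by (intro tendsto_diff tendsto_const)
    then have "(\<lambda>n. (F 0 x - F n x) - (F 0 x0 - F n x0)) \<longlonglongrightarrow> f x - f x0" by (simp add: F0 algebra_simps)
    ultimately have "T \<phi> x - T \<phi> x0 = f x - f x0" by (rule LIMSEQ_unique)
    then show ?thesis by simp
  qed
  then show ?thesis using that[OF osc_phi] by blast
qed

end

lemma abs_ln_diff_le_lipschitz: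
  fixes a b \<eta> :: real
  assumes "\<eta> > 0" "a \<ge> \<eta>" "b \<ge> \<eta>"
  shows "\<bar>ln a - ln b\<bar> \<le> \<bar>a - b\<bar> / \<eta>"
proof -
  have *: "ln a - ln b \<le> \<bar>a - b\<bar> / \<eta>" if "a \<ge> \<eta>" "b \<ge> \<eta>" for a b :: real
  proof -
    have "ln a - ln b \<le> (a - b) / b" using that assms(1) by (intro ln_diff_le) auto
    also have "\<dots> \<le> \<bar>a - b\<bar> / b" using that assms(1) by (intro divide_right_mono) auto
    also have "\<dots> \<le> \<bar>a - b\<bar> / \<eta>" using that assms(1) by (intro divide_left_mono) auto
    finally show ?thesis .
  qed
  show ?thesis using *[OF assms(2,3)] *[OF assms(3,2)] by (simp add: abs_le_iff abs_minus_commute)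
qed

context cantor
begin

section \<open>The logarithmic kernel on the Cantor set\<close>

sublocale D: dyadic_space M idx
  by unfold_locales
     (auto intro: idx_measurable idx_props(1) idx_Suc_div idx_prob[simplified] idx_separates)

lemma borel_measurable_M: "f \<in> borel_measurable borel \<Longrightarrow> f \<in> borel_measurable M"
  using measurable_restrict_space1[of f borel borel K] measurable_cong_sets[OF sets_M refl] by blast

lemma ln_dist_measurable: "(\<lambda>w. ln (dist y w)) \<in> borel_measurable M"
  by (rule borel_measurable_M) measurable

definition ker :: "real^2 \<Rightarrow> real^2 \<Rightarrow> real" where
  "ker x w = - ln (dist x w)"

lemma ker_measurable: "ker y \<in> borel_measurable M"
  unfolding ker_def using ln_dist_measurable by measurable

lemma ring_dist:
  assumes "x \<in> K" "w \<in> D.ring m x"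
  shows "(96/100) * r ^ m \<le> dist x w" "dist x w \<le> (104/100) * r ^ m"
  using split_dist[of x w m] assms by (auto simp: D.ring_def D.cyl_def)

lemma cyl_dist:
  assumes "x \<in> K" "w \<in> D.cyl m x"
  shows "dist x w \<le> 2 * r ^ m"
  using same_cell_dist[of x w m] assms by (auto simp: D.cyl_def)

lemma r_pow_diff_le:
  assumes "m < n"
  shows "r ^ n \<le> r ^ m / 1000"
proof -
  have "r ^ n \<le> r ^ Suc m" using assms r_small by (intro power_decreasing) auto
  then show ?thesis using r_pow_Suc_le[of m] by linarith
qed

text \<open>Moving \<open>x\<close> by at most \<open>2 * r ^ n\<close> hardly changes its distance to a point that was separated
  from \<open>x\<close> at an earlier level \<open>m\<close>.\<close>

lemma ln_dist_perturb:
  assumes x: "x \<in> K" and w: "w \<in> D.ring m x" and m: "m < n" and c: "c \<le> 2" and y: "dist x y \<le> c * r ^ n"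
  shows "\<bar>ln (dist y w) - ln (dist x w)\<bar> \<le> (5/2) * c * r ^ (n - m)"
proof -
  have d: "dist x w \<ge> (96/100) * r ^ m" using ring_dist[OF x w] by simp
  have pos: "dist x w > 0" using d zero_less_power[OF r_pos, of m] by linarith
  have diff: "\<bar>dist y w - dist x w\<bar> \<le> c * r ^ n"
    using y dist_triangle[of y w x] dist_triangle[of x w y] by (simp add: dist_commute abs_le_iff)
  have c0: "c \<ge> 0"
  proof (rule ccontr)
    assume "\<not> c \<ge> 0"
    then have "c * r ^ n < 0" by (intro mult_neg_pos) auto
    then show False using y zero_le_dist[of x y] by linarith
  qed
  have "c * r ^ n \<le> 2 * r ^ n" using c by (intro mult_right_mono) auto
  then have "\<bar>dist y w - dist x w\<bar> \<le> dist x w / 2"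
    using diff d r_pow_diff_le[OF m] by linarith
  then have "\<bar>ln (dist y w) - ln (dist x w)\<bar> \<le> 2 * \<bar>dist y w - dist x w\<bar> / dist x w"
    by (rule abs_ln_diff_le[OF pos])
  also have "\<dots> \<le> 2 * (c * r ^ n) / dist x w" using diff pos by (intro divide_right_mono) auto
  also have "\<dots> \<le> 2 * (c * r ^ n) / ((96/100) * r ^ m)"
    using d c0 pos by (intro divide_left_mono) auto
  also have "\<dots> = (2 / (96/100)) * c * (r ^ n / r ^ m)" by simp
  also have "r ^ n / r ^ m = r ^ (n - m)" using m by (simp add: power_diff)
  also have "(2 / (96/100)) * c * r ^ (n - m) \<le> (5/2) * c * r ^ (n - m)"
    using c0 by (intro mult_right_mono) auto
  finally show ?thesis .
qed

lemma ker_ring: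
  assumes x: "x \<in> K" and w: "w \<in> D.ring m x"
  shows "\<bar>ker x w - L * real m\<bar> \<le> 1 / 2"
proof -
  have pos: "r ^ m > 0" by simp
  have diff: "\<bar>dist x w - r ^ m\<bar> \<le> (4/100) * r ^ m" using ring_dist[OF x w] by linarith
  then have "\<bar>ln (dist x w) - ln (r ^ m)\<bar> \<le> 2 * \<bar>dist x w - r ^ m\<bar> / r ^ m"
    using pos by (intro abs_ln_diff_le) linarith+
  also have "\<dots> \<le> 2 * ((4/100) * r ^ m) / r ^ m" using diff by (intro divide_right_mono mult_left_mono) auto
  also have "\<dots> \<le> 1 / 2" by simp
  finally have "\<bar>ln (dist x w) - - (L * real m)\<bar> \<le> 1 / 2" by (simp add: ln_r_pow)
  then show ?thesis unfolding ker_def by linarith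
qed

sublocale D: dyadic_kernel M idx ker L r
proof unfold_locales
  show "100 \<le> L" "0 < r" "r \<le> 1 / 1000" using L r_small by auto
  fix x assume "x \<in> space M"
  then have x: "x \<in> K" by simp
  show "ker x \<in> borel_measurable M" by (rule ker_measurable)
  fix w m assume w: "w \<in> D.ring m x"
  show "\<bar>ker x w - L * real m\<bar> \<le> 1 / 2" by (rule ker_ring[OF x w])
  fix y n assume "y \<in> D.cyl n x" "m < n"
  then show "\<bar>ker x w - ker y w\<bar> \<le> 5 * r ^ (n - m)"
    using ln_dist_perturb[OF x w, of n 2 y] cyl_dist[OF x] by (simp add: ker_def)
qed

lemma block_integral_approx:
  fixes g :: "real^2 \<Rightarrow> real"
  assumes g: "integrable M g" and j: "j < 2 ^ m" and c: "\<And>w. w \<in> K \<Longrightarrow> idx m w = j \<Longrightarrow> \<bar>a - g w\<bar> \<le> c"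
  shows "\<bar>(\<integral>w. indicator {y \<in> K. idx m y = j} w * g w \<partial>M) - a / 2 ^ m\<bar> \<le> c / 2 ^ m"
proof -
  obtain y where y: "y \<in> space M" "idx m y = j" by (rule D.block_ex[OF j])
  have cyl: "D.cyl m y = {y \<in> K. idx m y = j}" using y by (simp add: D.cyl_def)
  have "\<bar>D.E m g y - a\<bar> \<le> c" by (rule D.E_close[OF y(1) g]) (use c cyl in auto)
  then have "\<bar>(D.E m g y - a) / 2 ^ m\<bar> \<le> c / 2 ^ m" by (simp add: abs_divide divide_right_mono)
  then show ?thesis by (simp add: D.E_def D.P_def cyl diff_divide_distrib)
qed

text \<open>At level \<open>m\<close>, replace the measure outside the cylinder of \<open>x\<close> by point masses at the centres
  \<open>z m i\<close> and \<open>x\<close> by \<open>z m j\<close>. The choice of \<open>s m j\<close> makes the resulting sum independent of \<open>j\<close> up to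
  \<open>s m j / 2 ^ Suc m\<close>, and the replacement costs \<open>O(r / 2 ^ m)\<close>.\<close>

lemma ker_const:
  assumes x: "x \<in> K"
  shows "(\<integral>w. ker x w \<partial>M) = L"
proof -
  have int: "integrable M (ker x)" by (rule D.k_integrable) (use x in simp)
  define A where "A m = (\<integral>w. ker x w \<partial>M) - D.P m (ker x) x" for m
  have A_approx: "\<bar>A m - (L * (1 - (real m + 1) / 2 ^ m) + s m (idx m x) / 2 / 2 ^ m)\<bar> \<le> 8 * r / 2 ^ m" for m
  proof -
    define j where "j = idx m x"
    have j: "j < 2 ^ m" using idx_props(1)[OF x] by (simp add: j_def)
    let ?I = "{..<2 ^ m} - {j}" and ?d = "\<lambda>i. dist (z m j) (z m i)"
    let ?B = "\<lambda>i. \<integral>w. indicator {y \<in> K. idx m y = i} w * ker x w \<partial>M"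
    have "(\<integral>w. ker x w \<partial>M) = ?B j + (\<Sum>i\<in>?I. ?B i)"
      using D.integral_blocks[OF int, of m] j by (simp add: sum.remove)
    moreover have "D.P m (ker x) x = ?B j" by (simp add: D.P_def D.cyl_def j_def)
    ultimately have A: "A m = (\<Sum>i\<in>?I. ?B i)" by (simp add: A_def)
    have B: "\<bar>?B i - (- ln (?d i)) / 2 ^ m\<bar> \<le> 4 * (r ^ m / ?d i) / 2 ^ m" if i: "i \<in> ?I" for i
    proof (rule block_integral_approx[OF int])
      show "i < 2 ^ m" using i by simp
      fix w assume w: "w \<in> K" "idx m w = i"
      have far: "500 * r ^ m \<le> ?d i" using z_far[of i m j] i j by auto
      have dpos: "?d i > 0" using far zero_less_power[OF r_pos, of m] by linarith
      have "\<bar>dist x w - ?d i\<bar> \<le> 2 * r ^ m"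
        using dist_z_idx[OF x, of m] dist_z_idx[OF w(1), of m] w(2)
          dist_triangle[of x w "z m j"] dist_triangle[of "z m j" w "z m i"]
          dist_triangle[of "z m j" "z m i" x] dist_triangle[of x "z m i" w]
        by (simp add: j_def dist_commute abs_le_iff) 
      then have diff: "\<bar>dist x w - ?d i\<bar> \<le> 2 * r ^ m" .
      have "\<bar>ln (dist x w) - ln (?d i)\<bar> \<le> 2 * \<bar>dist x w - ?d i\<bar> / ?d i"
        using diff far zero_less_power[OF r_pos, of m] by (intro abs_ln_diff_le[OF dpos]) linarith
      also have "\<dots> \<le> 2 * (2 * r ^ m) / ?d i" using diff dpos by (intro divide_right_mono) auto
      finally show "\<bar>- ln (?d i) - ker x w\<bar> \<le> 4 * (r ^ m / ?d i)" by (simp add: ker_def abs_minus_commute)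
    qed
    have "\<bar>A m - (\<Sum>i\<in>?I. (- ln (?d i)) / 2 ^ m)\<bar> \<le> (\<Sum>i\<in>?I. 4 * (r ^ m / ?d i) / 2 ^ m)"
      unfolding A sum_subtractf[symmetric] by (rule order_trans[OF sum_abs sum_mono]) (rule B)
    also have "\<dots> = 4 / 2 ^ m * (\<Sum>i\<in>?I. r ^ m / ?d i)" by (simp add: sum_distrib_left mult.commute)
    also have "\<dots> \<le> 4 / 2 ^ m * (2 * r)" using z_sum[OF j] by (intro mult_left_mono) auto
    also have "\<dots> = 8 * r / 2 ^ m" by simp
    also have "(\<Sum>i\<in>?I. (- ln (?d i)) / 2 ^ m) = (- (\<Sum>i\<in>?I. ln (?d i))) / 2 ^ m"
      by (simp add: sum_divide_distrib sum_negf)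
    also have "- (\<Sum>i\<in>?I. ln (?d i)) = s m j / 2 + L * (2 ^ m - real m - 1)"
      unfolding s_def by (simp add: field_simps)
    also have "\<dots> / 2 ^ m = L * (1 - (real m + 1) / 2 ^ m) + s m j / 2 / 2 ^ m"
      by (simp add: field_simps)
    finally show ?thesis by (simp add: j_def)
  qed
  have half: "(\<lambda>m. 1 / 2 ^ m :: real) \<longlonglongrightarrow> 0"
    using LIMSEQ_power_zero[of "1/2::real"] by (simp add: power_one_over)
  have A_lim: "A \<longlonglongrightarrow> L"
  proof -
    have lim1: "(\<lambda>m. L * (1 - (real m + 1) / 2 ^ m)) \<longlonglongrightarrow> L * (1 - 0)"
      by (intro tendsto_mult_left tendsto_diff tendsto_const) real_asymp
    have le: "norm (A m - L * (1 - (real m + 1) / 2 ^ m)) \<le> 17 * r * (1 / 2 ^ m)" for m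
    proof -
      have "\<bar>s m (idx m x) / 2 / 2 ^ m\<bar> \<le> 9 * r / 2 ^ m"
      proof -
        have "\<bar>s m (idx m x) / 2 / 2 ^ m\<bar> = \<bar>s m (idx m x)\<bar> / 2 / 2 ^ m" by simp
        also have "\<dots> \<le> 18 * r / 2 / 2 ^ m" using s_bound[OF idx_props(1)[OF x]] by (intro divide_right_mono) auto
        finally show ?thesis by simp
      qed
      then have "norm (A m - L * (1 - (real m + 1) / 2 ^ m)) \<le> 8 * r / 2 ^ m + 9 * r / 2 ^ m"
        using A_approx[of m] unfolding real_norm_def by linarith
      then show ?thesis by (simp add: add_divide_distrib[symmetric])
    qed
    have "(\<lambda>m. 17 * r * (1 / 2 ^ m)) \<longlonglongrightarrow> 17 * r * 0" by (intro tendsto_mult_left half)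
    then have "(\<lambda>m. 17 * r * (1 / 2 ^ m)) \<longlonglongrightarrow> 0" by simp
    then have "(\<lambda>m. A m - L * (1 - (real m + 1) / 2 ^ m)) \<longlonglongrightarrow> 0"
      by (rule Lim_null_comparison[OF always_eventually[OF allI[OF le]]])
    from tendsto_add[OF this lim1] show ?thesis by simp
  qed
  have "(\<lambda>m. D.P m (ker x) x) \<longlonglongrightarrow> (\<integral>w. 0 \<partial>M)"
    unfolding D.P_def
  proof (rule integral_dominated_convergence)
    show "integrable M (\<lambda>w. \<bar>ker x w\<bar>)" using int by simp
    show "(\<lambda>w. indicator (D.cyl m x) w * ker x w) \<in> borel_measurable M" for m
      using ker_measurable[of x] by measurable
    show "AE w in M. (\<lambda>m. indicator (D.cyl m x) w * ker x w) \<longlonglongrightarrow> 0"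
    proof (rule AE_mp[OF D.AE_neq[of x]], use x in simp, rule AE_I2, rule impI)
      fix w assume w: "w \<in> space M" "w \<noteq> x"
      obtain n where n: "w \<in> D.ring n x" using D.ring_ex[of x w] w x by auto
      have "eventually (\<lambda>m. indicator (D.cyl m x) w * ker x w = 0) sequentially"
        using D.ring_in_cyl[of x w n] x n
        by (intro eventually_sequentiallyI[of "Suc n"]) (auto simp: indicator_def)
      then show "(\<lambda>m. indicator (D.cyl m x) w * ker x w) \<longlonglongrightarrow> 0" by (rule tendsto_eventually)
    qed
    show "AE w in M. norm (indicator (D.cyl m x) w * ker x w) \<le> \<bar>ker x w\<bar>" for m
      by (intro AE_I2) (auto simp: indicator_def)
  qed simp
  then have "A \<longlonglongrightarrow> (\<integral>w. ker x w \<partial>M) - 0"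
    unfolding A_def by (intro tendsto_diff tendsto_const) simp
  from LIMSEQ_unique[OF this A_lim] show ?thesis by simp
qed

sublocale D: balanced_kernel M idx ker L r
  by unfold_locales (use ker_const in simp)

section \<open>Potentials off the Cantor set\<close>

definition pot :: "(real^2 \<Rightarrow> real) \<Rightarrow> real^2 \<Rightarrow> real" where
  "pot \<phi> y = (\<integral>w. ker y w * \<phi> w \<partial>M)"

lemma pot_on_K: "pot \<phi> x = D.T \<phi> x"
  by (simp add: pot_def D.T_def)

text \<open>An integral of conjugable functions is a limit of finite sums over the cylinders.\<close>

lemma conjugable_on_integral:
  fixes q :: "real^2 \<Rightarrow> real^2 \<Rightarrow> real"
  assumes S: "open S" and q: "\<And>w. w \<in> K \<Longrightarrow> conjugable_on S (\<lambda>y. q y w)"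
    and meas: "\<And>y. y \<in> S \<Longrightarrow> q y \<in> borel_measurable M"
    and unif: "\<And>C. compact C \<Longrightarrow> C \<subseteq> S \<Longrightarrow>
      \<exists>c. \<forall>y\<in>C. \<forall>n. \<forall>w\<in>K. \<forall>w'\<in>K. idx n w = idx n w' \<longrightarrow> \<bar>q y w - q y w'\<bar> \<le> c * r ^ n"
    and phi [measurable]: "\<phi> \<in> borel_measurable M" and B: "\<And>w. w \<in> K \<Longrightarrow> \<bar>\<phi> w\<bar> \<le> B"
  shows "conjugable_on S (\<lambda>y. \<integral>w. q y w * \<phi> w \<partial>M)"
proof -
  define p where "p n j = (SOME w. w \<in> K \<and> idx n w = j)" for n j
  have p: "p n j \<in> K" "idx n (p n j) = j" if "j < 2 ^ n" for n j
  proof -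
    have "\<exists>w. w \<in> K \<and> idx n w = j" using D.block_ex[OF that] by auto
    then have "p n j \<in> K \<and> idx n (p n j) = j" unfolding p_def by (rule someI_ex)
    then show "p n j \<in> K" "idx n (p n j) = j" by auto
  qed
  let ?F = "\<lambda>n j. {y \<in> K. idx n y = j}"
  have Fs: "?F n j \<in> sets M" for n j by (rule idx_cylinder_sets)
  have phi_int: "integrable M \<phi>" by (rule D.bounded_integrable[OF phi, of B]) (use B in simp)
  define u where "u n y = (\<Sum>j<2 ^ n. (\<integral>w. indicator (?F n j) w * \<phi> w \<partial>M) * q y (p n j))" for n y
  have B0: "B \<ge> 0" using B[OF p(1)[of 0 0]] by simp
  show ?thesis
  proof (rule conjugable_on_uniform_limit)
    show "conjugable_on S (u n)" for n
      unfolding u_def by (intro conjugable_on_sum S conjugable_on_cmult q) (use p in auto)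
    fix C assume C: "compact C" "C \<subseteq> S"
    obtain c where c: "\<And>y n w w'. y \<in> C \<Longrightarrow> w \<in> K \<Longrightarrow> w' \<in> K \<Longrightarrow> idx n w = idx n w' \<Longrightarrow>
        \<bar>q y w - q y w'\<bar> \<le> c * r ^ n"
      using unif[OF C] by metis
    have diff: "\<bar>u n y - (\<integral>w. q y w * \<phi> w \<partial>M)\<bar> \<le> c * r ^ n * B" if y: "y \<in> C" for n y
    proof -
      note [measurable] = meas[OF subsetD[OF C(2) y]]
      have q_bd: "\<bar>q y w\<bar> \<le> \<bar>q y (p 0 0)\<bar> + c" if "w \<in> K" for w
        using c[OF y that p(1)[of 0 0], of 0] idx_props(1)[OF that, of 0] p(2)[of 0 0] by simp
      have i1: "integrable M (\<lambda>w. q y w * \<phi> w)"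
        by (rule D.times_bounded_integrable[OF D.bounded_integrable[of _ "\<bar>q y (p 0 0)\<bar> + c"]])
           (use q_bd B in auto)
      have i2: "integrable M (\<lambda>w. indicator (?F n j) w * \<phi> w)" for j
        using integrable_mult_indicator[OF Fs phi_int] by simp
      have "u n y = (\<Sum>j<2 ^ n. \<integral>w. (indicator (?F n j) w * \<phi> w) * q y (p n j) \<partial>M)"
        unfolding u_def by simp
      also have "\<dots> = (\<integral>w. (\<Sum>j<2 ^ n. (indicator (?F n j) w * \<phi> w) * q y (p n j)) \<partial>M)"
        using i2 by (intro Bochner_Integration.integral_sum[symmetric]) auto
      finally have u: "u n y = \<dots>" .
      have i3: "integrable M (\<lambda>w. \<Sum>j<2 ^ n. (indicator (?F n j) w * \<phi> w) * q y (p n j))"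
        using i2 by (intro Bochner_Integration.integrable_sum) auto
      have "u n y - (\<integral>w. q y w * \<phi> w \<partial>M) =
          (\<integral>w. (\<Sum>j<2 ^ n. (indicator (?F n j) w * \<phi> w) * q y (p n j)) - q y w * \<phi> w \<partial>M)"
        unfolding u using i1 i3 by simp
      also have "\<bar>\<dots>\<bar> \<le> (\<integral>w. c * r ^ n * B \<partial>M)"
      proof (rule order_trans[OF integral_abs_bound integral_mono])
        show "integrable M (\<lambda>w. \<bar>(\<Sum>j<2 ^ n. (indicator (?F n j) w * \<phi> w) * q y (p n j)) - q y w * \<phi> w\<bar>)"
          using i1 i3 by (intro integrable_abs Bochner_Integration.integrable_diff)
        fix w assume "w \<in> space M"
        then have w: "w \<in> K" by simp
        have iw: "idx n w < 2 ^ n" using idx_props(1)[OF w] .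
        have "(\<Sum>j<2 ^ n. (indicator (?F n j) w * \<phi> w) * q y (p n j)) =
            (\<Sum>j<2 ^ n. if j = idx n w then \<phi> w * q y (p n j) else 0)"
          using w by (intro sum.cong) (auto simp: indicator_def)
        also have "\<dots> = \<phi> w * q y (p n (idx n w))" using iw by simp
        finally have "\<bar>(\<Sum>j<2 ^ n. (indicator (?F n j) w * \<phi> w) * q y (p n j)) - q y w * \<phi> w\<bar> =
            \<bar>q y (p n (idx n w)) - q y w\<bar> * \<bar>\<phi> w\<bar>"
          by (simp add: abs_mult[symmetric] algebra_simps)
        also have "\<dots> \<le> c * r ^ n * B"
          using c[OF y p(1)[OF iw] w p(2)[OF iw]] B[OF w] by (intro mult_mono) auto
        finally show "\<bar>(\<Sum>j<2 ^ n. (indicator (?F n j) w * \<phi> w) * q y (p n j)) - q y w * \<phi> w\<bar> \<le> c * r ^ n * B" .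
      qed simp
      finally show ?thesis using M.prob_space by simp
    qed
    have "(\<lambda>n. c * r ^ n * B) \<longlonglongrightarrow> c * 0 * B" by (intro tendsto_intros r_pow_tendsto_0)
    then have "(\<lambda>n. c * r ^ n * B) \<longlonglongrightarrow> 0" by simp
    show "uniform_limit C u (\<lambda>y. \<integral>w. q y w * \<phi> w \<partial>M) sequentially"
    proof (rule uniform_limitI)
      fix e :: real assume "e > 0"
      with \<open>(\<lambda>n. c * r ^ n * B) \<longlonglongrightarrow> 0\<close> have "\<forall>\<^sub>F n in sequentially. c * r ^ n * B < e"
        by (rule order_tendstoD(2))
      then show "\<forall>\<^sub>F n in sequentially. \<forall>y\<in>C. dist (u n y) (\<integral>w. q y w * \<phi> w \<partial>M) < e"
      proof eventually_elim
        case (elim n)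
        show ?case
        proof
          fix y assume "y \<in> C"
          from diff[OF this, of n] elim show "dist (u n y) (\<integral>w. q y w * \<phi> w \<partial>M) < e"
            unfolding dist_real_def by linarith
        qed
      qed
    qed
  qed
qed

lemma open_compl_K: "open (- K)"
  using closed_K by (simp add: open_Compl)

lemma K_nonempty: "K \<noteq> {}"
  using X_in_K[of 0] by auto

lemma conjugable_on_pot:
  assumes phi: "\<phi> \<in> borel_measurable M" and B: "\<And>w. w \<in> K \<Longrightarrow> \<bar>\<phi> w\<bar> \<le> B"
  shows "conjugable_on (- K) (pot \<phi>)"
  unfolding pot_def
proof (rule conjugable_on_integral[OF open_compl_K _ ker_measurable _ phi B])
  fix w assume w: "w \<in> K"
  have "conjugable_on (- K) (\<lambda>y. (- 1) * ln (norm (1 *\<^sub>R y + (- w))))"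
    by (intro conjugable_on_cmult conjugable_on_ln_norm_affine open_compl_K) (use w in auto)
  then show "conjugable_on (- K) (\<lambda>y. ker y w)" by (simp add: ker_def dist_norm)
next
  fix C assume C: "compact C" "C \<subseteq> - K"
  have "C \<inter> K = {}" using C(2) by auto
  then obtain \<eta> where \<eta>: "\<eta> > 0" "\<And>y w. y \<in> C \<Longrightarrow> w \<in> K \<Longrightarrow> \<eta> \<le> dist y w"
    using separate_compact_closed[OF C(1) closed_K] by metis
  have bound: "\<bar>ker y w - ker y w'\<bar> \<le> (2 / \<eta>) * r ^ n"
    if y: "y \<in> C" and w: "w \<in> K" "w' \<in> K" "idx n w = idx n w'" for y n w w'
  proof -
    have "\<bar>ln (dist y w) - ln (dist y w')\<bar> \<le> \<bar>dist y w - dist y w'\<bar> / \<eta>"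
      by (rule abs_ln_diff_le_lipschitz[OF \<eta>(1) \<eta>(2)[OF y w(1)] \<eta>(2)[OF y w(2)]])
    also have "\<dots> \<le> (2 * r ^ n) / \<eta>"
    proof (rule divide_right_mono)
      have "\<bar>dist y w - dist y w'\<bar> \<le> dist w w'"
        using dist_triangle[of y w w'] dist_triangle[of y w' w] by (simp add: dist_commute abs_le_iff)
      then show "\<bar>dist y w - dist y w'\<bar> \<le> 2 * r ^ n" using same_cell_dist[OF w] by simp
    qed (use \<eta> in simp)
    finally have "\<bar>ln (dist y w) - ln (dist y w')\<bar> \<le> (2 / \<eta>) * r ^ n" by simp
    then show ?thesis unfolding ker_def by linarith
  qed
  show "\<exists>c. \<forall>y\<in>C. \<forall>n. \<forall>w\<in>K. \<forall>w'\<in>K. idx n w = idx n w' \<longrightarrow> \<bar>ker y w - ker y w'\<bar> \<le> c * r ^ n"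
  proof (intro exI ballI allI impI)
    fix y n w w' assume "y \<in> C" "w \<in> K" "w' \<in> K" "idx n w = idx n w'"
    then show "\<bar>ker y w - ker y w'\<bar> \<le> (2 / \<eta>) * r ^ n" by (rule bound)
  qed
qed


section \<open>Comparison of the potentials with powers of the distance\<close>

text \<open>Here \<open>y0\<close> is the point of the set closest to \<open>y\<close>, and \<open>n\<close> is the level whose scale is the distance of
  \<open>y\<close> from the set.\<close>

definition nearest :: "nat \<Rightarrow> real^2 \<Rightarrow> real^2 \<Rightarrow> bool" where
  "nearest n y y0 \<longleftrightarrow> y0 \<in> K \<and> (\<forall>w\<in>K. dist y y0 \<le> dist y w) \<and> r ^ Suc n < dist y y0 \<and> dist y y0 \<le> r ^ n"

definition log_ratio :: "real^2 \<Rightarrow> real^2 \<Rightarrow> real^2 \<Rightarrow> real" where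
  "log_ratio y y0 w = ln (dist y w) - ln (dist y0 w)"

lemma scale_ex:
  assumes "0 < d" "d \<le> 1"
  obtains n where "r ^ Suc n < d" "d \<le> r ^ n"
proof -
  define n where "n = (LEAST n. r ^ Suc n < d)"
  obtain i where "r ^ i < d" using real_arch_pow_inv[OF assms(1), of r] r_small by auto
  then have "r ^ Suc i < d" using r_pow_Suc_le[of i] zero_less_power[OF r_pos, of i] by linarith
  then have n: "r ^ Suc n < d" unfolding n_def by (rule LeastI)
  have "d \<le> r ^ n"
  proof (cases n)
    case (Suc k)
    then have "\<not> r ^ Suc k < d" using not_less_Least[of k "\<lambda>n. r ^ Suc n < d"] n_def by simp
    then show ?thesis using Suc by simp
  qed (use assms in simp)
  then show ?thesis using that n by blast
qed

lemma nearest_point: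
  obtains y0 where "y0 \<in> K" "\<And>w. w \<in> K \<Longrightarrow> dist y y0 \<le> dist y w" "infdist y K = dist y y0"
proof -
  obtain y0 where y0: "y0 \<in> K" "\<And>w. w \<in> K \<Longrightarrow> dist y y0 \<le> dist y w"
    using distance_attains_inf[OF closed_K K_nonempty, of y] by metis
  moreover have "infdist y K = dist y y0"
    unfolding infdist_def using K_nonempty y0
    by (auto intro!: antisym cINF_lower cINF_greatest bdd_belowI2[of _ 0])
  ultimately show ?thesis using that by blast
qed

lemma infdist_pos: "y \<notin> K \<Longrightarrow> 0 < infdist y K"
  using closed_K K_nonempty by (simp add: infdist_pos_not_in_closed)

lemma nearest_ex:
  assumes y: "y \<notin> K" and le: "infdist y K \<le> 1"
  obtains n y0 where "nearest n y y0" "infdist y K = dist y y0"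
proof -
  obtain y0 where y0: "y0 \<in> K" "\<And>w. w \<in> K \<Longrightarrow> dist y y0 \<le> dist y w" "infdist y K = dist y y0"
    using nearest_point[of y] by blast
  obtain n where "r ^ Suc n < dist y y0" "dist y y0 \<le> r ^ n"
    using scale_ex[of "dist y y0"] infdist_pos[OF y] le y0(3) by auto
  then show ?thesis using that y0 unfolding nearest_def by blast
qed

lemma log_ratio_far:
  assumes y: "nearest n y y0" and w: "w \<in> D.ring m y0" and m: "m < n"
  shows "\<bar>log_ratio y y0 w\<bar> \<le> (5/2) * r ^ (n - m)"
  using ln_dist_perturb[OF _ w m, of 1 y] y by (simp add: nearest_def log_ratio_def dist_commute)

text \<open>The lower bound does not depend on \<open>L\<close>: as \<open>y0\<close> is closest to \<open>y\<close>, the point \<open>w\<close> is at most twice as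
  far from \<open>y0\<close> as from \<open>y\<close>.\<close>

lemma log_ratio_close:
  assumes y: "nearest n y y0" and w: "w \<in> D.ring m y0" and m: "n \<le> m"
  shows "\<bar>log_ratio y y0 w\<bar> \<le> L * (real m - real n) + 2" "log_ratio y y0 w \<ge> - 1"
proof -
  have y0: "y0 \<in> K" and wK: "w \<in> K" using y w by (auto simp: nearest_def D.ring_def D.cyl_def)
  note d = ring_dist[OF y0 w]
  have pos: "dist y0 w > 0" using d zero_less_power[OF r_pos, of m] by linarith
  have ge: "dist y w \<ge> dist y0 w / 2"
    using y wK dist_triangle[of y0 w y] by (fastforce simp: nearest_def dist_commute)
  then have "ln (dist y w) \<ge> ln (dist y0 w / 2)" using pos by (subst ln_le_cancel_iff) auto
  then have "log_ratio y y0 w \<ge> - ln 2" using pos by (simp add: log_ratio_def ln_div)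
  moreover have "ln 2 \<le> (1::real)" using ln_le_minus_one[of "2::real"] by simp
  ultimately show lower: "log_ratio y y0 w \<ge> - 1" by linarith
  have "r ^ m \<le> r ^ n" using m r_small by (intro power_decreasing) auto
  then have "dist y w \<le> (204/100) * r ^ n"
    using dist_triangle[of y w y0] y d by (simp add: nearest_def)
  then have "ln (dist y w) \<le> ln ((204/100) * r ^ n)"
    using pos ge zero_less_power[OF r_pos, of n] by (subst ln_le_cancel_iff) linarith+
  also have "\<dots> = ln (204/100) - L * n" by (subst ln_mult) (auto simp: ln_r_pow)
  also have "ln (204/100::real) \<le> 104/100" using ln_le_minus_one[of "204/100::real"] by simp
  finally have u: "ln (dist y w) \<le> 104/100 - L * n" by simp
  have "ln ((96/100) * r ^ m) \<le> ln (dist y0 w)"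
    using d pos zero_less_power[OF r_pos, of m] by (subst ln_le_cancel_iff) linarith+
  moreover have "ln ((96/100) * r ^ m) = ln (96/100) - L * m" by (subst ln_mult) (auto simp: ln_r_pow)
  moreover have "ln (96/100::real) \<ge> - (96/100)"
  proof -
    have "- ln (96/100::real) = ln (100/96)" using ln_inverse[of "96/100::real"] by simp
    also have "\<dots> \<le> 96/100" using ln_le_minus_one[of "100/96::real"] by simp
    finally show ?thesis by simp
  qed
  ultimately have "log_ratio y y0 w \<le> L * (real m - real n) + 2"
    using u unfolding log_ratio_def right_diff_distrib by linarith
  moreover have "L * (real m - real n) \<ge> 0" using L m by (intro mult_nonneg_nonneg) auto
  ultimately show "\<bar>log_ratio y y0 w\<bar> \<le> L * (real m - real n) + 2" using lower by linarith
qed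

lemma r_power_le: "r ^ i \<le> (3/16) ^ i" "r ^ i \<le> (3/8) ^ i"
  using r_small by (auto intro!: power_mono)

lemma half_powers: 
  assumes "m \<le> n" shows "(2::real) ^ m / 2 ^ n = (1/2) ^ (n - m)"
  using assms by (simp add: power_diff power_one_over field_simps)

lemma log_ratio_tent:
  assumes y: "nearest n y y0" and w: "w \<in> D.ring m y0"
  shows "\<bar>log_ratio y y0 w\<bar> \<le> (L + 4) / 2 ^ n * 2 ^ m * (3/4) ^ ((n - m) + (m - n))"
proof (cases "m < n")
  case True
  have "\<bar>log_ratio y y0 w\<bar> \<le> (5/2) * r ^ (n - m)" by (rule log_ratio_far[OF y w True])
  also have "\<dots> \<le> (L + 4) * (3/8) ^ (n - m)"
    using L r_power_le by (intro mult_mono) auto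
  also have "(3/8::real) ^ (n - m) = 2 ^ m / 2 ^ n * (3/4) ^ (n - m)"
    using half_powers[of m n] True by (simp add: power_mult_distrib[symmetric])
  finally show ?thesis using True by simp
next
  case False
  define d where "d = m - n"
  have m: "m = n + d" using False by (simp add: d_def)
  have "\<bar>log_ratio y y0 w\<bar> \<le> L * d + 2"
    using log_ratio_close(1)[OF y w] by (simp add: m)
  also have "\<dots> \<le> L * (3/2) ^ d + 4 * (3/2) ^ d"
  proof (intro add_mono mult_left_mono le_three_halves_power)
    have "(1::real) \<le> (3/2) ^ d" by simp
    then show "2 \<le> 4 * (3/2::real) ^ d" by linarith
  qed (use L in simp)
  also have "\<dots> = (L + 4) * (2 ^ d * (3/4) ^ d)" by (simp add: power_mult_distrib[symmetric] algebra_simps)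
  finally show ?thesis by (simp add: m power_add)
qed

lemma log_ratio_measurable: "log_ratio y y0 \<in> borel_measurable M"
  unfolding log_ratio_def using ln_dist_measurable by measurable

lemma log_ratio_integral:
  assumes y: "nearest n y y0" and phi [measurable]: "\<phi> \<in> borel_measurable M"
    and B: "\<And>w. w \<in> K \<Longrightarrow> \<bar>\<phi> w\<bar> \<le> B"
  shows "integrable M (\<lambda>w. log_ratio y y0 w * \<phi> w)"
    "\<bar>\<integral>w. log_ratio y y0 w * \<phi> w \<partial>M\<bar> \<le> 4 * ((L + 4) * B / 2 ^ n)"
proof -
  have y0: "y0 \<in> space M" using y by (simp add: nearest_def)
  have B0: "B \<ge> 0" using B[of y0] y0 by simp
  have tent: "\<bar>log_ratio y y0 w * \<phi> w\<bar> \<le> (L + 4) * B / 2 ^ n * 2 ^ m * (3/4) ^ ((n - m) + (m - n))"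
    if w: "w \<in> D.ring m y0" for m w
  proof -
    have "w \<in> K" using w by (auto simp: D.ring_def D.cyl_def)
    then have "\<bar>log_ratio y y0 w * \<phi> w\<bar> \<le> ((L + 4) / 2 ^ n * 2 ^ m * (3/4) ^ ((n - m) + (m - n))) * B"
      unfolding abs_mult using log_ratio_tent[OF y w] B L by (intro mult_mono) auto
    then show ?thesis by (simp add: mult_ac)
  qed
  have m: "(\<lambda>w. log_ratio y y0 w * \<phi> w) \<in> borel_measurable M"
    using log_ratio_measurable[of y y0] by measurable
  have D: "0 \<le> (L + 4) * B / 2 ^ n" using B0 L by simp
  show "integrable M (\<lambda>w. log_ratio y y0 w * \<phi> w)" by (rule D.ring_integral_tent(1)[OF y0 m D tent])
  show "\<bar>\<integral>w. log_ratio y y0 w * \<phi> w \<partial>M\<bar> \<le> 4 * ((L + 4) * B / 2 ^ n)"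
    by (rule D.ring_integral_tent(2)[OF y0 m D tent])
qed

lemma ker_integrable: "integrable M (ker y)"
proof (cases "y \<in> K")
  case True
  then show ?thesis using D.k_integrable by simp
next
  case False
  define \<eta> where "\<eta> = infdist y K"
  have \<eta>: "\<eta> > 0" "\<And>w. w \<in> K \<Longrightarrow> \<eta> \<le> dist y w"
    using infdist_pos[OF False] by (auto simp: \<eta>_def infdist_le)
  obtain w0 where w0: "w0 \<in> K" using K_nonempty by blast
  have "\<bar>ker y w\<bar> \<le> \<bar>ker y w0\<bar> + 2 / \<eta>" if w: "w \<in> K" for w
  proof -
    have "\<bar>ln (dist y w) - ln (dist y w0)\<bar> \<le> \<bar>dist y w - dist y w0\<bar> / \<eta>"
      by (rule abs_ln_diff_le_lipschitz) (use \<eta> w w0 in auto)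
    also have "\<dots> \<le> 2 / \<eta>"
    proof (rule divide_right_mono)
      have "dist w w0 \<le> 2" using same_cell_dist[OF w w0, of 0] idx_props(1)[OF w, of 0] idx_props(1)[OF w0, of 0] by simp
      then show "\<bar>dist y w - dist y w0\<bar> \<le> 2"
        using dist_triangle[of y w w0] dist_triangle[of y w0 w] by (simp add: dist_commute abs_le_iff)
    qed (use \<eta> in simp)
    finally show ?thesis unfolding ker_def by linarith
  qed
  then show ?thesis by (intro D.bounded_integrable[OF ker_measurable]) auto
qed

lemma ker_phi_integrable:
  assumes "\<phi> \<in> borel_measurable M" "\<And>w. w \<in> K \<Longrightarrow> \<bar>\<phi> w\<bar> \<le> B"
  shows "integrable M (\<lambda>w. ker y w * \<phi> w)"
  by (rule D.times_bounded_integrable[OF ker_integrable assms(1), of B]) (use assms(2) in simp)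

lemma pot_diff:
  assumes "\<phi> \<in> borel_measurable M" "\<And>w. w \<in> K \<Longrightarrow> \<bar>\<phi> w\<bar> \<le> B"
  shows "pot \<phi> y0 - pot \<phi> y = (\<integral>w. log_ratio y y0 w * \<phi> w \<partial>M)"
proof -
  have "pot \<phi> y0 - pot \<phi> y = (\<integral>w. ker y0 w * \<phi> w - ker y w * \<phi> w \<partial>M)"
    unfolding pot_def using ker_phi_integrable[OF assms] by simp
  also have "\<dots> = (\<integral>w. log_ratio y y0 w * \<phi> w \<partial>M)"
    by (intro Bochner_Integration.integral_cong) (auto simp: ker_def log_ratio_def algebra_simps)
  finally show ?thesis .
qed

lemma pot_near:
  assumes y: "nearest n y y0" and phi: "\<phi> \<in> borel_measurable M" "\<And>w. w \<in> K \<Longrightarrow> \<bar>\<phi> w\<bar> \<le> B"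
  shows "\<bar>pot \<phi> y0 - pot \<phi> y\<bar> \<le> 4 * ((L + 4) * B / 2 ^ n)"
  using log_ratio_integral(2)[OF y phi] pot_diff[OF phi, of y0 y] by simp

text \<open>Because the potential of the natural measure is constant on the set, \<open>green\<close> is the Green
  function with pole at infinity, normalised to grow like \<open>ln (norm y)\<close>.\<close>

definition green :: "real^2 \<Rightarrow> real" where
  "green y = L - pot (\<lambda>_. 1) y"

lemma green_on_K: "x \<in> K \<Longrightarrow> green x = 0"
  by (simp add: green_def pot_def ker_const)

lemma green_eq_log_ratio:
  assumes "nearest n y y0"
  shows "green y = (\<integral>w. log_ratio y y0 w \<partial>M)"
proof -
  have "green y = pot (\<lambda>_. 1) y0 - pot (\<lambda>_. 1) y"
    using green_on_K[of y0] assms by (simp add: green_def nearest_def)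
  then show ?thesis by (subst (asm) pot_diff[of _ 1]) auto
qed

lemma green_upper:
  assumes y: "nearest n y y0"
  shows "green y \<le> 4 * (L + 4) / 2 ^ n"
  using log_ratio_integral(2)[OF y, of "\<lambda>_. 1" 1] by (simp add: green_eq_log_ratio[OF y] abs_le_iff)

text \<open>The cylinder of level \<open>n + 2\<close> around \<open>y0\<close> contributes about \<open>L / 2 ^ (n + 2)\<close>; the points
  outside contribute at least \<open>- 4 / 2 ^ n\<close>, with a constant that does not depend on \<open>L\<close>.\<close>

lemma green_lower:
  assumes y: "nearest n y y0"
  shows "20 / 2 ^ n \<le> green y"
proof -
  have y0: "y0 \<in> K" using y by (simp add: nearest_def)
  let ?A = "D.cyl (Suc (Suc n)) y0" and ?h = "log_ratio y y0"
  note [measurable] = log_ratio_measurable[of y y0]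
  define e where "e w = indicator (- ?A) w * min (?h w) 0" for w
  have e_meas: "e \<in> borel_measurable M"
  proof -
    have "e = (\<lambda>w. if w \<in> ?A then 0 else min (?h w) 0)" by (auto simp: e_def fun_eq_iff indicator_def)
    moreover have "(\<lambda>w. if w \<in> ?A then 0 else min (?h w) 0) \<in> borel_measurable M"
    proof (rule measurable_If_set)
      show "?A \<inter> space M \<in> sets M" by (intro sets.Int D.cyl_sets sets.top)
    qed auto
    ultimately show ?thesis by simp
  qed
  have e_tent: "\<bar>e w\<bar> \<le> 1 / 2 ^ n * 2 ^ m * (3/4) ^ ((n - m) + (m - n))" if w: "w \<in> D.ring m y0" for m w
  proof -
    consider "m < n" | "n \<le> m" "m \<le> Suc n" | "m \<ge> Suc (Suc n)" by linarith
    then show ?thesis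
    proof cases
      case 1
      have "\<bar>e w\<bar> \<le> \<bar>?h w\<bar>" by (auto simp: e_def indicator_def)
      also have "\<dots> \<le> (5/2) * r ^ (n - m)" by (rule log_ratio_far[OF y w 1])
      also have "\<dots> \<le> (3/8) ^ (n - m)"
      proof -
        define d where "d = n - m - 1"
        have d: "n - m = Suc d" using 1 by (simp add: d_def)
        have "(5/2) * r \<le> 3/8" using r_small by simp
        then have "((5/2) * r) * r ^ d \<le> (3/8) * (3/8) ^ d" using r_power_le(2)[of d] by (intro mult_mono) auto
        then show ?thesis by (simp add: d mult.assoc)
      qed
      also have "\<dots> = 1 / 2 ^ n * 2 ^ m * (3/4) ^ ((n - m) + (m - n))"
        using half_powers[of m n] 1 by (simp add: power_mult_distrib[symmetric])
      finally show ?thesis .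
    next
      case 2
      have "\<bar>e w\<bar> \<le> 1" using log_ratio_close(2)[OF y w 2(1)] by (auto simp: e_def indicator_def)
      moreover have "m = n \<or> m = Suc n" using 2 by linarith
      ultimately show ?thesis by auto
    next
      case 3
      then have "w \<in> ?A" using D.ring_in_cyl[of y0 w m "Suc (Suc n)"] y0 w by simp
      then show ?thesis by (simp add: e_def)
    qed
  qed
  have e_int: "integrable M e" and e_le: "\<bar>\<integral>w. e w \<partial>M\<bar> \<le> 4 * (1 / 2 ^ n)"
    using D.ring_integral_tent[OF _ e_meas _ e_tent] y0 by auto
  have A_int: "integrable M (\<lambda>w. (L - 1) * indicator ?A w)"
    using D.indicator_integrable[of "\<lambda>_. L - 1" "Suc (Suc n)" y0] by (simp add: mult.commute)
  have "(\<integral>w. (L - 1) * indicator ?A w + e w \<partial>M) \<le> (\<integral>w. ?h w \<partial>M)"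
  proof (rule integral_mono_AE)
    show "integrable M (\<lambda>w. (L - 1) * indicator ?A w + e w)"
      using A_int e_int by (rule Bochner_Integration.integrable_add)
    show "integrable M ?h" using log_ratio_integral(1)[OF y, of "\<lambda>_. 1" 1] by simp
    show "AE w in M. (L - 1) * indicator ?A w + e w \<le> ?h w"
    proof (rule AE_mp[OF D.AE_neq[of y0]], use y0 in simp, rule AE_I2, rule impI)
      fix w assume w: "w \<in> space M" "w \<noteq> y0"
      show "(L - 1) * indicator ?A w + e w \<le> ?h w"
      proof (cases "w \<in> ?A")
        case True
        then have "dist y0 w \<le> 2 * r ^ Suc (Suc n)" using cyl_dist[OF y0] by blast
        then have "ln (dist y0 w) \<le> ln (2 * r ^ Suc (Suc n))" using w by (subst ln_le_cancel_iff) auto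
        also have "\<dots> = ln 2 - L * (n + 2)" by (subst ln_mult) (auto simp: ln_r_pow simp del: power_Suc)
        finally have 1: "ln (dist y0 w) \<le> ln 2 - L * (n + 2)" .
        have "r ^ Suc n \<le> dist y w" using y w by (auto simp: nearest_def intro: less_imp_le less_le_trans)
        then have "ln (r ^ Suc n) \<le> ln (dist y w)"
          using zero_less_power[OF r_pos, of "Suc n"] by (subst ln_le_cancel_iff) linarith+
        then have "- L * (n + 1) \<le> ln (dist y w)" by (simp add: ln_r_pow algebra_simps del: power_Suc)
        moreover have "ln 2 \<le> (1::real)" using ln_le_minus_one[of "2::real"] by simp
        ultimately have "L - 1 \<le> ?h w" using 1 unfolding log_ratio_def by (simp add: algebra_simps)
        then show ?thesis using True by (simp add: e_def)
      qed (simp add: e_def)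
    qed
  qed
  moreover have "(\<integral>w. (L - 1) * indicator ?A w + e w \<partial>M) = (L - 1) / 2 ^ Suc (Suc n) + (\<integral>w. e w \<partial>M)"
  proof -
    have "?A \<inter> K = ?A" using D.cyl_subset_space[of "Suc (Suc n)" y0] by auto
    then have "(\<integral>w. (L - 1) * indicator ?A w \<partial>M) = (L - 1) / 2 ^ Suc (Suc n)"
      using D.prob_cyl[of y0 "Suc (Suc n)"] y0 by simp
    then show ?thesis by (simp only: Bochner_Integration.integral_add[OF A_int e_int])
  qed
  moreover have "(L - 1) / 2 ^ Suc (Suc n) \<ge> 24 / 2 ^ n" using L by (simp add: field_simps)
  ultimately show ?thesis using e_le by (simp add: green_eq_log_ratio[OF y])
qed

text \<open>To leading order near \<open>y0\<close>, a potential with continuous density \<open>\<phi>\<close> behaves like \<open>\<phi> y0\<close>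
  times \<open>green\<close>.\<close>

lemma pot_leading_order:
  assumes y: "nearest n y y0" and phi: "D.osc C (1/2) \<phi>"
  shows "\<bar>(pot \<phi> y0 - pot \<phi> y) - \<phi> y0 * green y\<bar> \<le> 4 * ((L + 4) * C / 4 ^ n)"
proof -
  have y0: "y0 \<in> space M" using y by (simp add: nearest_def)
  have C0: "C \<ge> 0" by (rule D.osc_nonneg[OF phi])
  have [measurable]: "\<phi> \<in> borel_measurable M" by (rule D.osc_measurable[OF phi]) auto
  note [measurable] = log_ratio_measurable[of y y0]
  obtain B where B: "\<And>w. w \<in> space M \<Longrightarrow> \<bar>\<phi> w\<bar> \<le> B" using D.osc_bounded[OF phi] by blast
  have i1: "integrable M (\<lambda>w. log_ratio y y0 w * \<phi> w)"
    by (rule log_ratio_integral(1)[OF y _, of _ B]) (use B in auto)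
  have i2: "integrable M (\<lambda>w. log_ratio y y0 w)" using log_ratio_integral(1)[OF y, of "\<lambda>_. 1" 1] by simp
  have "(pot \<phi> y0 - pot \<phi> y) - \<phi> y0 * green y =
      (\<integral>w. log_ratio y y0 w * \<phi> w \<partial>M) - (\<integral>w. \<phi> y0 * log_ratio y y0 w \<partial>M)"
    using pot_diff[of \<phi> B y0 y] B by (simp add: green_eq_log_ratio[OF y])
  also have "\<dots> = (\<integral>w. log_ratio y y0 w * \<phi> w - \<phi> y0 * log_ratio y y0 w \<partial>M)"
    using i1 i2 by (intro Bochner_Integration.integral_diff[symmetric]) auto
  also have "\<dots> = (\<integral>w. log_ratio y y0 w * (\<phi> w - \<phi> y0) \<partial>M)"
    by (intro Bochner_Integration.integral_cong) (auto simp: algebra_simps)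
  finally have eq: "(pot \<phi> y0 - pot \<phi> y) - \<phi> y0 * green y = (\<integral>w. log_ratio y y0 w * (\<phi> w - \<phi> y0) \<partial>M)" .
  show ?thesis unfolding eq
  proof (rule D.ring_integral_tent(2)[OF y0])
    show "(\<lambda>w. log_ratio y y0 w * (\<phi> w - \<phi> y0)) \<in> borel_measurable M" by measurable
    show "0 \<le> (L + 4) * C / 4 ^ n" using C0 L by simp
    fix m w assume w: "w \<in> D.ring m y0"
    have p: "\<bar>\<phi> w - \<phi> y0\<bar> \<le> C * (1/2) ^ m"
      using D.oscD[OF phi y0, of w m] w by (simp add: D.ring_def abs_minus_commute)
    show "\<bar>log_ratio y y0 w * (\<phi> w - \<phi> y0)\<bar> \<le> (L + 4) * C / 4 ^ n * 2 ^ m * (3/4) ^ ((n - m) + (m - n))"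
    proof (cases "m < n")
      case True
      define d where "d = n - m"
      have n: "n = m + d" using True by (simp add: d_def)
      have "\<bar>log_ratio y y0 w * (\<phi> w - \<phi> y0)\<bar> \<le> ((5/2) * r ^ d) * (C * (1/2) ^ m)"
        unfolding abs_mult d_def using log_ratio_far[OF y w True] p by (intro mult_mono) auto
      also have "\<dots> \<le> ((L + 4) * (3/16) ^ d) * (C * (1/2) ^ m)"
        using L C0 r_power_le(1)[of d] by (intro mult_right_mono mult_mono) auto
      also have "\<dots> = (L + 4) * C / 4 ^ n * 2 ^ m * (3/4) ^ d"
      proof -
        have "(1/2::real) ^ m = 2 ^ m / 4 ^ m"
          using power_divide[of "2::real" 4 m] by simp
        moreover have "(3/16::real) ^ d = (3/4) ^ d / 4 ^ d"
          using power_divide[of "3/4::real" 4 d] by simp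
        ultimately show ?thesis by (simp add: n power_add mult_ac)
      qed
      finally show ?thesis using True by (simp add: d_def)
    next
      case False
      define d where "d = m - n"
      have m: "m = n + d" using False by (simp add: d_def)
      have "(1/2::real) ^ m \<le> (1/2) ^ n" using False by (intro power_decreasing) auto
      then have "C * (1/2) ^ m \<le> C * (1/2) ^ n" using C0 by (rule mult_left_mono)
      then have "\<bar>log_ratio y y0 w * (\<phi> w - \<phi> y0)\<bar> \<le>
          ((L + 4) / 2 ^ n * 2 ^ m * (3/4) ^ ((n - m) + (m - n))) * (C * (1/2) ^ n)"
        unfolding abs_mult using log_ratio_tent[OF y w] p L by (intro mult_mono) auto
      also have "\<dots> = (L + 4) * C / 4 ^ n * 2 ^ m * (3/4) ^ ((n - m) + (m - n))"
        using power_mult_distrib[of "2::real" 2 n] by (simp add: power_one_over)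
      finally show ?thesis .
    qed
  qed
qed

definition \<delta> :: real where "\<delta> = ln 2 / L"

lemma delta_pos: "\<delta> > 0" using L by (simp add: \<delta>_def)

lemma delta_le: "\<delta> \<le> 1"
proof -
  have "ln 2 \<le> (1::real)" using ln_le_minus_one[of "2::real"] by simp
  then show ?thesis using L by (simp add: \<delta>_def)
qed

lemma r_pow_powr: "(r ^ n) powr \<delta> = 1 / 2 ^ n"
proof -
  have "(r ^ n) powr \<delta> = exp (ln 2 / L * (- L * n))" by (simp add: powr_def \<delta>_def ln_r_pow)
  also have "ln 2 / L * (- L * n) = - (n * ln 2)" using L by simp
  also have "exp (- (n * ln 2)) = 1 / 2 ^ n" by (simp add: exp_minus exp_of_nat_mult field_simps)
  finally show ?thesis .
qed

lemma powr_scale: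
  assumes "r ^ Suc n < d" "d \<le> r ^ n"
  shows "d powr \<delta> \<le> 1 / 2 ^ n" "1 / 2 ^ Suc n \<le> d powr \<delta>"
proof -
  have "0 < d" using assms zero_less_power[OF r_pos, of "Suc n"] by linarith
  then show "d powr \<delta> \<le> 1 / 2 ^ n"
    using powr_mono2[of \<delta> d "r ^ n"] delta_pos assms by (simp add: r_pow_powr)
  show "1 / 2 ^ Suc n \<le> d powr \<delta>"
    using powr_mono2[of \<delta> "r ^ Suc n" d] delta_pos assms unfolding r_pow_powr by simp
qed

lemma green_dist:
  assumes "y \<notin> K" "infdist y K \<le> 1"
  shows "infdist y K powr \<delta> \<le> green y" "green y \<le> 8 * (L + 4) * infdist y K powr \<delta>"
proof -
  obtain n y0 where n: "nearest n y y0" "infdist y K = dist y y0" using nearest_ex[OF assms] .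
  have sc: "r ^ Suc n < dist y y0" "dist y y0 \<le> r ^ n" using n by (auto simp: nearest_def)
  note p = powr_scale[OF sc]
  have "1 / 2 ^ n \<le> 20 / (2::real) ^ n" by (intro divide_right_mono) auto
  then show "infdist y K powr \<delta> \<le> green y" using p(1) green_lower[OF n(1)] n(2) by simp
  have "green y \<le> 4 * (L + 4) * 2 * (1 / 2 ^ Suc n)" using green_upper[OF n(1)] by (simp add: field_simps)
  also have "\<dots> \<le> 4 * (L + 4) * 2 * (dist y y0 powr \<delta>)" using p(2) L by (intro mult_left_mono) auto
  finally show "green y \<le> 8 * (L + 4) * infdist y K powr \<delta>" using n(2) by simp
qed

text \<open>A potential that is regular along the set is continuous across it, since near the set it is
  close to its value at the nearest point.\<close>

lemma pot_continuous:
  assumes phi: "\<phi> \<in> borel_measurable M" and B: "\<And>w. w \<in> K \<Longrightarrow> \<bar>\<phi> w\<bar> \<le> B"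
    and T: "D.osc C (1/4) (D.T \<phi>)"
  shows "continuous_on UNIV (pot \<phi>)"
proof (rule continuous_at_imp_continuous_on, rule ballI)
  fix p :: "real^2"
  show "isCont (pot \<phi>) p"
  proof (cases "p \<in> K")
    case False
    then show ?thesis
      using conjugable_on_imp_continuous_on[OF conjugable_on_pot[OF phi B]] open_compl_K
      by (simp add: continuous_on_eq_continuous_at)
  next
    case p: True
    have B0: "B \<ge> 0" using B[OF p] by linarith
    have C0: "C \<ge> 0" by (rule D.osc_nonneg[OF T])
    define D0 where "D0 = C + 4 * (L + 4) * B"
    have bound: "\<bar>pot \<phi> y - pot \<phi> p\<bar> \<le> D0 / 2 ^ n" if y: "dist y p < r ^ Suc n / 4" for n y
    proof -
      obtain y0 where y0: "y0 \<in> K" "\<And>w. w \<in> K \<Longrightarrow> dist y y0 \<le> dist y w" "infdist y K = dist y y0"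
        using nearest_point[of y] by blast
      have yy0: "dist y y0 < r ^ Suc n / 4" using y0(2)[OF p] y by linarith
      then have d0: "dist y0 p < r ^ Suc n / 2"
        using y dist_triangle[of y0 p y] by (simp add: dist_commute)
      have "y0 \<in> D.cyl n p"
      proof (rule ccontr)
        assume nc: "y0 \<notin> D.cyl n p"
        have "y0 \<noteq> p" using nc D.cyl_self[of p n] p by auto
        then obtain m where m: "y0 \<in> D.ring m p" using D.ring_ex[of p y0] p y0 by auto
        then have "m < n" using nc D.ring_in_cyl[of p y0 m n] p by auto
        then have "r ^ n \<le> r ^ m" using r_small by (intro power_decreasing) auto
        moreover have "r ^ Suc n \<le> r ^ n / 1000" by (rule r_pow_Suc_le)
        ultimately show False
          using ring_dist(1)[OF p m] d0 zero_less_power[OF r_pos, of m] unfolding dist_commute[of y0 p] by linarith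
      qed
      then have "\<bar>D.T \<phi> p - D.T \<phi> y0\<bar> \<le> C * (1/4) ^ n" using D.oscD[OF T] p by simp
      also have "\<dots> \<le> C * (1/2) ^ n" using C0 by (intro mult_left_mono power_mono) auto
      finally have 1: "\<bar>pot \<phi> p - pot \<phi> y0\<bar> \<le> C / 2 ^ n" by (simp add: pot_on_K power_one_over)
      have 2: "\<bar>pot \<phi> y0 - pot \<phi> y\<bar> \<le> 4 * ((L + 4) * B / 2 ^ n)"
      proof (cases "y \<in> K")
        case True
        then have "y0 = y" using y0(2)[OF True] by simp
        then show ?thesis using B0 L by simp
      next
        case False
        have "dist y y0 > 0" using infdist_pos[OF False] y0(3) by simp
        moreover have "r ^ Suc n \<le> 1" using r_small by (intro power_le_one) auto
        ultimately obtain k where k: "r ^ Suc k < dist y y0" "dist y y0 \<le> r ^ k"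
          using scale_ex[of "dist y y0"] yy0 by auto
        have "n \<le> k"
        proof (rule ccontr)
          assume "\<not> n \<le> k"
          then have "r ^ Suc n \<le> r ^ Suc k" using r_small by (intro power_decreasing) auto
          then show False using k yy0 zero_less_power[OF r_pos, of "Suc n"] by linarith
        qed
        have "nearest k y y0" using y0 k by (auto simp: nearest_def)
        then have "\<bar>pot \<phi> y0 - pot \<phi> y\<bar> \<le> 4 * ((L + 4) * B / 2 ^ k)" by (rule pot_near[OF _ phi B])
        also have "\<dots> \<le> 4 * ((L + 4) * B / 2 ^ n)"
          using B0 L \<open>n \<le> k\<close> by (intro mult_left_mono divide_left_mono power_increasing) auto
        finally show ?thesis .
      qed
      have "D0 / 2 ^ n = C / 2 ^ n + 4 * ((L + 4) * B / 2 ^ n)" by (simp add: D0_def add_divide_distrib)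
      then show ?thesis using 1 2 by linarith
    qed
    show ?thesis unfolding continuous_at_eps_delta
    proof (intro allI impI)
      fix e :: real assume "e > 0"
      have "(\<lambda>n. D0 * (1/2) ^ n) \<longlonglongrightarrow> D0 * 0" by (intro tendsto_mult_left LIMSEQ_power_zero) auto
      then have "\<forall>\<^sub>F n in sequentially. D0 * (1/2) ^ n < e"
        using \<open>e > 0\<close> by (intro order_tendstoD(2)[of _ 0]) auto
      then obtain n where n: "D0 / 2 ^ n < e" by (auto simp: eventually_sequentially power_one_over)
      show "\<exists>d>0. \<forall>y. dist y p < d \<longrightarrow> dist (pot \<phi> y) (pot \<phi> p) < e"
        using bound[of _ n] n by (intro exI[of _ "r ^ Suc n / 4"]) (auto simp: dist_real_def intro: le_less_trans)
    qed
  qed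
qed


section \<open>Maximum principles in the complement of the Cantor set\<close>

lemma K_snd:
  assumes "w \<in> K" shows "w $ 2 = 0"
proof -
  have "w \<in> span {axis 1 1}" using assms K_line by blast
  then obtain t :: real where "w = t *\<^sub>R axis 1 1" by (auto simp: span_singleton)
  then show ?thesis by (simp add: axis_def)
qed

lemma interior_K: "interior K = {}"
proof (rule ccontr)
  assume "interior K \<noteq> {}"
  then obtain p where "p \<in> interior K" by blast
  then obtain e where e: "e > 0" "ball p e \<subseteq> K" by (auto simp: mem_interior)
  have "p + (e/2) *\<^sub>R axis 2 1 \<in> ball p e" using e by (simp add: dist_norm)
  then have "p + (e/2) *\<^sub>R axis 2 1 \<in> K" "p \<in> K" using e by auto
  from K_snd[OF this(1)] K_snd[OF this(2)] show False using e by (simp add: axis_def)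
qed

lemma closure_compl_K: "closure (- K) = UNIV"
  by (simp add: closure_complement interior_K)

lemma frontier_compl_K: "frontier (- K) = K"
  using closed_K by (simp add: frontier_def closure_complement interior_K interior_complement)

text \<open>Every vertical line through a point off the set, together with the two open half planes, is a
  connected subset of the complement.\<close>

lemma connected_compl_K: "connected (- K)"
proof -
  define H where "H q = {y::real^2. y $ 2 > 0} \<union> {y. y $ 1 = q} \<union> {y. y $ 2 < 0}" for q :: real
  have conv: "convex {y::real^2. y $ 2 > 0}" "convex {y::real^2. y $ 1 = q}" "convex {y::real^2. y $ 2 < 0}" for q
    using convex_halfspace_gt[of 0 "axis 2 1 :: real^2"] convex_hyperplane[of "axis 1 1 :: real^2" q]
      convex_halfspace_lt[of "axis 2 1 :: real^2" 0]
    by (simp_all add: inner_axis')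
  have conn: "connected (H q)" for q
  proof -
    have 1: "vector [q, 1] \<in> {y::real^2. y $ 2 > 0} \<inter> {y. y $ 1 = q}" by simp
    have 2: "vector [q, -1] \<in> ({y::real^2. y $ 2 > 0} \<union> {y. y $ 1 = q}) \<inter> {y. y $ 2 < 0}" by simp
    show ?thesis unfolding H_def
      by (intro connected_Un convex_connected conv) (use 1 2 in blast)+
  qed
  have "- K = \<Union> (H ` {q. vector [q, 0] \<notin> K})"
  proof (intro equalityI subsetI)
    fix y assume y: "y \<in> - K"
    show "y \<in> \<Union> (H ` {q. vector [q, 0] \<notin> K})"
    proof (cases "y $ 2 = 0")
      case True
      then have "vector [y $ 1, 0] = y" by (simp add: vec_eq_iff forall_2)
      moreover have "y \<in> H (y $ 1)" by (simp add: H_def)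
      ultimately show ?thesis using y by (intro UN_I[of "y $ 1"]) auto
    next
      case False
      have "vector [5, 0] \<notin> K"
      proof
        assume "vector [5, 0] \<in> K"
        then have "norm (vector [5, 0] :: real^2) \<le> 1" using K_subset_cball by auto
        moreover have "\<bar>(vector [5, 0] :: real^2) $ 1\<bar> \<le> norm (vector [5, 0] :: real^2)" by (rule component_le_norm_cart)
        ultimately show False by simp
      qed
      moreover have "y \<in> H 5" using False by (auto simp: H_def)
      ultimately show ?thesis by blast
    qed
  next
    fix y assume "y \<in> \<Union> (H ` {q. vector [q, 0] \<notin> K})"
    then obtain q where q: "vector [q, 0] \<notin> K" "y \<in> H q" by blast
    show "y \<in> - K"
    proof
      assume yK: "y \<in> K"
      then have "y $ 2 = 0" by (rule K_snd)
      moreover from this have "y $ 1 = q" using q(2) by (auto simp: H_def)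
      ultimately have "y = vector [q, 0]" by (simp add: vec_eq_iff forall_2)
      then show False using q(1) yK by simp
    qed
  qed
  moreover have "vector [0, 1] \<in> H q" for q by (simp add: H_def)
  then have "connected (\<Union> (H ` {q. vector [q, 0] \<notin> K}))"
    using conn by (intro connected_Union) auto
  ultimately show ?thesis by simp
qed

lemma T_one: "x \<in> K \<Longrightarrow> D.T (\<lambda>_. 1) x = L"
  by (simp add: D.T_def ker_const)

lemma osc_cong: "D.osc C b f \<Longrightarrow> (\<And>x. x \<in> K \<Longrightarrow> f x = g x) \<Longrightarrow> D.osc C b g"
  unfolding D.osc_def D.cyl_def by simp

lemma green_continuous: "continuous_on UNIV green"
proof -
  have "D.osc 0 (1/4) (D.T (\<lambda>_. 1))"
    by (rule osc_cong[OF D.osc_const[of _ L]]) (simp add: T_one)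
  then have "continuous_on UNIV (pot (\<lambda>_. 1))" by (intro pot_continuous[of _ 1]) auto
  then show ?thesis unfolding green_def by (intro continuous_intros)
qed

lemma conjugable_on_minus:
  "conjugable_on S u \<Longrightarrow> conjugable_on S (\<lambda>y. c - u y)"
  using conjugable_on_add[OF conjugable_on_const[of S c] conjugable_on_cmult[of S u "- 1"]]
  by (simp add: conjugable_on_def)

lemma conjugable_on_green: "conjugable_on (- K) green"
  unfolding green_def by (intro conjugable_on_minus conjugable_on_pot[of _ 1]) auto

lemma green_large:
  assumes y: "norm y > 1"
  shows "L + ln (norm y - 1) \<le> green y"
proof -
  have "pot (\<lambda>_. 1) y \<le> (\<integral>w. - ln (norm y - 1) \<partial>M)"
    unfolding pot_def
  proof (rule integral_mono)
    show "integrable M (\<lambda>w. ker y w * 1)" using ker_integrable by simp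
    fix w assume "w \<in> space M"
    then have "norm w \<le> 1" using K_subset_cball by auto
    then have "norm y - 1 \<le> dist y w" using norm_triangle_ineq2[of y w] by (simp add: dist_norm)
    then have "ln (norm y - 1) \<le> ln (dist y w)" using y by (subst ln_le_cancel_iff) auto
    then show "ker y w * 1 \<le> - ln (norm y - 1)" by (simp add: ker_def)
  qed simp
  then show ?thesis using M.prob_space by (simp add: green_def)
qed

lemma green_nonneg: "0 \<le> green y"
proof (cases "y \<in> K")
  case False
  define R where "R = norm y + 2"
  have R: "R \<ge> 2" by (simp add: R_def)
  let ?S = "- K \<inter> ball 0 R"
  have harm: "harmonic_on ?S (\<lambda>x. (- 1) * green x + 0 * green x)"
    by (intro harmonic_on_lin harmonic_on_subset[OF conjugable_on_imp_harmonic_on[OF conjugable_on_green]])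
       (auto intro: open_compl_K)
  have "(- 1) * green y + 0 * green y \<le> 0"
  proof (rule harmonic_weak_maximum_principle[OF harm])
    show "bounded ?S" by (meson bounded_ball bounded_subset inf_le2)
    show "continuous_on (closure ?S) (\<lambda>x. (- 1) * green x + 0 * green x)"
      by (intro continuous_intros continuous_on_subset[OF green_continuous]) auto
    show "y \<in> ?S" using False by (simp add: R_def)
    fix p assume "p \<in> frontier ?S"
    then have "p \<in> K \<or> p \<in> frontier (ball 0 R)"
      using frontier_Int_subset[of "- K" "ball 0 R"] frontier_compl_K by auto
    then show "(- 1) * green p + 0 * green p \<le> 0"
    proof
      assume "p \<in> frontier (ball 0 R)"
      then have p: "norm p = R" using R by (simp add: frontier_ball)
      then have "ln (norm p - 1) \<ge> 0" using R by simp
      then have "0 \<le> green p" using green_large[of p] p L R by linarith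
      then show ?thesis by simp
    qed (simp add: green_on_K)
  qed
  then show ?thesis by simp
qed (simp add: green_on_K)

text \<open>A multiple of \<open>green\<close>, arbitrarily small on compact sets but unbounded at infinity, serves
  as a barrier at infinity.\<close>

theorem bounded_maximum_principle:
  assumes S: "open S" "S \<subseteq> - K" and w: "harmonic_on S w" and cont: "continuous_on (closure S) w"
    and fr: "\<And>p. p \<in> frontier S \<Longrightarrow> w p \<le> 0" and bd: "\<And>p. p \<in> S \<Longrightarrow> w p \<le> B" and y: "y \<in> S"
  shows "w y \<le> 0"
proof (rule ccontr)
  assume "\<not> w y \<le> 0"
  then have wy: "w y > 0" by simp
  define q where "q = green y + 1"
  define \<epsilon> where "\<epsilon> = w y / (2 * q)"
  have g0: "q > 0" using green_nonneg[of y] by (simp add: q_def)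
  have eps: "\<epsilon> > 0" using wy g0 by (simp add: \<epsilon>_def)
  define R where "R = exp (\<bar>B\<bar> / \<epsilon>) + norm y + 1"
  have R: "R > norm y" "R > 1" using exp_gt_zero[of "\<bar>B\<bar> / \<epsilon>"] by (auto simp: R_def add_pos_nonneg)
  let ?S = "S \<inter> ball 0 R"
  have harm: "harmonic_on ?S (\<lambda>x. 1 * w x + (- \<epsilon>) * green x)"
    by (intro harmonic_on_lin harmonic_on_subset[OF w]
        harmonic_on_subset[OF conjugable_on_imp_harmonic_on[OF conjugable_on_green]])
       (use S in auto)
  have "1 * w y + (- \<epsilon>) * green y \<le> 0"
  proof (rule harmonic_weak_maximum_principle[OF harm])
    show "bounded ?S" by (meson bounded_ball bounded_subset inf_le2)
    have "closure ?S \<subseteq> closure S" by (intro closure_mono) auto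
    then show "continuous_on (closure ?S) (\<lambda>x. 1 * w x + (- \<epsilon>) * green x)"
      by (intro continuous_intros continuous_on_subset[OF green_continuous] continuous_on_subset[OF cont]) auto
    show "y \<in> ?S" using y R by simp
    fix p assume p: "p \<in> frontier ?S"
    show "1 * w p + (- \<epsilon>) * green p \<le> 0"
    proof (cases "p \<in> S")
      case True
      have "open ?S" using S by auto
      then have "p \<notin> ?S" using p by (simp add: frontier_def interior_open del: interior_Int)
      then have "p \<notin> ball 0 R" using True by simp
      moreover have "p \<in> frontier S \<union> frontier (ball 0 R)" using p frontier_Int_subset by blast
      moreover have "p \<notin> frontier S" using True S(1) by (auto simp: frontier_def interior_open)
      ultimately have np: "norm p = R" using R by (auto simp: frontier_ball)
      have "\<bar>B\<bar> / \<epsilon> \<le> ln (norm p - 1)"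
        unfolding np R_def by (subst ln_ge_iff) (auto simp: add_pos_nonneg)
      also have "\<dots> \<le> green p" using green_large[of p] np R L by linarith
      finally have "\<bar>B\<bar> \<le> \<epsilon> * green p" using eps by (simp add: field_simps)
      then show ?thesis using bd[OF True] by simp
    next
      case False
      have "p \<in> closure S" using p closure_mono[of ?S S] by (auto simp: frontier_def)
      then have "p \<in> frontier S" using False S(1) by (auto simp: frontier_def interior_open)
      then have "w p \<le> 0" by (rule fr)
      moreover have "\<epsilon> * green p \<ge> 0" using eps green_nonneg[of p] by simp
      ultimately show ?thesis by simp
    qed
  qed
  moreover have "\<epsilon> * q = w y / 2" using g0 by (simp add: \<epsilon>_def)
  ultimately show False using wy eps by (simp add: q_def distrib_left)
qed

section \<open>Green functions with finite pole\<close>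

lemma T_add_const:
  assumes "\<phi> \<in> borel_measurable M" "\<And>w. w \<in> K \<Longrightarrow> \<bar>\<phi> w\<bar> \<le> B" and x: "x \<in> K"
  shows "D.T (\<lambda>w. \<phi> w + a) x = D.T \<phi> x + a * L"
proof -
  have "D.T (\<lambda>w. \<phi> w + a) x = (\<integral>w. ker x w * \<phi> w + a * ker x w \<partial>M)"
    unfolding D.T_def by (intro Bochner_Integration.integral_cong) (auto simp: algebra_simps)
  also have "\<dots> = D.T \<phi> x + a * L"
    using ker_phi_integrable[OF assms(1,2), of x] ker_integrable[of x] by (simp add: D.T_def ker_const[OF x])
  finally show ?thesis .
qed

text \<open>The integral of the solution can be prescribed because adding a constant to it only changes \<open>c\<close>.\<close>

lemma solve_normalized:
  assumes f: "D.osc C (1/4) f"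
  obtains \<phi> C' c where "D.osc C' (1/2) \<phi>" "\<And>x. x \<in> K \<Longrightarrow> D.T \<phi> x = f x + c" "(\<integral>w. \<phi> w \<partial>M) = a"
proof -
  obtain \<psi> C' c where psi: "D.osc C' (1/2) \<psi>" "\<And>x. x \<in> space M \<Longrightarrow> D.T \<psi> x = f x + c"
    by (rule D.T_solvable[OF f]) (rule that)
  have m: "\<psi> \<in> borel_measurable M" by (rule D.osc_measurable[OF psi(1)]) auto
  obtain B where B: "\<And>w. w \<in> space M \<Longrightarrow> \<bar>\<psi> w\<bar> \<le> B" using D.osc_bounded[OF psi(1)] by blast
  define t where "t = a - (\<integral>w. \<psi> w \<partial>M)"
  have "D.osc (C' + 0) (1/2) (\<lambda>w. \<psi> w + t)" by (rule D.osc_add[OF psi(1) D.osc_const])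
  moreover have "D.T (\<lambda>w. \<psi> w + t) x = f x + (c + t * L)" if "x \<in> K" for x
    using T_add_const[OF m _ that, of B t] B psi(2)[of x] that by simp
  moreover have "(\<integral>w. \<psi> w + t \<partial>M) = a"
    using D.osc_integrable[OF psi(1)] M.prob_space by (simp add: t_def)
  ultimately show ?thesis using that by blast
qed

lemma osc_ker:
  assumes x: "x \<notin> K"
  shows "D.osc (2 / infdist x K) (1/4) (ker x)"
  unfolding D.osc_def
proof (intro allI ballI)
  fix n w w' assume w: "w \<in> space M" and w': "w' \<in> D.cyl n w"
  then have K: "w \<in> K" "w' \<in> K" by (auto simp: D.cyl_def)
  have \<eta>: "infdist x K > 0" by (rule infdist_pos[OF x])
  have "\<bar>ln (dist x w) - ln (dist x w')\<bar> \<le> \<bar>dist x w - dist x w'\<bar> / infdist x K"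
    by (rule abs_ln_diff_le_lipschitz[OF \<eta>]) (use K in \<open>auto intro: infdist_le\<close>)
  also have "\<dots> \<le> 2 * (1/4) ^ n / infdist x K"
  proof (rule divide_right_mono)
    have "\<bar>dist x w - dist x w'\<bar> \<le> dist w w'"
      using dist_triangle[of x w w'] dist_triangle[of x w' w] by (simp add: dist_commute abs_le_iff)
    also have "\<dots> \<le> 2 * r ^ n" using cyl_dist[OF K(1) w'] .
    also have "\<dots> \<le> 2 * (1/4) ^ n" using r_small by (intro mult_left_mono power_mono) auto
    finally show "\<bar>dist x w - dist x w'\<bar> \<le> 2 * (1/4) ^ n" .
  qed (use \<eta> in simp)
  finally have "\<bar>ln (dist x w) - ln (dist x w')\<bar> \<le> 2 / infdist x K * (1/4) ^ n" by simp
  then show "\<bar>ker x w - ker x w'\<bar> \<le> 2 / infdist x K * (1/4) ^ n" unfolding ker_def by linarith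
qed

text \<open>Density of harmonic measure with pole at \<open>x\<close>. That it has total mass one makes the Green function below
  bounded at infinity.\<close>

definition pole_density :: "real^2 \<Rightarrow> (real^2 \<Rightarrow> real) \<Rightarrow> real \<Rightarrow> bool" where
  "pole_density x \<phi> c \<longleftrightarrow> (\<exists>C. D.osc C (1/2) \<phi>) \<and> (\<integral>w. \<phi> w \<partial>M) = 1 \<and> (\<forall>w\<in>K. pot \<phi> w = ker x w + c)"

lemma pole_density_ex:
  assumes "x \<notin> K"
  obtains \<phi> c where "pole_density x \<phi> c"
proof -
  obtain \<phi> C' c where "D.osc C' (1/2) \<phi>" "\<And>w. w \<in> K \<Longrightarrow> D.T \<phi> w = ker x w + c" "(\<integral>w. \<phi> w \<partial>M) = 1"
    by (rule solve_normalized[OF osc_ker[OF assms], of 1]) (rule that)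
  then have "pole_density x \<phi> c" unfolding pole_density_def pot_on_K by blast
  then show ?thesis by (rule that)
qed

definition Green :: "real^2 \<Rightarrow> (real^2 \<Rightarrow> real) \<Rightarrow> real \<Rightarrow> real^2 \<Rightarrow> real" where
  "Green x \<phi> c y = (1 / (2 * pi)) * (ker x y - pot \<phi> y + c)"

context
  fixes x :: "real^2" and \<phi> :: "real^2 \<Rightarrow> real" and c :: real
  assumes x: "x \<notin> K" and pd: "pole_density x \<phi> c"
begin

lemma phi_measurable: "\<phi> \<in> borel_measurable M"
  using pd D.osc_measurable by (auto simp: pole_density_def)

lemma phi_bounded: obtains B where "B \<ge> 0" "\<And>w. w \<in> K \<Longrightarrow> \<bar>\<phi> w\<bar> \<le> B"
proof -
  obtain C where "D.osc C (1/2) \<phi>" using pd unfolding pole_density_def by (elim exE conjE) (rule that)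
  then show ?thesis using D.osc_bounded[of C "1/2" \<phi>] that by auto
qed

lemma conjugable_on_pot_phi: "conjugable_on (- K) (pot \<phi>)"
  using phi_bounded conjugable_on_pot[OF phi_measurable] by metis

lemma pot_phi_continuous: "continuous_on UNIV (pot \<phi>)"
proof -
  obtain B where B: "\<And>w. w \<in> K \<Longrightarrow> \<bar>\<phi> w\<bar> \<le> B" using phi_bounded by blast
  have "D.osc (2 / infdist x K + 0) (1/4) (\<lambda>w. ker x w + c)" by (rule D.osc_add[OF osc_ker[OF x] D.osc_const])
  then have "D.osc (2 / infdist x K + 0) (1/4) (D.T \<phi>)"
    by (rule osc_cong) (use pd in \<open>simp add: pole_density_def pot_on_K\<close>)
  then show ?thesis by (rule pot_continuous[OF phi_measurable, rotated]) (rule B)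
qed

lemma Green_on_K: "w \<in> K \<Longrightarrow> Green x \<phi> c w = 0"
  using pd by (simp add: pole_density_def Green_def)

lemma Green_continuous: "continuous_on (- {x}) (Green x \<phi> c)"
  unfolding Green_def ker_def
  by (intro continuous_intros continuous_on_subset[OF pot_phi_continuous]) auto

lemma conjugable_on_Green: "conjugable_on (- K - {x}) (Green x \<phi> c)"
proof -
  have o: "open (- K - {x})" by (intro open_Diff open_compl_K) auto
  have "conjugable_on (- K - {x}) (\<lambda>y. (- 1) * ln (norm (1 *\<^sub>R y + (- x))))"
    by (intro conjugable_on_cmult conjugable_on_ln_norm_affine o) auto
  moreover have "conjugable_on (- K - {x}) (\<lambda>y. c - pot \<phi> y)"
    by (intro conjugable_on_minus conjugable_on_subset[OF conjugable_on_pot_phi] o) auto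
  ultimately have "conjugable_on (- K - {x}) (\<lambda>y. (- 1) * ln (norm (1 *\<^sub>R y + (- x))) + (c - pot \<phi> y))"
    by (rule conjugable_on_add)
  then have "conjugable_on (- K - {x}) (\<lambda>y. (1 / (2 * pi)) * ((- 1) * ln (norm (1 *\<^sub>R y + (- x))) + (c - pot \<phi> y)))"
    by (rule conjugable_on_cmult)
  then show ?thesis
    by (rule conjugable_on_cong) (simp add: Green_def ker_def dist_norm norm_minus_commute)
qed

lemma Green_bounded_at_infinity: "\<exists>R B. \<forall>y. norm y \<ge> R \<longrightarrow> \<bar>Green x \<phi> c y\<bar> \<le> B"
proof -
  obtain B where B: "B \<ge> 0" "\<And>w. w \<in> K \<Longrightarrow> \<bar>\<phi> w\<bar> \<le> B" using phi_bounded by blast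
  define d where "d = 1 + norm x"
  have d: "d > 0" by (simp add: d_def add_pos_nonneg)
  have int1: "(\<integral>w. \<phi> w \<partial>M) = 1" using pd by (simp add: pole_density_def)
  have phi_int: "integrable M \<phi>" by (rule D.bounded_integrable[OF phi_measurable, of B]) (use B in simp)
  have "\<bar>Green x \<phi> c y\<bar> \<le> (1 / (2 * pi)) * (B + \<bar>c\<bar>)" if y: "norm y \<ge> 2 * d + norm x" for y
  proof -
    have dx: "dist y x \<ge> 2 * d" using y norm_triangle_ineq2[of y x] by (simp add: dist_norm)
    have le: "\<bar>ker x y * \<phi> w - ker y w * \<phi> w\<bar> \<le> B" if w: "w \<in> K" for w
    proof -
      have "dist w x \<le> d"
        using w K_subset_cball norm_triangle_ineq4[of w x] by (auto simp: d_def dist_norm)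
      then have diff: "\<bar>dist y w - dist y x\<bar> \<le> d"
        using dist_triangle[of y w x] dist_triangle[of y x w] by (simp add: dist_commute abs_le_iff)
      have "\<bar>ln (dist y w) - ln (dist y x)\<bar> \<le> 2 * \<bar>dist y w - dist y x\<bar> / dist y x"
        using dx d diff by (intro abs_ln_diff_le) auto
      also have "\<dots> \<le> 1" using dx d diff by (subst divide_le_eq_1) auto
      finally have "\<bar>ker x y - ker y w\<bar> \<le> 1" unfolding ker_def dist_commute[of x y] by linarith
      then have "\<bar>ker x y - ker y w\<bar> * \<bar>\<phi> w\<bar> \<le> 1 * B" using B w by (intro mult_mono) auto
      then show ?thesis by (simp add: left_diff_distrib[symmetric] abs_mult)
    qed
    have i: "integrable M (\<lambda>w. ker y w * \<phi> w)" by (rule ker_phi_integrable[OF phi_measurable B(2)])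
    have "ker x y - pot \<phi> y = (\<integral>w. ker x y * \<phi> w - ker y w * \<phi> w \<partial>M)"
      using i phi_int int1 by (simp add: pot_def)
    also have "\<bar>\<dots>\<bar> \<le> (\<integral>w. B \<partial>M)"
      by (rule order_trans[OF integral_abs_bound integral_mono]) (use le i phi_int in auto)
    finally have "\<bar>ker x y - pot \<phi> y\<bar> \<le> B" using M.prob_space by simp
    then have "\<bar>ker x y - pot \<phi> y + c\<bar> \<le> B + \<bar>c\<bar>" by linarith
    then show ?thesis unfolding Green_def abs_mult by (intro mult_mono) auto
  qed
  then show ?thesis by blast
qed

lemma Green_pos_near_pole:
  obtains e where "e > 0" "cball x e \<subseteq> - K" "\<And>y. y \<in> cball x e \<Longrightarrow> y \<noteq> x \<Longrightarrow> Green x \<phi> c y > 0"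
proof -
  define e0 where "e0 = infdist x K / 2"
  have e0: "e0 > 0" "cball x e0 \<subseteq> - K"
  proof -
    show "e0 > 0" using infdist_pos[OF x] by (simp add: e0_def)
    show "cball x e0 \<subseteq> - K"
    proof (intro subsetI ComplI)
      fix y assume y: "y \<in> cball x e0" "y \<in> K"
      then have "infdist x K \<le> e0" using infdist_le[OF y(2), of x] by simp
      then show False using infdist_pos[OF x] by (simp add: e0_def)
    qed
  qed
  have "compact (pot \<phi> ` cball x e0)"
    by (intro compact_continuous_image continuous_on_subset[OF pot_phi_continuous]) auto
  then have "bounded (pot \<phi> ` cball x e0)" by (rule compact_imp_bounded)
  then obtain H where "\<forall>v\<in>pot \<phi> ` cball x e0. norm v \<le> H" by (auto simp only: bounded_iff)
  then have H: "\<bar>pot \<phi> y\<bar> \<le> H" if "y \<in> cball x e0" for y using that by simp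
  define e where "e = min e0 (exp (- (H + \<bar>c\<bar> + 1)))"
  have e: "e > 0" "e \<le> e0" using e0(1) by (auto simp: e_def)
  have pos: "Green x \<phi> c y > 0" if y: "y \<in> cball x e" "y \<noteq> x" for y
  proof -
    have "dist x y \<le> exp (- (H + \<bar>c\<bar> + 1))" using y by (auto simp: e_def)
    then have "ln (dist x y) \<le> ln (exp (- (H + \<bar>c\<bar> + 1)))" using y(2) by (subst ln_le_cancel_iff) auto
    then have "ln (dist x y) \<le> - (H + \<bar>c\<bar> + 1)" by simp
    moreover have "\<bar>pot \<phi> y\<bar> \<le> H" using H y e by auto
    ultimately have "ker x y - pot \<phi> y + c > 0" unfolding ker_def by linarith
    then show ?thesis by (simp add: Green_def)
  qed
  have "cball x e \<subseteq> - K" using e0(2) subset_cball[OF e(2), of x] by (rule order_trans[rotated])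
  then show ?thesis by (rule that[OF e(1) _ pos])
qed

lemma Green_nonneg: "y \<noteq> x \<Longrightarrow> Green x \<phi> c y \<ge> 0"
proof -
  assume yx: "y \<noteq> x"
  obtain e where e: "e > 0" "cball x e \<subseteq> - K" "\<And>y. y \<in> cball x e \<Longrightarrow> y \<noteq> x \<Longrightarrow> Green x \<phi> c y > 0"
    by (rule Green_pos_near_pole) (rule that)
  show ?thesis
  proof (cases "y \<in> K \<or> y \<in> cball x e")
    case True
    then show ?thesis using Green_on_K[of y] e(3)[of y] yx by auto
  next
    case False
    let ?S = "- K - cball x e"
    have S: "open ?S" by (intro open_Diff open_compl_K) auto
    obtain R B where RB: "\<And>y. norm y \<ge> R \<Longrightarrow> \<bar>Green x \<phi> c y\<bar> \<le> B" using Green_bounded_at_infinity by blast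
    have "compact (cball 0 R - ball x e)" by (intro compact_diff) auto
    moreover have "continuous_on (cball 0 R - ball x e) (Green x \<phi> c)"
      by (rule continuous_on_subset[OF Green_continuous]) (use e in auto)
    ultimately have "bounded (Green x \<phi> c ` (cball 0 R - ball x e))"
      using compact_continuous_image compact_imp_bounded by blast
    then obtain B' where "\<forall>v\<in>Green x \<phi> c ` (cball 0 R - ball x e). norm v \<le> B'" by (auto simp only: bounded_iff)
    then have B': "\<bar>Green x \<phi> c y\<bar> \<le> B'" if "y \<in> cball 0 R - ball x e" for y using that by simp
    have sub: "closure ?S \<subseteq> - ball x e"
      by (rule closure_minimal) auto
    have "(- 1) * Green x \<phi> c y + 0 * Green x \<phi> c y \<le> 0"
    proof (rule bounded_maximum_principle[OF S])
      show "harmonic_on ?S (\<lambda>y. (- 1) * Green x \<phi> c y + 0 * Green x \<phi> c y)"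
        by (intro harmonic_on_lin harmonic_on_subset[OF conjugable_on_imp_harmonic_on[OF conjugable_on_Green]] S)
           (use e in auto)
      show "continuous_on (closure ?S) (\<lambda>y. (- 1) * Green x \<phi> c y + 0 * Green x \<phi> c y)"
        by (intro continuous_intros continuous_on_subset[OF Green_continuous]) (use sub e in auto)
      show "(- 1) * Green x \<phi> c p + 0 * Green x \<phi> c p \<le> max B B'" if "p \<in> ?S" for p
        using RB[of p] B'[of p] that by (cases "norm p \<ge> R") (auto simp: abs_le_iff)
      fix p assume p: "p \<in> frontier ?S"
      then have "p \<notin> ?S" "p \<notin> ball x e" using S sub by (auto simp: frontier_def interior_open)
      then have "p \<in> K \<or> (p \<in> cball x e \<and> p \<noteq> x)" using e by auto
      then show "(- 1) * Green x \<phi> c p + 0 * Green x \<phi> c p \<le> 0"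
        using Green_on_K[of p] e(3)[of p] by auto
    qed (use False in auto)
    then show ?thesis by simp
  qed
qed

lemma Green_pos:
  assumes y: "y \<notin> K" "y \<noteq> x"
  shows "Green x \<phi> c y > 0"
proof -
  have conn: "connected (- K - {x})"
    by (rule connected_open_diff_countable)
       (use connected_compl_K open_compl_K in \<open>auto simp: aff_dim_open\<close>)
  obtain e where e: "e > 0" "cball x e \<subseteq> - K" "\<And>y. y \<in> cball x e \<Longrightarrow> y \<noteq> x \<Longrightarrow> Green x \<phi> c y > 0"
    by (rule Green_pos_near_pole) (rule that)
  have q: "x + e *\<^sub>R axis 1 1 \<in> cball x e" "x + e *\<^sub>R axis 1 1 \<noteq> x" using e by (auto simp: dist_norm)
  then have q': "x + e *\<^sub>R axis 1 1 \<in> - K - {x}" using e by auto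
  show ?thesis
    by (rule conjugable_on_positive[OF conjugable_on_Green conn _ q' e(3)[OF q]]) (use y Green_nonneg in auto)
qed

lemma Green_is_green_function: "is_green_function (- K) x (Green x \<phi> c)"
  unfolding is_green_function_def frontier_compl_K closure_compl_K
proof (intro conjI)
  have "conjugable_on (- K) (\<lambda>y. (1 / (2 * pi)) * (c - pot \<phi> y))"
    by (intro conjugable_on_cmult conjugable_on_minus conjugable_on_pot_phi)
  then have "harmonic_on (- K) (\<lambda>y. (1 / (2 * pi)) * (c - pot \<phi> y))" by (rule conjugable_on_imp_harmonic_on)
  moreover have "Green x \<phi> c y = - (1 / (2 * pi)) * ln (dist y x) + (1 / (2 * pi)) * (c - pot \<phi> y)" for y
    by (simp add: Green_def ker_def dist_commute algebra_simps add_divide_distrib diff_divide_distrib)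
  ultimately show "\<exists>h. harmonic_on (- K) h \<and> (\<forall>y\<in>- K - {x}. Green x \<phi> c y = - (1 / (2 * pi)) * ln (dist y x) + h y)"
    by blast
  show "\<forall>y\<in>- K - {x}. 0 < Green x \<phi> c y" using Green_pos by auto
  show "continuous_on (UNIV - {x}) (Green x \<phi> c)" using Green_continuous by (simp add: Compl_eq_Diff_UNIV)
  show "\<forall>z\<in>K. Green x \<phi> c z = 0" using Green_on_K by auto
  show "\<exists>R B. \<forall>y\<in>- K. R \<le> norm y \<longrightarrow> \<bar>Green x \<phi> c y\<bar> \<le> B" using Green_bounded_at_infinity by blast
qed

text \<open>Both functions vanish on the set. On a level set of the distance function, which is compact, both are
  continuous and positive, so they are comparable there, and the maximum principle extends this to the
  region between the level set and the set.\<close>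

lemma Green_comparable:
  "\<exists>a>0. \<exists>b>0. \<exists>\<rho>>0. \<rho> \<le> 1 \<and> \<rho> < infdist x K \<and>
    (\<forall>y. infdist y K \<le> \<rho> \<longrightarrow> a * green y \<le> Green x \<phi> c y \<and> Green x \<phi> c y \<le> b * green y)"
proof -
  define \<rho> where "\<rho> = min 1 (infdist x K / 2)"
  have rho: "\<rho> > 0" "\<rho> \<le> 1" "\<rho> < infdist x K" using infdist_pos[OF x] by (auto simp: \<rho>_def)
  define Z where "Z = {y. infdist y K = \<rho>}"
  let ?S = "{y. infdist y K < \<rho>} \<inter> - K" and ?N = "{y. infdist y K \<le> \<rho>}"
  have ci: "continuous_on UNIV (\<lambda>y. infdist y K)" by (intro continuous_intros)
  have N_closed: "closed ?N" by (rule closed_Collect_le[OF ci]) simp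
  have N_bounded: "bounded ?N"
  proof (rule bounded_subset[OF bounded_cball[of 0 2]], rule subsetI)
    fix y assume "y \<in> ?N"
    obtain y0 where "y0 \<in> K" "infdist y K = dist y y0" using nearest_point[of y] by blast
    moreover have "norm y0 \<le> 1" using \<open>y0 \<in> K\<close> K_subset_cball by auto
    ultimately show "y \<in> cball 0 2" using \<open>y \<in> ?N\<close> rho(2) norm_triangle_sub[of y y0] by (simp add: dist_norm)
  qed
  have "closed Z" unfolding Z_def by (rule closed_Collect_eq[OF ci]) simp
  moreover have "Z \<subseteq> ?N" by (auto simp: Z_def)
  ultimately have Zc: "compact Z" using N_bounded by (meson bounded_subset compact_eq_bounded_closed)
  have ZK: "y \<notin> K" if "y \<in> Z" for y using that rho infdist_zero[of y K] by (auto simp: Z_def)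
  have xN: "x \<notin> ?N" using rho by auto
  have GcN: "continuous_on ?N (Green x \<phi> c)" by (rule continuous_on_subset[OF Green_continuous]) (use xN in auto)
  have Zne: "Z \<noteq> {}"
  proof -
    obtain w0 where w0: "w0 \<in> K" using K_nonempty by blast
    let ?y = "w0 + \<rho> *\<^sub>R axis 2 1"
    have "dist ?y w \<ge> \<rho>" if "w \<in> K" for w
    proof -
      have "\<bar>(?y - w) $ 2\<bar> \<le> norm (?y - w)" by (rule component_le_norm_cart)
      then show ?thesis using K_snd[OF that] K_snd[OF w0] rho by (simp add: dist_norm axis_def)
    qed
    then have "infdist ?y K \<ge> \<rho>" using K_nonempty by (simp add: infdist_def cINF_greatest)
    moreover have "infdist ?y K \<le> dist ?y w0" by (rule infdist_le[OF w0])
    then have "infdist ?y K \<le> \<rho>" using rho by (simp add: dist_norm)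
    ultimately have "?y \<in> Z" by (simp add: Z_def)
    then show ?thesis by blast
  qed
  have GcZ: "continuous_on Z (Green x \<phi> c)" by (rule continuous_on_subset[OF GcN]) (auto simp: Z_def)
  obtain p where p: "p \<in> Z" "\<And>y. y \<in> Z \<Longrightarrow> Green x \<phi> c p \<le> Green x \<phi> c y"
    using continuous_attains_inf[OF Zc Zne GcZ] by blast
  obtain q where q: "q \<in> Z" "\<And>y. y \<in> Z \<Longrightarrow> Green x \<phi> c y \<le> Green x \<phi> c q"
    using continuous_attains_sup[OF Zc Zne GcZ] by blast
  have px: "p \<noteq> x" "q \<noteq> x" using p(1) q(1) xN by (auto simp: Z_def)
  define m where "m = Green x \<phi> c p"
  have m: "m > 0" unfolding m_def by (rule Green_pos[OF ZK[OF p(1)] px(1)])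
  define m' where "m' = Green x \<phi> c q"
  have m': "m' > 0" unfolding m'_def by (rule Green_pos[OF ZK[OF q(1)] px(2)])
  have gZ: "\<rho> powr \<delta> \<le> green y" "green y \<le> 8 * (L + 4) * \<rho> powr \<delta>" if "y \<in> Z" for y
    using green_dist[OF ZK[OF that]] that rho by (auto simp: Z_def)
  define t where "t = \<rho> powr \<delta>"
  have t: "t > 0" using rho by (simp add: t_def)
  define a where "a = m / (8 * (L + 4) * t)"
  define b where "b = m' / t"
  have a: "a > 0" and b: "b > 0" using m m' t L by (auto simp: a_def b_def)
  have S_open: "open ?S" by (intro open_Int open_compl_K open_Collect_less ci) simp
  have clS: "closure ?S \<subseteq> ?N" by (rule closure_minimal[OF _ N_closed]) auto
  have frS: "p \<in> K \<or> p \<in> Z" if "p \<in> frontier ?S" for p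
  proof -
    have "p \<in> ?N" using that clS by (auto simp: frontier_def)
    moreover have "p \<notin> ?S" using that by (auto simp: frontier_def interior_open[OF S_open] simp del: interior_Int)
    ultimately show ?thesis by (auto simp: Z_def)
  qed
  have principle: "\<alpha> * green y + \<beta> * Green x \<phi> c y \<le> 0"
    if le: "\<And>y. y \<in> Z \<Longrightarrow> \<alpha> * green y + \<beta> * Green x \<phi> c y \<le> 0" and y: "y \<in> ?N" for \<alpha> \<beta> y
  proof -
    have "y \<in> K \<or> y \<in> Z \<or> y \<in> ?S" using y by (auto simp: Z_def)
    then consider "y \<in> K" | "y \<in> Z" | "y \<in> ?S" by blast
    then show ?thesis
    proof cases
      case 1 then show ?thesis by (simp add: green_on_K Green_on_K)
    next
      case 2 then show ?thesis by (rule le)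
    next
      case 3
      show ?thesis
      proof (rule harmonic_weak_maximum_principle[of ?S "\<lambda>y. \<alpha> * green y + \<beta> * Green x \<phi> c y"])
        show "harmonic_on ?S (\<lambda>y. \<alpha> * green y + \<beta> * Green x \<phi> c y)"
          by (intro harmonic_on_lin harmonic_on_subset[OF conjugable_on_imp_harmonic_on[OF conjugable_on_Green]]
              harmonic_on_subset[OF conjugable_on_imp_harmonic_on[OF conjugable_on_green]] S_open)
             (use xN in auto)
        show "bounded ?S" by (rule bounded_subset[OF N_bounded]) auto
        show "continuous_on (closure ?S) (\<lambda>y. \<alpha> * green y + \<beta> * Green x \<phi> c y)"
          by (intro continuous_intros continuous_on_subset[OF green_continuous] continuous_on_subset[OF GcN] clS) auto
        show "\<alpha> * green p + \<beta> * Green x \<phi> c p \<le> 0" if "p \<in> frontier ?S" for p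
          using frS[OF that] le[of p] green_on_K[of p] Green_on_K[of p] by auto
      qed (use 3 in auto)
    qed
  qed
  have low: "a * green y \<le> Green x \<phi> c y" if "infdist y K \<le> \<rho>" for y
  proof -
    have "a * green y + (- 1) * Green x \<phi> c y \<le> 0"
    proof (rule principle)
      fix y assume y: "y \<in> Z"
      have "a * green y \<le> a * (8 * (L + 4) * t)" using gZ(2)[OF y] a by (intro mult_left_mono) (auto simp: t_def)
      also have "\<dots> = m" using t L by (simp add: a_def)
      also have "\<dots> \<le> Green x \<phi> c y" unfolding m_def by (rule p(2)[OF y])
      finally show "a * green y + (- 1) * Green x \<phi> c y \<le> 0" by simp
    qed (use that in simp)
    then show ?thesis by simp
  qed
  have up: "Green x \<phi> c y \<le> b * green y" if "infdist y K \<le> \<rho>" for y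
  proof -
    have "(- b) * green y + 1 * Green x \<phi> c y \<le> 0"
    proof (rule principle)
      fix y assume y: "y \<in> Z"
      have "Green x \<phi> c y \<le> m'" unfolding m'_def by (rule q(2)[OF y])
      also have "\<dots> = b * t" using t by (simp add: b_def)
      also have "\<dots> \<le> b * green y" using gZ(1)[OF y] b by (intro mult_left_mono) (auto simp: t_def)
      finally show "(- b) * green y + 1 * Green x \<phi> c y \<le> 0" by simp
    qed (use that in simp)
    then show ?thesis by simp
  qed
  show ?thesis
    by (rule exI[of _ a], rule conjI[OF a], rule exI[of _ b], rule conjI[OF b], rule exI[of _ \<rho>],
        intro conjI rho allI impI low up)
qed

text \<open>Approaching \<open>w\<close> perpendicularly to the line, the quotient of the two Green functions tends to
  \<open>\<phi> w\<close> up to the factor \<open>2 * pi\<close>, and it is bounded below.\<close>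

lemma pole_density_lower: "\<exists>a>0. \<forall>w\<in>K. a \<le> \<phi> w"
proof -
  obtain a b \<rho> where ab: "a > 0" "b > 0" "\<rho> > 0" "\<rho> \<le> 1" "\<rho> < infdist x K"
    "\<forall>y. infdist y K \<le> \<rho> \<longrightarrow> a * green y \<le> Green x \<phi> c y \<and> Green x \<phi> c y \<le> b * green y"
    using Green_comparable by (elim exE conjE) (rule that)
  obtain C where C: "D.osc C (1/2) \<phi>" using pd unfolding pole_density_def by (elim exE conjE) (rule that)
  define \<eta> where "\<eta> = infdist x K - \<rho>"
  have \<eta>: "\<eta> > 0" using ab by (simp add: \<eta>_def)
  have C0: "C \<ge> 0" by (rule D.osc_nonneg[OF C])
  have "2 * pi * a \<le> \<phi> w" if w: "w \<in> K" for w
  proof (rule ccontr)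
    assume "\<not> 2 * pi * a \<le> \<phi> w"
    define t where "t = 2 * pi * a - \<phi> w"
    have t: "t > 0" using \<open>\<not> 2 * pi * a \<le> \<phi> w\<close> by (simp add: t_def)
    define E where "E = 1 / \<eta> + 4 * ((L + 4) * C)"
    have bound: "t \<le> E * (1/2) ^ n" if n: "r ^ n < \<rho>" for n
    proof -
      define y where "y = w + r ^ n *\<^sub>R axis 2 1"
      have dyw: "dist y w = r ^ n" by (simp add: y_def dist_norm)
      have "dist y w \<le> dist y v" if "v \<in> K" for v
      proof -
        have "\<bar>(y - v) $ 2\<bar> \<le> norm (y - v)" by (rule component_le_norm_cart)
        then show ?thesis unfolding dyw using K_snd[OF that] K_snd[OF w] by (simp add: y_def dist_norm axis_def)
      qed
      moreover have "r ^ Suc n < r ^ n" using r_pow_Suc_le[of n] zero_less_power[OF r_pos, of n] by linarith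
      ultimately have near: "nearest n y w" using w dyw by (simp add: nearest_def)
      have "infdist y K \<le> dist y w" by (rule infdist_le[OF w])
      then have "a * green y \<le> Green x \<phi> c y" using spec[OF ab(6), of y] n dyw by simp
      then have "2 * pi * (a * green y) \<le> 2 * pi * Green x \<phi> c y" by (intro mult_left_mono) auto
      also have "2 * pi * Green x \<phi> c y = ker x y - pot \<phi> y + c" by (simp add: Green_def)
      also have "\<dots> = (ker x y - ker x w) + (pot \<phi> w - pot \<phi> y)" using pd w by (simp add: pole_density_def)
      also have "ker x y - ker x w \<le> r ^ n / \<eta>"
      proof -
        have xw: "infdist x K \<le> dist x w" by (rule infdist_le[OF w])
        have "\<bar>dist x w - dist x y\<bar> \<le> r ^ n"
          using dist_triangle[of x w y] dist_triangle[of x y w] dyw by (simp add: dist_commute abs_le_iff)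
        moreover have "\<bar>ln (dist x w) - ln (dist x y)\<bar> \<le> \<bar>dist x w - dist x y\<bar> / \<eta>"
          using calculation n xw ab by (intro abs_ln_diff_le_lipschitz[OF \<eta>]) (auto simp: \<eta>_def)
        ultimately have "\<bar>ln (dist x w) - ln (dist x y)\<bar> \<le> r ^ n / \<eta>"
          using divide_right_mono[of "\<bar>dist x w - dist x y\<bar>" "r ^ n" \<eta>] \<eta> by linarith
        then show ?thesis unfolding ker_def by linarith
      qed
      also have "pot \<phi> w - pot \<phi> y \<le> \<phi> w * green y + 4 * ((L + 4) * C / 4 ^ n)"
        using pot_leading_order[OF near C] by linarith
      finally have "t * green y \<le> r ^ n / \<eta> + 4 * ((L + 4) * C / 4 ^ n)"
        by (simp add: t_def algebra_simps)
      moreover have "r ^ n \<le> (1/4) ^ n" using r_small by (intro power_mono) auto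
      then have "r ^ n / \<eta> \<le> (1/4) ^ n / \<eta>" using \<eta> by (intro divide_right_mono) auto
      ultimately have "t * green y \<le> E / 4 ^ n"
        by (simp add: E_def add_divide_distrib power_one_over mult.commute)
      moreover have "1 / 2 ^ n \<le> green y"
      proof -
        have "1 / (2::real) ^ n \<le> 20 / 2 ^ n" by (intro divide_right_mono) auto
        then show ?thesis using green_lower[OF near] by linarith
      qed
      then have "t * (1 / 2 ^ n) \<le> t * green y" using t by (intro mult_left_mono) auto
      ultimately have "t / 2 ^ n \<le> E / 4 ^ n" by simp
      then have "t / 2 ^ n * 2 ^ n \<le> E / 4 ^ n * 2 ^ n" by (intro mult_right_mono) auto
      moreover have "(4::real) ^ n = 2 ^ n * 2 ^ n" by (simp add: power_mult_distrib[symmetric])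
      ultimately show ?thesis by (simp add: power_one_over)
    qed
    have "(\<lambda>n. E * (1/2) ^ n) \<longlonglongrightarrow> E * 0" by (intro tendsto_mult_left LIMSEQ_power_zero) auto
    then have "\<forall>\<^sub>F n in sequentially. E * (1/2) ^ n < t" using t by (intro order_tendstoD(2)[of _ 0]) auto
    moreover have "\<forall>\<^sub>F n in sequentially. r ^ n < \<rho>" using r_pow_tendsto_0 ab(3) by (rule order_tendstoD(2))
    ultimately have "\<forall>\<^sub>F n in sequentially. False"
    proof eventually_elim
      case (elim n)
      then show ?case using bound[of n] by linarith
    qed
    then show False by simp
  qed
  then show ?thesis using ab(1) by (intro exI[of _ "2 * pi * a"]) auto
qed

end


section \<open>Harmonic measure\<close>

definition \<Phi> :: "real^2 \<Rightarrow> real^2 \<Rightarrow> real" where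
  "\<Phi> y = (SOME \<phi>. \<exists>c. pole_density y \<phi> c)"

lemma Phi_density:
  assumes "y \<notin> K"
  obtains c where "pole_density y (\<Phi> y) c"
proof -
  have "\<exists>\<phi>. \<exists>c. pole_density y \<phi> c" using pole_density_ex[OF assms] by metis
  then have "\<exists>c. pole_density y (\<Phi> y) c" unfolding \<Phi>_def by (rule someI_ex)
  then show ?thesis using that by blast
qed

lemma Phi_lower:
  assumes "y \<notin> K"
  obtains a where "a > 0" "\<And>w. w \<in> K \<Longrightarrow> a \<le> \<Phi> y w"
  using Phi_density[OF assms] pole_density_lower[OF assms] by metis

lemma Phi_nonneg: "y \<notin> K \<Longrightarrow> w \<in> K \<Longrightarrow> 0 \<le> \<Phi> y w"
  using Phi_lower[of y] by (metis less_imp_le order_trans)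

lemma Phi_measurable: "y \<notin> K \<Longrightarrow> \<Phi> y \<in> borel_measurable M"
  using Phi_density[of y] phi_measurable[of y] by metis

lemma Phi_bounded:
  assumes "y \<notin> K"
  obtains B where "B \<ge> 0" "\<And>w. w \<in> K \<Longrightarrow> \<bar>\<Phi> y w\<bar> \<le> B"
proof -
  obtain c where "pole_density y (\<Phi> y) c" by (rule Phi_density[OF assms])
  then show ?thesis using phi_bounded[OF assms] that by metis
qed

lemma Phi_integrable: "y \<notin> K \<Longrightarrow> integrable M (\<Phi> y)"
  using Phi_bounded[of y] D.bounded_integrable[OF Phi_measurable[of y]] by (metis space_M)

lemma Phi_integral: "y \<notin> K \<Longrightarrow> (\<integral>w. \<Phi> y w \<partial>M) = 1"
  using Phi_density[of y] by (auto simp: pole_density_def)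

lemma id_measurable_M: "(\<lambda>w. w) \<in> M \<rightarrow>\<^sub>M borel"
  by (rule borel_measurable_M) simp

text \<open>Fubini's theorem and the symmetry of the kernel.\<close>

lemma T_symmetric:
  assumes phi: "\<phi> \<in> borel_measurable M" "\<And>w. w \<in> K \<Longrightarrow> \<bar>\<phi> w\<bar> \<le> B"
    and psi: "\<psi> \<in> borel_measurable M" "\<And>w. w \<in> K \<Longrightarrow> \<bar>\<psi> w\<bar> \<le> B'"
  shows "(\<integral>w. D.T \<phi> w * \<psi> w \<partial>M) = (\<integral>v. \<phi> v * D.T \<psi> v \<partial>M)"
proof -
  interpret P: pair_sigma_finite M M ..
  define f where "f = (\<lambda>(w, v). ker w v * \<phi> v * \<psi> w)"
  have m1: "fst \<in> M \<Otimes>\<^sub>M M \<rightarrow>\<^sub>M borel" "snd \<in> M \<Otimes>\<^sub>M M \<rightarrow>\<^sub>M borel"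
    using measurable_compose[OF measurable_fst id_measurable_M] measurable_compose[OF measurable_snd id_measurable_M] by auto
  have m2: "(\<lambda>p. \<phi> (snd p)) \<in> borel_measurable (M \<Otimes>\<^sub>M M)" "(\<lambda>p. \<psi> (fst p)) \<in> borel_measurable (M \<Otimes>\<^sub>M M)"
    using measurable_compose[OF measurable_snd phi(1)] measurable_compose[OF measurable_fst psi(1)] by auto
  have "(\<lambda>p. ker (fst p) (snd p)) \<in> borel_measurable (M \<Otimes>\<^sub>M M)"
    unfolding ker_def using m1 by measurable
  then have fm: "f \<in> borel_measurable (M \<Otimes>\<^sub>M M)"
    unfolding f_def case_prod_beta using m2 by measurable
  have nonneg: "B \<ge> 0" "B' \<ge> 0" using phi(2) psi(2) K_nonempty by (force intro: order_trans[OF abs_ge_zero])+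
  have iphi: "integrable M (\<lambda>v. ker w v * \<phi> v * a)" for w a
    using ker_phi_integrable[OF phi] by simp
  have int: "integrable (M \<Otimes>\<^sub>M M) f"
  proof (rule P.Fubini_integrable[OF fm])
    show "AE w in M. integrable M (\<lambda>v. f (w, v))" using iphi by (auto simp: f_def)
    show "integrable M (\<lambda>w. \<integral>v. norm (f (w, v)) \<partial>M)"
    proof (rule D.bounded_integrable)
      show "(\<lambda>w. \<integral>v. norm (f (w, v)) \<partial>M) \<in> borel_measurable M"
        using fm by measurable
      fix w assume "w \<in> space M"
      then have w: "w \<in> K" by simp
      have "(\<integral>v. norm (f (w, v)) \<partial>M) \<le> (\<integral>v. \<bar>ker w v\<bar> * (B * B') \<partial>M)"
      proof (rule integral_mono)
        show "integrable M (\<lambda>v. norm (f (w, v)))" using iphi by (auto simp: f_def)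
        show "integrable M (\<lambda>v. \<bar>ker w v\<bar> * (B * B'))" using ker_integrable by simp
        fix v assume "v \<in> space M"
        then have "\<bar>\<phi> v\<bar> * \<bar>\<psi> w\<bar> \<le> B * B'" using phi(2) psi(2) w nonneg by (intro mult_mono) auto
        then show "norm (f (w, v)) \<le> \<bar>ker w v\<bar> * (B * B')"
          by (simp add: f_def abs_mult mult.assoc mult_left_mono)
      qed
      also have "\<dots> \<le> 4 * (L + 1) * (B * B')"
        using D.k_abs_integral[of w] w nonneg by (simp add: mult_right_mono)
      finally show "\<bar>\<integral>v. norm (f (w, v)) \<partial>M\<bar> \<le> 4 * (L + 1) * (B * B')" by simp
    qed
  qed
  have "(\<integral>w. D.T \<phi> w * \<psi> w \<partial>M) = (\<integral>w. (\<integral>v. f (w, v) \<partial>M) \<partial>M)"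
    by (intro Bochner_Integration.integral_cong) (auto simp: f_def D.T_def)
  also have "\<dots> = (\<integral>v. (\<integral>w. f (w, v) \<partial>M) \<partial>M)"
    using P.Fubini_integral[of "\<lambda>w v. f (w, v)"] int by simp
  also have "\<dots> = (\<integral>v. \<phi> v * D.T \<psi> v \<partial>M)"
  proof (intro Bochner_Integration.integral_cong refl)
    fix v
    have "(\<integral>w. f (w, v) \<partial>M) = (\<integral>w. \<phi> v * (ker v w * \<psi> w) \<partial>M)"
      by (intro Bochner_Integration.integral_cong) (auto simp: f_def ker_def dist_commute)
    then show "(\<integral>w. f (w, v) \<partial>M) = \<phi> v * D.T \<psi> v" by (simp add: D.T_def)
  qed
  finally show ?thesis .
qed

text \<open>Distances to points of a line through the origin transform in this way under inversion in the unit
  circle.\<close>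

lemma norm_inversion:
  fixes y e :: "'a::real_inner"
  assumes "norm e = 1" "y \<noteq> 0"
  shows "norm (y /\<^sub>R (norm y)\<^sup>2 - t *\<^sub>R e) = norm (e - t *\<^sub>R y) / norm y"
proof -
  have ny: "norm y > 0" using assms by simp
  have ee: "e \<bullet> e = 1" using assms(1) by (simp add: dot_square_norm)
  have "(norm (y /\<^sub>R (norm y)\<^sup>2 - t *\<^sub>R e) * norm y)\<^sup>2 =
      (y /\<^sub>R (norm y)\<^sup>2 - t *\<^sub>R e) \<bullet> (y /\<^sub>R (norm y)\<^sup>2 - t *\<^sub>R e) * (y \<bullet> y)"
    by (simp only: power_mult_distrib power2_norm_eq_inner)
  also have "\<dots> = (y \<bullet> y / (y \<bullet> y)\<^sup>2 - 2 * t * (y \<bullet> e) / (y \<bullet> y) + t\<^sup>2) * (y \<bullet> y)"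
    unfolding power2_norm_eq_inner
    using ee by (simp add: inner_diff_left inner_diff_right inner_commute
        power2_eq_square divide_inverse algebra_simps)
  also have "\<dots> = 1 - 2 * t * (y \<bullet> e) + t\<^sup>2 * (y \<bullet> y)"
    using assms(2) by (simp add: power2_eq_square field_simps)
  also have "\<dots> = (e - t *\<^sub>R y) \<bullet> (e - t *\<^sub>R y)"
    using ee by (simp add: inner_diff_left inner_diff_right inner_commute power2_eq_square algebra_simps)
  also have "\<dots> = (norm (e - t *\<^sub>R y))\<^sup>2" by (simp add: dot_square_norm)
  finally have "norm (y /\<^sub>R (norm y)\<^sup>2 - t *\<^sub>R e) * norm y = norm (e - t *\<^sub>R y)"
    by (rule power2_eq_imp_eq) auto
  then show ?thesis using ny by (simp add: field_simps)
qed

lemma K_eq_axis: "w \<in> K \<Longrightarrow> w = (w $ 1) *\<^sub>R axis 1 1"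
  using K_snd[of w] by (simp add: vec_eq_iff forall_2 axis_def)

lemma K_fst_le: "w \<in> K \<Longrightarrow> \<bar>w $ 1\<bar> \<le> 1"
  using component_le_norm_cart[of w 1] K_subset_cball by fastforce

lemma inverted_kernel_lower:
  assumes "w \<in> K" "y \<in> ball 0 (1/2)"
  shows "1/2 \<le> norm (- (w $ 1) *\<^sub>R y + axis 1 1 :: real^2)"
proof -
  have "\<bar>w $ 1\<bar> * norm y \<le> 1 * (1/2)" using K_fst_le[OF assms(1)] assms(2) by (intro mult_mono) auto
  then show ?thesis
    using norm_triangle_ineq2[of "axis 1 1 :: real^2" "(w $ 1) *\<^sub>R y"] by (simp add: norm_minus_commute)
qed

text \<open>For regular data the solution is a potential plus a constant. Its values are integrals against
  the densities \<open>\<Phi> y\<close> by symmetry, and its inversion extends across the origin because the density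
  has integral zero.\<close>

lemma regular_solution:
  assumes f: "D.osc C (1/4) f"
  obtains v V where "continuous_on UNIV v" "conjugable_on (- K) v"
    "\<And>w. w \<in> K \<Longrightarrow> v w = f w" "\<And>y. y \<notin> K \<Longrightarrow> v y = (\<integral>w. \<Phi> y w * f w \<partial>M)"
    "conjugable_on (ball 0 (1/2)) V" "V 0 = (\<integral>w. f w \<partial>M)"
    "\<And>y. y \<in> ball 0 (1/2) \<Longrightarrow> y \<noteq> 0 \<Longrightarrow> V y = v (y /\<^sub>R (norm y)\<^sup>2)"
proof -
  obtain \<psi> C' c where psi: "D.osc C' (1/2) \<psi>" "\<And>w. w \<in> K \<Longrightarrow> D.T \<psi> w = f w + c" "(\<integral>w. \<psi> w \<partial>M) = 0"
    by (rule solve_normalized[OF f, of 0]) (rule that)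
  have m: "\<psi> \<in> borel_measurable M" by (rule D.osc_measurable[OF psi(1)]) auto
  obtain B where B: "\<And>w. w \<in> K \<Longrightarrow> \<bar>\<psi> w\<bar> \<le> B" using D.osc_bounded[OF psi(1)] by auto
  have ipsi: "integrable M \<psi>" by (rule D.osc_integrable[OF psi(1)]) auto
  have fm: "f \<in> borel_measurable M" by (rule D.osc_measurable[OF f]) auto
  have fi: "integrable M f" by (rule D.osc_integrable[OF f]) auto
  obtain Bf where Bf: "\<And>w. w \<in> K \<Longrightarrow> \<bar>f w\<bar> \<le> Bf" using D.osc_bounded[OF f] by auto
  define v where "v y = pot \<psi> y - c" for y
  define q where "q y w = ln (norm (- (w $ 1) *\<^sub>R y + axis 1 1 :: real^2))" for y w :: "real^2"
  define V where "V y = (- c) - (\<integral>w. q y w * \<psi> w \<partial>M)" for y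
  have "D.osc (C + 0) (1/4) (\<lambda>w. f w + c)" by (rule D.osc_add[OF f D.osc_const])
  then have "D.osc (C + 0) (1/4) (D.T \<psi>)" by (rule osc_cong) (simp add: psi(2))
  then have "continuous_on UNIV (pot \<psi>)" by (rule pot_continuous[OF m, rotated]) (rule B)
  then have 1: "continuous_on UNIV v" unfolding v_def by (intro continuous_intros)
  have "conjugable_on (- K) (pot \<psi>)" by (rule conjugable_on_pot[OF m]) (rule B)
  then have "conjugable_on (- K) (\<lambda>y. pot \<psi> y + (- c))"
    by (intro conjugable_on_add conjugable_on_const open_compl_K)
  moreover have "v = (\<lambda>y. pot \<psi> y + (- c))" by (auto simp: v_def fun_eq_iff)
  ultimately have 2: "conjugable_on (- K) v" by simp
  have 3: "v w = f w" if "w \<in> K" for w using psi(2)[OF that] by (simp add: v_def pot_on_K)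
  have 4: "v y = (\<integral>w. \<Phi> y w * f w \<partial>M)" if y: "y \<notin> K" for y
  proof -
    obtain c' where c': "pole_density y (\<Phi> y) c'" by (rule Phi_density[OF y])
    obtain B' where B': "\<And>w. w \<in> K \<Longrightarrow> \<bar>\<Phi> y w\<bar> \<le> B'" using Phi_bounded[OF y] by metis
    have "(\<integral>w. D.T (\<Phi> y) w * \<psi> w \<partial>M) = (\<integral>w. ker y w * \<psi> w + c' * \<psi> w \<partial>M)"
      using c' by (intro Bochner_Integration.integral_cong) (auto simp: pole_density_def pot_on_K[symmetric] algebra_simps)
    also have "\<dots> = pot \<psi> y"
      using ker_phi_integrable[OF m B, of y] ipsi psi(3) by (simp add: pot_def)
    finally have "pot \<psi> y = (\<integral>w. \<Phi> y w * D.T \<psi> w \<partial>M)"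
      using T_symmetric[OF Phi_measurable[OF y] B' m B] by simp
    also have "\<dots> = (\<integral>w. \<Phi> y w * f w + c * \<Phi> y w \<partial>M)"
      by (intro Bochner_Integration.integral_cong) (auto simp: psi(2) algebra_simps)
    also have "\<dots> = (\<integral>w. \<Phi> y w * f w \<partial>M) + c"
      using D.times_bounded_integrable[OF Phi_integrable[OF y] fm, of Bf] Bf Phi_integrable[OF y] Phi_integral[OF y]
      by simp
    finally show ?thesis by (simp add: v_def)
  qed
  have 5: "conjugable_on (ball 0 (1/2)) V"
    unfolding V_def
  proof (intro conjugable_on_minus conjugable_on_integral[OF open_ball _ _ _ m B])
    show "conjugable_on (ball 0 (1/2)) (\<lambda>y. q y w)" if "w \<in> K" for w
      unfolding q_def
      by (rule conjugable_on_ln_norm_affine[OF open_ball]) (use inverted_kernel_lower[OF that] in force)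
    show "q y \<in> borel_measurable M" for y
    proof (rule borel_measurable_M)
      have "continuous_on UNIV (\<lambda>w::real^2. norm (- (w $ 1) *\<^sub>R y + axis 1 1 :: real^2))"
        by (intro continuous_intros)
      then have "(\<lambda>w::real^2. norm (- (w $ 1) *\<^sub>R y + axis 1 1 :: real^2)) \<in> borel_measurable borel"
        by (rule borel_measurable_continuous_onI)
      then show "q y \<in> borel_measurable borel" unfolding q_def by measurable
    qed
    fix D assume D: "compact D" "D \<subseteq> ball (0::real^2) (1/2)"
    have "\<bar>q y w - q y w'\<bar> \<le> 2 * r ^ n"
      if y: "y \<in> D" and w: "w \<in> K" "w' \<in> K" "idx n w = idx n w'" for y n w w'
    proof -
      have yb: "y \<in> ball 0 (1/2)" using y D(2) by blast
      let ?a = "- (w $ 1) *\<^sub>R y + axis 1 1 :: real^2" and ?a' = "- (w' $ 1) *\<^sub>R y + axis 1 1 :: real^2"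
      have "\<bar>q y w - q y w'\<bar> \<le> \<bar>norm ?a - norm ?a'\<bar> / (1/2)"
        unfolding q_def by (rule abs_ln_diff_le_lipschitz[OF _ inverted_kernel_lower inverted_kernel_lower])
          (use w yb in auto)
      also have "\<dots> = 2 * \<bar>norm ?a - norm ?a'\<bar>" by simp
      also have "\<dots> \<le> 2 * norm (?a - ?a')" by (intro mult_left_mono norm_triangle_ineq3) auto
      also have "?a - ?a' = ((w' - w) $ 1) *\<^sub>R y" by (simp add: algebra_simps)
      also have "2 * norm (((w' - w) $ 1) *\<^sub>R y) = \<bar>(w' - w) $ 1\<bar> * (2 * norm y)" by simp
      also have "\<dots> \<le> norm (w' - w) * 1"
        using yb by (intro mult_mono component_le_norm_cart) auto
      also have "\<dots> \<le> 2 * r ^ n" using same_cell_dist[OF w] by (simp add: dist_norm norm_minus_commute)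
      finally show ?thesis .
    qed
    then show "\<exists>c. \<forall>y\<in>D. \<forall>n. \<forall>w\<in>K. \<forall>w'\<in>K. idx n w = idx n w' \<longrightarrow> \<bar>q y w - q y w'\<bar> \<le> c * r ^ n"
      by (intro exI[of _ 2]) simp
  qed
  have 6: "V 0 = (\<integral>w. f w \<partial>M)"
  proof -
    have q0: "q 0 w = 0" for w by (simp add: q_def)
    have "(\<integral>w. D.T \<psi> w * 1 \<partial>M) = (\<integral>w. \<psi> w * D.T (\<lambda>_. 1) w \<partial>M)"
      by (rule T_symmetric[OF m B, of _ 1]) auto
    also have "\<dots> = (\<integral>w. \<psi> w * L \<partial>M)" by (intro Bochner_Integration.integral_cong) (auto simp: T_one)
    also have "\<dots> = 0" using psi(3) by simp
    also have "(\<integral>w. D.T \<psi> w * 1 \<partial>M) = (\<integral>w. f w + c \<partial>M)"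
      by (intro Bochner_Integration.integral_cong) (auto simp: psi(2))
    also have "\<dots> = (\<integral>w. f w \<partial>M) + c" using fi M.prob_space by simp
    finally show ?thesis by (simp add: V_def q0)
  qed
  have 7: "V y = v (y /\<^sub>R (norm y)\<^sup>2)" if y: "y \<in> ball 0 (1/2)" "y \<noteq> 0" for y
  proof -
    let ?y = "y /\<^sub>R (norm y)\<^sup>2"
    have ker: "ker ?y w = ln (norm y) - q y w" if w: "w \<in> K" for w
    proof -
      have "dist ?y w = norm (axis 1 1 - (w $ 1) *\<^sub>R y) / norm y"
        using norm_inversion[of "axis 1 1 :: real^2" y "w $ 1"] y(2) K_eq_axis[OF w] by (simp add: dist_norm)
      also have "axis 1 1 - (w $ 1) *\<^sub>R y = - (w $ 1) *\<^sub>R y + axis 1 1" by simp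
      finally have d: "dist ?y w = norm (- (w $ 1) *\<^sub>R y + axis 1 1 :: real^2) / norm y" .
      have "norm (- (w $ 1) *\<^sub>R y + axis 1 1 :: real^2) > 0" using inverted_kernel_lower[OF w y(1)] by linarith
      then show ?thesis unfolding ker_def d q_def using y(2) by (subst ln_div) auto
    qed
    have i: "integrable M (\<lambda>w. ker ?y w * \<psi> w)" by (rule ker_phi_integrable[OF m B])
    have "(\<integral>w. q y w * \<psi> w \<partial>M) = (\<integral>w. ln (norm y) * \<psi> w - ker ?y w * \<psi> w \<partial>M)"
      by (intro Bochner_Integration.integral_cong) (auto simp: ker algebra_simps)
    also have "\<dots> = - pot \<psi> ?y" using i ipsi psi(3) by (simp add: pot_def)
    finally show ?thesis by (simp add: V_def v_def)
  qed
  show ?thesis by (rule that[OF 1 2 3 4 5 6 7])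
qed

definition rep :: "nat \<Rightarrow> nat \<Rightarrow> real^2" where
  "rep n j = (SOME w. w \<in> K \<and> idx n w = j)"

lemma rep:
  assumes "w \<in> K"
  shows "rep n (idx n w) \<in> K" "idx n (rep n (idx n w)) = idx n w"
proof -
  have "rep n (idx n w) \<in> K \<and> idx n (rep n (idx n w)) = idx n w"
    unfolding rep_def by (rule someI[of _ w]) (use assms in simp)
  then show "rep n (idx n w) \<in> K" "idx n (rep n (idx n w)) = idx n w" by auto
qed

lemma locally_constant_osc:
  assumes B: "\<And>w. w \<in> K \<Longrightarrow> \<bar>f w\<bar> \<le> B"
  shows "D.osc (2 * B * 4 ^ n) (1/4) (\<lambda>w. f (rep n (idx n w)))"
  unfolding D.osc_def
proof (intro allI ballI)
  fix m x y assume x: "x \<in> space M" and y: "y \<in> D.cyl m x"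
  then have K: "x \<in> K" "y \<in> K" by (auto simp: D.cyl_def)
  have B0: "B \<ge> 0" using B[OF K(1)] by linarith
  show "\<bar>f (rep n (idx n x)) - f (rep n (idx n y))\<bar> \<le> 2 * B * 4 ^ n * (1/4) ^ m"
  proof (cases "n \<le> m")
    case True
    then have "y \<in> D.cyl n x" using D.cyl_mono[OF x True] y by blast
    then show ?thesis using B0 by (simp add: D.cyl_def)
  next
    case False
    have "(1::real) = 4 ^ m * (1/4) ^ m" by (simp add: power_mult_distrib[symmetric])
    also have "\<dots> \<le> 4 ^ n * (1/4) ^ m" using False by (intro mult_right_mono power_increasing) auto
    finally have "2 * B * 1 \<le> 2 * B * (4 ^ n * (1/4) ^ m)" using B0 by (intro mult_left_mono) auto
    moreover have "\<bar>f (rep n (idx n x)) - f (rep n (idx n y))\<bar> \<le> 2 * B"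
      using B[OF rep(1)[OF K(1), of n]] B[OF rep(1)[OF K(2), of n]] by linarith
    ultimately show ?thesis by (simp add: mult.assoc)
  qed
qed

text \<open>The data are approximated uniformly by locally constant ones. As the densities \<open>\<Phi> y\<close> are nonnegative
  with integral one, the solutions, and their inversions near the origin, converge at the same rate.\<close>

theorem dirichlet_solution_ex:
  assumes f: "continuous_on K f"
  obtains u where "dirichlet_solution (- K) f u" "\<And>y. y \<notin> K \<Longrightarrow> u y = (\<integral>w. \<Phi> y w * f w \<partial>M)"
proof -
  have "bounded (f ` K)" using compact_continuous_image[OF f compact_K] compact_imp_bounded by blast
  then obtain B where "\<forall>v\<in>f ` K. norm v \<le> B" by (auto simp only: bounded_iff)
  then have B: "\<bar>f w\<bar> \<le> B" if "w \<in> K" for w using that by simp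
  have fm: "f \<in> borel_measurable M"
    using borel_measurable_continuous_on_restrict[OF f] measurable_cong_sets[OF sets_M refl] by blast
  have fi: "integrable M f" by (rule D.bounded_integrable[OF fm, of B]) (use B in simp)
  define g where "g n w = f (rep n (idx n w))" for n w
  define u where "u y = (if y \<in> K then f y else (\<integral>w. \<Phi> y w * f w \<partial>M))" for y
  have gosc: "D.osc (2 * B * 4 ^ n) (1/4) (g n)" for n
    unfolding g_def by (rule locally_constant_osc) (rule B)
  have gB: "\<bar>g n w\<bar> \<le> B" if "w \<in> K" for n w unfolding g_def by (rule B[OF rep(1)[OF that]])
  have gm: "g n \<in> borel_measurable M" for n by (rule D.osc_measurable[OF gosc]) auto
  have gi: "integrable M (g n)" for n by (rule D.osc_integrable[OF gosc]) auto
  define sol where "sol n v V \<longleftrightarrow> continuous_on UNIV v \<and> conjugable_on (- K) v \<and>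
    (\<forall>w\<in>K. v w = g n w) \<and> (\<forall>y. y \<notin> K \<longrightarrow> v y = (\<integral>w. \<Phi> y w * g n w \<partial>M)) \<and>
    conjugable_on (ball 0 (1/2)) V \<and> V 0 = (\<integral>w. g n w \<partial>M) \<and>
    (\<forall>y\<in>ball 0 (1/2). y \<noteq> 0 \<longrightarrow> V y = v (y /\<^sub>R (norm y)\<^sup>2))" for n v V
  have "\<exists>v V. sol n v V" for n
    by (rule regular_solution[OF gosc[of n]], rule exI, rule exI, unfold sol_def)
       (intro conjI ballI allI impI; assumption | simp)
  then obtain v V where sol: "\<And>n. sol n (v n) (V n)" by metis
  have v: "continuous_on UNIV (v n)" "conjugable_on (- K) (v n)"
    "w \<in> K \<Longrightarrow> v n w = g n w" "y \<notin> K \<Longrightarrow> v n y = (\<integral>w. \<Phi> y w * g n w \<partial>M)"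
    and V: "conjugable_on (ball 0 (1/2)) (V n)" "V n 0 = (\<integral>w. g n w \<partial>M)"
    "y \<in> ball 0 (1/2) \<Longrightarrow> y \<noteq> 0 \<Longrightarrow> V n y = v n (y /\<^sub>R (norm y)\<^sup>2)" for n w y
    using sol[of n] unfolding sol_def by simp_all
  have approx: "\<forall>\<^sub>F n in sequentially. \<forall>w\<in>K. \<bar>g n w - f w\<bar> \<le> e" if "e > 0" for e
  proof -
    have "uniformly_continuous_on K f" by (rule compact_uniformly_continuous[OF f compact_K])
    then obtain d where d: "d > 0" "\<And>w w'. w \<in> K \<Longrightarrow> w' \<in> K \<Longrightarrow> dist w' w < d \<Longrightarrow> dist (f w') (f w) < e"
      using \<open>e > 0\<close> unfolding uniformly_continuous_on_def by metis
    have "(\<lambda>n. 2 * r ^ n) \<longlonglongrightarrow> 2 * 0" by (intro tendsto_mult_left r_pow_tendsto_0)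
    then have "\<forall>\<^sub>F n in sequentially. 2 * r ^ n < d" using d(1) by (intro order_tendstoD(2)[of _ 0]) auto
    then show ?thesis
    proof eventually_elim
      case (elim n)
      show ?case
      proof
        fix w assume w: "w \<in> K"
        have "dist (rep n (idx n w)) w \<le> 2 * r ^ n" by (rule same_cell_dist[OF rep(1)[OF w] w rep(2)[OF w]])
        then have "dist (f (rep n (idx n w))) (f w) < e" using d(2)[OF w rep(1)[OF w]] elim by simp
        then show "\<bar>g n w - f w\<bar> \<le> e" by (simp add: g_def dist_real_def)
      qed
    qed
  qed
  have close: "\<bar>v n y - u y\<bar> \<le> e" if e: "\<forall>w\<in>K. \<bar>g n w - f w\<bar> \<le> e" for n y e
  proof (cases "y \<in> K")
    case True
    then show ?thesis using e v(3)[OF True] by (simp add: u_def)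
  next
    case False
    note Pi = Phi_integrable[OF False]
    have i1: "integrable M (\<lambda>w. \<Phi> y w * g n w)"
      by (rule D.times_bounded_integrable[OF Pi gm, of _ B]) (use gB in simp)
    have i2: "integrable M (\<lambda>w. \<Phi> y w * f w)"
      by (rule D.times_bounded_integrable[OF Pi fm, of B]) (use B in simp)
    have "v n y - u y = (\<integral>w. \<Phi> y w * g n w - \<Phi> y w * f w \<partial>M)"
      using i1 i2 False by (simp add: v(4) u_def)
    also have "\<bar>\<dots>\<bar> \<le> (\<integral>w. \<Phi> y w * e \<partial>M)"
    proof (rule order_trans[OF integral_abs_bound integral_mono])
      fix w assume "w \<in> space M"
      then have w: "w \<in> K" by simp
      have "\<bar>\<Phi> y w * g n w - \<Phi> y w * f w\<bar> = \<Phi> y w * \<bar>g n w - f w\<bar>"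
        using Phi_nonneg[OF False w] by (simp add: right_diff_distrib[symmetric] abs_mult)
      also have "\<dots> \<le> \<Phi> y w * e" using Phi_nonneg[OF False w] e w by (intro mult_left_mono) auto
      finally show "\<bar>\<Phi> y w * g n w - \<Phi> y w * f w\<bar> \<le> \<Phi> y w * e" .
    qed (use i1 i2 Pi in auto)
    finally show ?thesis using Phi_integral[OF False] by simp
  qed
  have unif: "uniform_limit UNIV v u sequentially"
  proof (rule uniform_limitI)
    fix e :: real assume "e > 0"
    then have "\<forall>\<^sub>F n in sequentially. \<forall>w\<in>K. \<bar>g n w - f w\<bar> \<le> e / 2" by (intro approx) simp
    then show "\<forall>\<^sub>F n in sequentially. \<forall>y\<in>UNIV. dist (v n y) (u y) < e"
    proof eventually_elim
      case (elim n)
      then show ?case using close[OF elim] \<open>e > 0\<close>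
        by (auto simp: dist_real_def intro: le_less_trans[of _ "e / 2"])
    qed
  qed
  have cont: "continuous_on UNIV u"
    by (rule uniform_limit_theorem[OF _ unif]) (use v(1) in auto)
  have conj: "conjugable_on (- K) u"
    by (rule conjugable_on_uniform_limit[OF v(2)]) (rule uniform_limit_on_subset[OF unif], simp)
  define W where "W y = (if y = 0 then (\<integral>w. f w \<partial>M) else u (y /\<^sub>R (norm y)\<^sup>2))" for y
  have "conjugable_on (ball 0 (1/2)) W"
  proof (rule conjugable_on_uniform_limit[OF V(1)])
    fix D assume D: "compact D" "D \<subseteq> ball (0::real^2) (1/2)"
    show "uniform_limit D V W sequentially"
    proof (rule uniform_limitI)
      fix e :: real assume "e > 0"
      then have "\<forall>\<^sub>F n in sequentially. \<forall>w\<in>K. \<bar>g n w - f w\<bar> \<le> e / 2" by (intro approx) simp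
      then show "\<forall>\<^sub>F n in sequentially. \<forall>y\<in>D. dist (V n y) (W y) < e"
      proof eventually_elim
        case (elim n)
        have "\<bar>(\<integral>w. g n w \<partial>M) - (\<integral>w. f w \<partial>M)\<bar> \<le> e / 2"
        proof -
          have "(\<integral>w. g n w \<partial>M) - (\<integral>w. f w \<partial>M) = (\<integral>w. g n w - f w \<partial>M)" using gi fi by simp
          also have "\<bar>\<dots>\<bar> \<le> (\<integral>w. e / 2 \<partial>M)"
            by (rule order_trans[OF integral_abs_bound integral_mono]) (use elim gi fi in auto)
          finally show ?thesis using M.prob_space by simp
        qed
        then have "\<bar>V n y - W y\<bar> \<le> e / 2" if "y \<in> D" for y
          using close[OF elim, of "y /\<^sub>R (norm y)\<^sup>2"] V(2)[of n] V(3)[of y n] that D(2)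
          by (auto simp: W_def)
        then show ?case using \<open>e > 0\<close> by (auto simp: dist_real_def intro: le_less_trans[of _ "e / 2"])
      qed
    qed
  qed
  then have "harmonic_on (ball 0 (1/2)) W" by (rule conjugable_on_imp_harmonic_on)
  then have "harmonic_at_infinity u"
    unfolding harmonic_at_infinity_def by (intro exI[of _ "1/2"] exI[of _ W] conjI) (auto simp: W_def)
  moreover have "bounded (u ` (- K))"
  proof -
    have "\<bar>u y\<bar> \<le> B" if y: "y \<notin> K" for y
    proof -
      have i2: "integrable M (\<lambda>w. \<Phi> y w * f w)"
        by (rule D.times_bounded_integrable[OF Phi_integrable[OF y] fm, of B]) (use B in simp)
      have "\<bar>\<integral>w. \<Phi> y w * f w \<partial>M\<bar> \<le> (\<integral>w. \<Phi> y w * B \<partial>M)"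
      proof (rule order_trans[OF integral_abs_bound integral_mono])
        fix w assume "w \<in> space M"
        then show "\<bar>\<Phi> y w * f w\<bar> \<le> \<Phi> y w * B"
          using Phi_nonneg[OF y, of w] B[of w] by (simp add: abs_mult mult_left_mono)
      qed (use i2 Phi_integrable[OF y] in auto)
      then show ?thesis using Phi_integral[OF y] y by (simp add: u_def)
    qed
    then show ?thesis unfolding bounded_iff by auto
  qed
  ultimately have "dirichlet_solution (- K) f u"
    unfolding dirichlet_solution_def frontier_compl_K closure_compl_K
    using cont conjugable_on_imp_harmonic_on[OF conj] by (auto simp: u_def)
  then show ?thesis by (rule that) (simp add: u_def)
qed

lemma dirichlet_solution_unique:
  assumes u: "dirichlet_solution (- K) f u" and v: "dirichlet_solution (- K) f v" and y: "y \<notin> K"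
  shows "u y = v y"
proof -
  have le: "u y \<le> v y" if u: "dirichlet_solution (- K) f u" and v: "dirichlet_solution (- K) f v" for u v
  proof -
    note d = u[unfolded dirichlet_solution_def frontier_compl_K closure_compl_K]
      v[unfolded dirichlet_solution_def frontier_compl_K closure_compl_K]
    obtain Bu where Bu: "\<forall>z\<in>u ` (- K). norm z \<le> Bu" using d(1) by (auto simp only: bounded_iff)
    obtain Bv where Bv: "\<forall>z\<in>v ` (- K). norm z \<le> Bv" using d(2) by (auto simp only: bounded_iff)
    have "1 * u y + (- 1) * v y \<le> 0"
    proof (rule bounded_maximum_principle[OF open_compl_K])
      show "harmonic_on (- K) (\<lambda>y. 1 * u y + (- 1) * v y)" using d by (intro harmonic_on_lin) auto
      show "continuous_on (closure (- K)) (\<lambda>y. 1 * u y + (- 1) * v y)"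
        unfolding closure_compl_K using d by (intro continuous_intros) auto
      show "1 * u p + (- 1) * v p \<le> 0" if "p \<in> frontier (- K)" for p
        using that d unfolding frontier_compl_K by auto
      show "1 * u p + (- 1) * v p \<le> Bu + Bv" if "p \<in> - K" for p
      proof -
        have "\<bar>u p\<bar> \<le> Bu" "\<bar>v p\<bar> \<le> Bv" using Bu Bv that by auto
        then show ?thesis by linarith
      qed
    qed (use y in auto)
    then show ?thesis by simp
  qed
  show ?thesis using le[OF u v] le[OF v u] by simp
qed

definition harm_measure :: "real^2 \<Rightarrow> (real^2) measure" where
  "harm_measure x = density M (\<lambda>w. ennreal (\<Phi> x w))"

lemma harm_measure_is_harmonic_measure:
  assumes x: "x \<notin> K"
  shows "is_harmonic_measure (- K) x (harm_measure x)"
  unfolding is_harmonic_measure_def frontier_compl_K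
proof (intro conjI allI impI)
  note [measurable] = Phi_measurable[OF x]
  show "prob_space (harm_measure x)"
  proof (rule prob_spaceI)
    have "emeasure (harm_measure x) (space (harm_measure x)) = (\<integral>\<^sup>+w. ennreal (\<Phi> x w) * indicator (space M) w \<partial>M)"
      unfolding harm_measure_def space_density by (rule emeasure_density) (use sets.top in measurable)
    also have "\<dots> = (\<integral>\<^sup>+w. ennreal (\<Phi> x w) \<partial>M)"
      by (intro nn_integral_cong) (simp add: indicator_def)
    also have "\<dots> = ennreal (\<integral>w. \<Phi> x w \<partial>M)"
      by (rule nn_integral_eq_integral[OF Phi_integrable[OF x]]) (use Phi_nonneg[OF x] in auto)
    finally show "emeasure (harm_measure x) (space (harm_measure x)) = 1" using Phi_integral[OF x] by simp
  qed
  show "sets (harm_measure x) = sets (restrict_space borel K)" by (simp add: harm_measure_def sets_M)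
  fix f :: "real^2 \<Rightarrow> real" assume f: "continuous_on K f"
  obtain u where u: "dirichlet_solution (- K) f u" "\<And>y. y \<notin> K \<Longrightarrow> u y = (\<integral>w. \<Phi> y w * f w \<partial>M)"
    by (rule dirichlet_solution_ex[OF f]) (rule that)
  have [measurable]: "f \<in> borel_measurable M"
    using borel_measurable_continuous_on_restrict[OF f] measurable_cong_sets[OF sets_M refl] by blast
  have "(\<integral>z. f z \<partial>harm_measure x) = (\<integral>w. \<Phi> x w * f w \<partial>M)"
    unfolding harm_measure_def by (subst integral_density) (use Phi_nonneg[OF x] in auto)
  then show "\<exists>u. dirichlet_solution (- K) f u \<and> u x = (\<integral>z. f z \<partial>harm_measure x)"
    using u x by metis
qed

section \<open>Uniqueness of the Green function and of harmonic measure\<close>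

text \<open>In the difference the logarithmic poles cancel, and the maximum principle applies on the whole
  complement.\<close>

lemma green_function_le:
  assumes G1: "is_green_function (- K) x G1" and G2: "is_green_function (- K) x G2"
    and x: "x \<notin> K" and y: "y \<notin> K" "y \<noteq> x"
  shows "G1 y \<le> G2 y"
proof -
  note d1 = G1[unfolded is_green_function_def frontier_compl_K closure_compl_K]
  note d2 = G2[unfolded is_green_function_def frontier_compl_K closure_compl_K]
  obtain h1 where h1: "harmonic_on (- K) h1" "\<forall>y\<in>- K - {x}. G1 y = - (1 / (2 * pi)) * ln (dist y x) + h1 y"
    using d1 by (elim conjE exE) (rule that)
  obtain h2 where h2: "harmonic_on (- K) h2" "\<forall>y\<in>- K - {x}. G2 y = - (1 / (2 * pi)) * ln (dist y x) + h2 y"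
    using d2 by (elim conjE exE) (rule that)
  obtain R1 B1 where R1: "\<forall>y\<in>- K. norm y \<ge> R1 \<longrightarrow> \<bar>G1 y\<bar> \<le> B1" using d1 by (elim conjE exE) (rule that)
  obtain R2 B2 where R2: "\<forall>y\<in>- K. norm y \<ge> R2 \<longrightarrow> \<bar>G2 y\<bar> \<le> B2" using d2 by (elim conjE exE) (rule that)
  have c: "continuous_on (UNIV - {x}) G1" "continuous_on (UNIV - {x}) G2" using d1 d2 by auto
  have z: "G1 w = 0" "G2 w = 0" if "w \<in> K" for w using d1 d2 that by auto
  define w where "w y = (if y \<in> K then 0 else h1 y - h2 y)" for y
  have w_eq: "w y = G1 y - G2 y" if "y \<noteq> x" for y
    using that h1(2) h2(2) z[of y] by (auto simp: w_def)
  have harm: "harmonic_on (- K) w"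
    by (rule harmonic_on_cong[OF harmonic_on_lin[OF h1(1) h2(1), of 1 "- 1"]]) (simp add: w_def)
  have "continuous_on (UNIV - {x}) (\<lambda>y. G1 y - G2 y)" using c by (intro continuous_intros)
  then have "continuous_on (UNIV - {x}) w"
    by (rule continuous_on_eq) (simp add: w_eq)
  then have "continuous_on ((UNIV - {x}) \<union> - K) w"
    using harmonic_on_imp_continuous_on[OF harm] open_compl_K
    by (intro continuous_on_open_Un) (auto intro: open_Diff)
  moreover have "(UNIV - {x}) \<union> - K = UNIV" using x by auto
  ultimately have cont: "continuous_on UNIV w" by simp
  define R where "R = max (max R1 R2) (norm x + 1)"
  have "compact (w ` cball 0 R)" by (intro compact_continuous_image continuous_on_subset[OF cont]) auto
  then have "bounded (w ` cball 0 R)" by (rule compact_imp_bounded)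
  then obtain B where B: "\<forall>v\<in>w ` cball 0 R. norm v \<le> B" by (auto simp only: bounded_iff)
  have "w y \<le> 0"
  proof (rule bounded_maximum_principle[OF open_compl_K _ harm])
    show "continuous_on (closure (- K)) w" using cont by (simp add: closure_compl_K)
    show "w p \<le> 0" if "p \<in> frontier (- K)" for p
      using that unfolding frontier_compl_K by (simp add: w_def)
    show "w p \<le> max B (B1 + B2)" if p: "p \<in> - K" for p
    proof (cases "norm p \<le> R")
      case True
      then have "\<bar>w p\<bar> \<le> B" using B by auto
      then show ?thesis by linarith
    next
      case False
      then have "norm p \<ge> R1" "norm p \<ge> R2" "p \<noteq> x" by (auto simp: R_def)
      then have "\<bar>G1 p\<bar> \<le> B1" "\<bar>G2 p\<bar> \<le> B2" using R1 R2 p by auto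
      then show ?thesis using w_eq[OF \<open>p \<noteq> x\<close>] by linarith
    qed
  qed (use y in auto)
  then show ?thesis using w_eq[OF y(2)] by simp
qed

lemma green_function_unique:
  assumes "is_green_function (- K) x G1" "is_green_function (- K) x G2" "x \<notin> K" "y \<notin> K" "y \<noteq> x"
  shows "G1 y = G2 y"
  using green_function_le[OF assms] green_function_le[OF assms(2,1,3,4,5)] by (rule antisym)

definition cylinder :: "nat \<Rightarrow> nat \<Rightarrow> (real^2) set" where
  "cylinder n j = {w \<in> K. idx n w = j}"

lemma cylinder_sets: "cylinder n j \<in> sets M"
  unfolding cylinder_def by (rule idx_cylinder_sets)

lemma cylinder_emeasure: "cylinder n j \<noteq> {} \<Longrightarrow> emeasure M (cylinder n j) = ennreal (1 / 2 ^ n)"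
  using idx_prob[of j n] idx_props(1) by (auto simp: cylinder_def M.emeasure_eq_measure)

text \<open>The maximal cylinders of level at least \<open>m\<close> inside \<open>S\<close>, enumerated through pairs of a level and a
  number; the remaining indices give the empty set.\<close>

definition piece :: "nat \<Rightarrow> (real^2) set \<Rightarrow> nat \<Rightarrow> (real^2) set" where
  "piece m S i = (let (n, j) = prod_decode i in
     if m \<le> n \<and> cylinder n j \<subseteq> S \<and> (n = m \<or> \<not> cylinder (n - 1) (j div 2) \<subseteq> S) then cylinder n j else {})"

lemma piece_cases:
  assumes "w \<in> piece m S i"
  obtains n where "m \<le> n" "i = prod_encode (n, idx n w)" "w \<in> K" "piece m S i = cylinder n (idx n w)" "cylinder n (idx n w) \<subseteq> S"
    "n = m \<or> \<not> cylinder (n - 1) (idx (n - 1) w) \<subseteq> S"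
proof -
  obtain n j where nj: "prod_decode i = (n, j)" by (cases "prod_decode i")
  then have i: "i = prod_encode (n, j)" by (metis prod_decode_inverse)
  have *: "m \<le> n" "cylinder n j \<subseteq> S" "n = m \<or> \<not> cylinder (n - 1) (j div 2) \<subseteq> S" "piece m S i = cylinder n j"
    using assms nj by (auto simp: piece_def split: if_splits)
  then have w: "w \<in> K" "idx n w = j" using assms by (auto simp: cylinder_def)
  have "n = m \<or> \<not> cylinder (n - 1) (idx (n - 1) w) \<subseteq> S"
  proof (cases "n = m")
    case False
    then have "j div 2 = idx (n - 1) w"
      using idx_Suc_div[OF w(1), of "n - 1"] w(2) *(1) by (cases n) auto
    then show ?thesis using *(3) by simp
  qed simp
  then show ?thesis using that[of n, OF *(1) _ w(1)] * w(2) i by simp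
qed

lemma idx_mono:
  assumes "v \<in> K" "w \<in> K" "idx n v = idx n w" "m \<le> n"
  shows "idx m v = idx m w"
  using D.cyl_mono[of w m n] assms by (auto simp: D.cyl_def)

lemma piece_disjoint: "disjoint_family (piece m S)"
  unfolding disjoint_family_on_def
proof (intro ballI impI)
  fix i i' :: nat assume "i \<noteq> i'"
  show "piece m S i \<inter> piece m S i' = {}"
  proof (rule ccontr)
    assume "piece m S i \<inter> piece m S i' \<noteq> {}"
    then obtain w where w: "w \<in> piece m S i" "w \<in> piece m S i'" by blast
    obtain n where n: "m \<le> n" "i = prod_encode (n, idx n w)" "w \<in> K" "cylinder n (idx n w) \<subseteq> S"
      "n = m \<or> \<not> cylinder (n - 1) (idx (n - 1) w) \<subseteq> S"
      using piece_cases[OF w(1)] by metis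
    obtain n' where n': "m \<le> n'" "i' = prod_encode (n', idx n' w)" "cylinder n' (idx n' w) \<subseteq> S"
      "n' = m \<or> \<not> cylinder (n' - 1) (idx (n' - 1) w) \<subseteq> S"
      using piece_cases[OF w(2)] by metis
    have lt: False if "k < l" "m \<le> k" "cylinder k (idx k w) \<subseteq> S" "l = m \<or> \<not> cylinder (l - 1) (idx (l - 1) w) \<subseteq> S" for k l
    proof -
      have "cylinder (l - 1) (idx (l - 1) w) \<subseteq> cylinder k (idx k w)"
        using that(1) idx_mono[OF _ n(3), of _ "l - 1" k] by (auto simp: cylinder_def)
      then show False using that by auto
    qed
    have "n \<noteq> n'" using \<open>i \<noteq> i'\<close> n(2) n'(2) by auto
    then show False using lt[of n n'] lt[of n' n] n n' by linarith
  qed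
qed

lemma piece_Union:
  assumes S: "open S"
  shows "(\<Union>i. piece m S i) = S \<inter> K"
proof (intro equalityI subsetI)
  fix w assume "w \<in> (\<Union>i. piece m S i)"
  then obtain i where i: "w \<in> piece m S i" by blast
  then obtain n where "w \<in> K" "piece m S i = cylinder n (idx n w)" "cylinder n (idx n w) \<subseteq> S" by (rule piece_cases)
  then show "w \<in> S \<inter> K" using i by auto
next
  fix w assume "w \<in> S \<inter> K"
  then have w: "w \<in> S" "w \<in> K" by auto
  obtain e where e: "e > 0" "ball w e \<subseteq> S" using S w(1) openE by metis
  have "(\<lambda>n. 2 * r ^ n) \<longlonglongrightarrow> 2 * 0" by (intro tendsto_mult_left r_pow_tendsto_0)
  then have "\<forall>\<^sub>F n in sequentially. 2 * r ^ n < e" using e(1) by (intro order_tendstoD(2)[of _ 0]) auto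
  then have "\<forall>\<^sub>F n in sequentially. 2 * r ^ n < e \<and> m \<le> n" by (intro eventually_conj eventually_ge_at_top)
  then obtain k where k: "2 * r ^ k < e" "m \<le> k" by (auto simp: eventually_sequentially)
  let ?P = "\<lambda>n. m \<le> n \<and> cylinder n (idx n w) \<subseteq> S"
  have "cylinder k (idx k w) \<subseteq> ball w e"
    using same_cell_dist[OF w(2), of _ k] k(1) by (force simp: cylinder_def)
  then have "?P k" using e k by auto
  define n where "n = (LEAST n. ?P n)"
  have n: "?P n" unfolding n_def by (rule LeastI[of ?P, OF \<open>?P k\<close>])
  have n2: "n = m \<or> \<not> cylinder (n - 1) (idx n w div 2) \<subseteq> S"
  proof (rule disjCI, rule ccontr)
    assume "\<not> \<not> cylinder (n - 1) (idx n w div 2) \<subseteq> S" "n \<noteq> m"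
    then have nm: "n - 1 < n" "m \<le> n - 1" using n by auto
    moreover have "idx n w div 2 = idx (n - 1) w" using idx_Suc_div[OF w(2), of "n - 1"] nm by simp
    ultimately show False using not_less_Least[of "n - 1" ?P] \<open>\<not> \<not> cylinder (n - 1) (idx n w div 2) \<subseteq> S\<close>
      by (simp add: n_def[symmetric])
  qed
  have "piece m S (prod_encode (n, idx n w)) = cylinder n (idx n w)" using n n2 by (simp add: piece_def)
  moreover have "w \<in> cylinder n (idx n w)" using w by (simp add: cylinder_def)
  ultimately show "w \<in> (\<Union>i. piece m S i)" by blast
qed

lemma piece_sets: "piece m S i \<in> sets M"
  using cylinder_sets by (auto simp: piece_def Let_def split: prod.splits)

lemma cylinder_indicator_continuous: "continuous_on K (indicator (cylinder n j) :: real^2 \<Rightarrow> real)"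
  unfolding continuous_on_iff
proof (intro ballI allI impI)
  fix w and e :: real assume w: "w \<in> K" and e: "e > 0"
  have idx_eq: "idx n v = idx n w" if v: "v \<in> K" "dist v w < r ^ n / 2" for v
  proof (rule ccontr)
    assume ne: "idx n v \<noteq> idx n w"
    then have "v \<noteq> w" by auto
    then obtain m where m: "v \<in> D.ring m w" using D.ring_ex[of w v] v w by auto
    have "m < n" using ne D.ring_in_cyl[of w v m n] m w v by (auto simp: D.cyl_def)
    then have "r ^ n \<le> r ^ m" using r_small by (intro power_decreasing) auto
    then show False using ring_dist(1)[OF w m] v(2) zero_less_power[OF r_pos, of m]
      unfolding dist_commute[of v w] by linarith
  qed
  have "indicator (cylinder n j) v = (indicator (cylinder n j) w :: real)" if v: "v \<in> K" "dist v w < r ^ n / 2" for v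
  proof -
    have "v \<in> cylinder n j \<longleftrightarrow> w \<in> cylinder n j" using idx_eq[OF v] v(1) w by (simp add: cylinder_def)
    then show ?thesis by (simp add: indicator_def)
  qed
  then show "\<exists>d>0. \<forall>v\<in>K. dist v w < d \<longrightarrow> dist (indicator (cylinder n j) v :: real) (indicator (cylinder n j) w) < e"
    using e by (intro exI[of _ "r ^ n / 2"]) auto
qed

text \<open>The indicator function of a cylinder is continuous on the set. So uniqueness for the Dirichlet problem
  determines the mass of every cylinder, and open sets are disjoint unions of cylinders.\<close>

lemma harmonic_measure_unique:
  assumes om: "is_harmonic_measure (- K) x \<omega>" and x: "x \<notin> K"
  shows "\<omega> = harm_measure x"
proof -
  have h: "is_harmonic_measure (- K) x (harm_measure x)" by (rule harm_measure_is_harmonic_measure[OF x])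
  have sets: "sets \<omega> = sets M" "sets (harm_measure x) = sets M"
    using om h by (auto simp: is_harmonic_measure_def sets_M frontier_compl_K simp del: frontier_complement)
  have sp: "space \<omega> = K" "space (harm_measure x) = K"
    using sets_eq_imp_space_eq[OF sets(1)] sets_eq_imp_space_eq[OF sets(2)] by auto
  interpret o: prob_space \<omega> using om by (simp add: is_harmonic_measure_def)
  interpret h: prob_space "harm_measure x" using h by (simp add: is_harmonic_measure_def)
  have cylinder_eq: "emeasure \<omega> (cylinder n j) = emeasure (harm_measure x) (cylinder n j)" for n j
  proof -
    have c: "continuous_on (frontier (- K)) (indicator (cylinder n j) :: real^2 \<Rightarrow> real)"
      unfolding frontier_compl_K by (rule cylinder_indicator_continuous)
    obtain u where u: "dirichlet_solution (- K) (indicator (cylinder n j)) u" "u x = (\<integral>z. indicator (cylinder n j) z \<partial>\<omega>)"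
      using om c unfolding is_harmonic_measure_def by blast
    obtain v where v: "dirichlet_solution (- K) (indicator (cylinder n j)) v" "v x = (\<integral>z. indicator (cylinder n j) z \<partial>harm_measure x)"
      using h c unfolding is_harmonic_measure_def by blast
    have "cylinder n j \<inter> K = cylinder n j" by (auto simp: cylinder_def)
    then have "measure \<omega> (cylinder n j) = measure (harm_measure x) (cylinder n j)"
      using dirichlet_solution_unique[OF u(1) v(1) x] u(2) v(2) sp by simp
    then show ?thesis by (simp add: o.emeasure_eq_measure h.emeasure_eq_measure)
  qed
  have piece_eq: "emeasure \<omega> (piece 0 S i) = emeasure (harm_measure x) (piece 0 S i)" for S i
    by (auto simp: piece_def Let_def cylinder_eq split: prod.splits)
  have open_eq: "emeasure \<omega> (S \<inter> K) = emeasure (harm_measure x) (S \<inter> K)" if S: "open S" for S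
  proof -
    have "emeasure \<omega> (S \<inter> K) = (\<Sum>i. emeasure \<omega> (piece 0 S i))"
      unfolding piece_Union[OF S, of 0, symmetric]
      by (rule suminf_emeasure[symmetric]) (auto simp: sets piece_sets piece_disjoint)
    also have "\<dots> = (\<Sum>i. emeasure (harm_measure x) (piece 0 S i))" by (simp add: piece_eq)
    also have "\<dots> = emeasure (harm_measure x) (S \<inter> K)"
      unfolding piece_Union[OF S, of 0, symmetric]
      by (rule suminf_emeasure) (auto simp: sets piece_sets piece_disjoint)
    finally show ?thesis .
  qed
  have id: "(\<lambda>w. w) \<in> N \<rightarrow>\<^sub>M borel" if "sets N = sets M" for N :: "(real^2) measure"
    using id_measurable_M measurable_cong_sets[OF that refl] by blast
  have em: "emeasure (distr N borel (\<lambda>w. w)) A = emeasure N (A \<inter> K)"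
    if "sets N = sets M" "A \<in> sets borel" for N A
    using emeasure_distr[OF id[OF that(1)] that(2)] sets_eq_imp_space_eq[OF that(1)] by simp
  have "distr \<omega> borel (\<lambda>w. w) = distr (harm_measure x) borel (\<lambda>w. w)"
  proof (rule measure_eqI_generator_eq[where \<Omega> = UNIV and E = "{S. open S}" and A = "\<lambda>_. UNIV"])
    show "Int_stable {S :: (real^2) set. open S}" by (auto simp: Int_stable_def)
    show "emeasure (distr \<omega> borel (\<lambda>w. w)) S = emeasure (distr (harm_measure x) borel (\<lambda>w. w)) S" if "S \<in> {S. open S}" for S
      using that em[OF sets(1), of S] em[OF sets(2), of S] open_eq[of S] by auto
    show "emeasure (distr \<omega> borel (\<lambda>w. w)) UNIV \<noteq> \<infinity>" for i :: nat
      using em[OF sets(1), of UNIV] by (simp add: o.emeasure_eq_measure)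
  qed (auto simp: borel_def)
  then have D: "emeasure \<omega> (A \<inter> K) = emeasure (harm_measure x) (A \<inter> K)" if "A \<in> sets borel" for A
    using em[OF sets(1) that] em[OF sets(2) that] by simp
  show ?thesis
  proof (rule measure_eqI)
    show "sets \<omega> = sets (harm_measure x)" using sets by simp
    fix A assume "A \<in> sets \<omega>"
    then obtain A' where "A' \<in> sets borel" "A = K \<inter> A'" using sets sets_M by (auto simp: sets_restrict_space)
    then show "emeasure \<omega> A = emeasure (harm_measure x) A" using D[of A'] by (simp add: Int_commute)
  qed
qed

section \<open>Ahlfors regularity and Hausdorff measure\<close>

lemma two_powr_delta: "2 powr \<delta> \<le> 2"
  using powr_mono[of \<delta> 1 2] delta_le by simp

lemma borel_subset_sets_M: "A \<in> sets borel \<Longrightarrow> K \<inter> A \<in> sets M"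
  by (auto simp: sets_M sets_restrict_space)

lemma ball_mass_upper:
  assumes x: "x \<in> K" and rho: "\<rho> > 0"
  shows "emeasure M (K \<inter> cball x \<rho>) \<le> ennreal (2 * \<rho> powr \<delta>)"
proof -
  have double: "(2 * \<rho>) powr \<delta> \<le> 2 * \<rho> powr \<delta>"
    using two_powr_delta rho by (simp add: powr_mult mult_right_mono)
  have "measure M (K \<inter> cball x \<rho>) \<le> 2 * \<rho> powr \<delta>"
  proof (cases "2 * \<rho> \<le> 1")
    case True
    obtain n where n: "r ^ Suc n < 2 * \<rho>" "2 * \<rho> \<le> r ^ n" using scale_ex[of "2 * \<rho>"] rho True by auto
    have "K \<inter> cball x \<rho> \<subseteq> D.cyl (Suc n) x"
    proof
      fix w assume w: "w \<in> K \<inter> cball x \<rho>"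
      show "w \<in> D.cyl (Suc n) x"
      proof (cases "w = x")
        case False
        then obtain m where m: "w \<in> D.ring m x" using D.ring_ex[of x w] x w by auto
        have "n < m"
        proof (rule ccontr)
          assume "\<not> n < m"
          then have "r ^ n \<le> r ^ m" using r_small by (intro power_decreasing) auto
          moreover have "dist x w \<le> \<rho>" using w by simp
          ultimately show False using ring_dist(1)[OF x m] n zero_less_power[OF r_pos, of m] by linarith
        qed
        then show ?thesis using D.ring_in_cyl[of x w m "Suc n"] m x by simp
      qed (use x D.cyl_self in simp)
    qed
    then have "measure M (K \<inter> cball x \<rho>) \<le> measure M (D.cyl (Suc n) x)"
      by (rule M.finite_measure_mono) (rule D.cyl_sets)
    also have "\<dots> = 1 / 2 ^ Suc n" using D.prob_cyl[of x "Suc n"] x by simp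
    also have "\<dots> \<le> (2 * \<rho>) powr \<delta>" by (rule powr_scale(2)[OF n])
    finally show ?thesis using double by linarith
  next
    case False
    have "measure M (K \<inter> cball x \<rho>) \<le> 1" by (rule M.prob_le_1)
    also have "1 \<le> (2 * \<rho>) powr \<delta>" using False delta_pos by (intro ge_one_powr_ge_zero) auto
    finally show ?thesis using double by linarith
  qed
  then show ?thesis by (simp add: M.emeasure_eq_measure ennreal_leI)
qed

lemma ball_mass_lower:
  assumes x: "x \<in> K" and rho: "\<rho> > 0" "\<rho> \<le> 2"
  shows "ennreal (\<rho> powr \<delta> / 4) \<le> emeasure M (K \<inter> ball x \<rho>)"
proof -
  obtain n where n: "r ^ Suc n < \<rho> / 2" "\<rho> / 2 \<le> r ^ n" using scale_ex[of "\<rho> / 2"] rho by auto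
  have "\<rho> powr \<delta> = 2 powr \<delta> * (\<rho> / 2) powr \<delta>" using rho by (simp add: powr_mult[symmetric])
  also have "\<dots> \<le> 2 * (1 / 2 ^ n)" using two_powr_delta powr_scale(1)[OF n] by (intro mult_mono) auto
  finally have "\<rho> powr \<delta> / 4 \<le> 1 / 2 ^ Suc n" by simp
  also have "\<dots> = measure M (D.cyl (Suc n) x)" using D.prob_cyl[of x "Suc n"] x by simp
  also have "\<dots> \<le> measure M (K \<inter> ball x \<rho>)"
  proof (rule M.finite_measure_mono)
    show "D.cyl (Suc n) x \<subseteq> K \<inter> ball x \<rho>"
    proof
      fix w assume w: "w \<in> D.cyl (Suc n) x"
      then have "dist x w < \<rho>" using cyl_dist[OF x w] n(1) by linarith
      moreover have "w \<in> K" using w by (simp add: D.cyl_def)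
      ultimately show "w \<in> K \<inter> ball x \<rho>" by simp
    qed
  qed (rule borel_subset_sets_M, simp)
  finally show ?thesis by (simp add: M.emeasure_eq_measure ennreal_leI)
qed

theorem K_ahlfors_regular: "ahlfors_regular \<delta> K"
  unfolding ahlfors_regular_def
proof (intro conjI)
  show "compact K" by (rule compact_K)
  show "\<delta> > 0" by (rule delta_pos)
  obtain w0 where w0: "w0 \<in> space M" "idx 1 w0 = 0" by (rule D.block_ex[of 0 1]) simp
  obtain w1 where w1: "w1 \<in> space M" "idx 1 w1 = 1" by (rule D.block_ex[of 1 1]) simp
  have "w0 \<noteq> w1" using w0(2) w1(2) by auto
  then show "\<exists>x\<in>K. \<exists>y\<in>K. x \<noteq> y" using w0(1) w1(1) by auto
  have diam: "diameter K \<le> 2"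
  proof (rule diameter_le)
    fix x y assume "x \<in> K" "y \<in> K"
    then have "dist x y \<le> 2" using same_cell_dist[of x y 0] idx_props(1)[of x 0] idx_props(1)[of y 0] by simp
    then show "norm (x - y) \<le> 2" by (simp add: dist_norm)
  qed simp
  show "\<exists>(\<mu> :: (real^2) measure) C\<^sub>0 :: real.
        sets \<mu> = sets (restrict_space borel K) \<and> C\<^sub>0 \<ge> 1 \<and>
        (\<forall>x\<in>K. \<forall>\<rho>. 0 < \<rho> \<and> \<rho> \<le> diameter K \<longrightarrow>
           ennreal (\<rho> powr \<delta> / C\<^sub>0) \<le> emeasure \<mu> (ball x \<rho> \<inter> K) \<and>
           emeasure \<mu> (ball x \<rho> \<inter> K) \<le> ennreal (C\<^sub>0 * \<rho> powr \<delta>))"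
  proof (intro exI[of _ M] exI[of _ 4] conjI ballI allI impI)
    fix x \<rho> assume x: "x \<in> K" and rho: "0 < \<rho> \<and> \<rho> \<le> diameter K"
    show "ennreal (\<rho> powr \<delta> / 4) \<le> emeasure M (ball x \<rho> \<inter> K)"
      using ball_mass_lower[OF x, of \<rho>] rho diam by (simp add: Int_commute)
    have "emeasure M (ball x \<rho> \<inter> K) \<le> emeasure M (K \<inter> cball x \<rho>)"
      by (intro emeasure_mono borel_subset_sets_M) auto
    also have "\<dots> \<le> ennreal (2 * \<rho> powr \<delta>)" using ball_mass_upper[OF x] rho by simp
    also have "\<dots> \<le> ennreal (4 * \<rho> powr \<delta>)" by (intro ennreal_leI mult_right_mono) auto
    finally show "emeasure M (ball x \<rho> \<inter> K) \<le> ennreal (4 * \<rho> powr \<delta>)" .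
  qed (auto simp: sets_M)
qed

lemma ennreal_half_le:
  fixes a b :: ennreal
  assumes "ennreal (1/2) * a \<le> b"
  shows "a \<le> ennreal 2 * b"
proof -
  have "ennreal 2 * (ennreal (1/2) * a) = a"
    by (simp add: mult.assoc[symmetric] ennreal_mult[symmetric] del: ennreal_half ennreal_numeral)
  then show ?thesis using mult_left_mono[OF assms, of "ennreal 2"] by simp
qed

text \<open>The mass distribution principle: a set of diameter \<open>d\<close> that meets the Cantor set has mass at
  most \<open>2 * d powr \<delta>\<close>.\<close>

lemma mass_le_hausdorff:
  assumes A: "A \<in> sets M"
  shows "emeasure M A \<le> ennreal 2 * hausdorff_measure \<delta> A"
proof -
  have "ennreal (1/2) * emeasure M A \<le> hausdorff_pre \<delta> 1 A"
    unfolding hausdorff_pre_def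
  proof (rule INF_greatest)
    fix Us assume "Us \<in> {Us :: nat \<Rightarrow> (real^2) set. A \<subseteq> (\<Union>i. Us i) \<and> (\<forall>i. bounded (Us i) \<and> diameter (Us i) \<le> 1)}"
    then have U: "A \<subseteq> (\<Union>i. Us i)" "\<And>i. bounded (Us i)" by auto
    define c where "c i = (SOME x. x \<in> Us i \<inter> K)" for i
    define V where "V i = (if Us i \<inter> K = {} then {} else K \<inter> cball (c i) (diameter (Us i)))" for i
    have c: "c i \<in> Us i" "c i \<in> K" if "Us i \<inter> K \<noteq> {}" for i
      using some_in_eq[of "Us i \<inter> K"] that by (auto simp: c_def)
    have V_sets: "V i \<in> sets M" for i by (auto simp: V_def intro: borel_subset_sets_M)
    have V_mass: "emeasure M (V i) \<le> ennreal 2 * ennreal (diameter (Us i) powr \<delta>)" for i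
    proof (cases "Us i \<inter> K = {}")
      case False
      show ?thesis
      proof (cases "diameter (Us i) = 0")
        case True
        have "V i = {c i}" using c[OF False] False True by (auto simp: V_def)
        moreover have "emeasure M {c i} = 0"
        proof -
          have ci: "c i \<in> space M" using c(2)[OF False] by simp
          have "{c i} \<in> null_sets M"
            using AE_iff_null_sets[OF D.singleton_sets[OF ci]] D.AE_neq[OF ci] by simp
          then show ?thesis by (rule null_setsD1)
        qed
        ultimately show ?thesis by simp
      next
        case nz: False
        then have "diameter (Us i) > 0" using diameter_ge_0[OF U(2), of i] by linarith
        then have "emeasure M (V i) \<le> ennreal (2 * diameter (Us i) powr \<delta>)"
          using ball_mass_upper[OF c(2)[OF False]] False by (simp add: V_def)
        then show ?thesis by (simp add: ennreal_mult[symmetric] del: ennreal_numeral)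
      qed
    qed (simp add: V_def)
    have "A \<subseteq> K" using A sets.sets_into_space by fastforce
    have "A \<subseteq> (\<Union>i. V i)"
    proof
      fix w assume w: "w \<in> A"
      then obtain i where i: "w \<in> Us i" "w \<in> K" using U(1) \<open>A \<subseteq> K\<close> by blast
      then have ne: "Us i \<inter> K \<noteq> {}" by blast
      have "dist (c i) w \<le> diameter (Us i)" by (rule diameter_bounded_bound[OF U(2) c(1)[OF ne] i(1)])
      then have "w \<in> V i" using i ne by (simp add: V_def)
      then show "w \<in> (\<Union>i. V i)" by blast
    qed
    then have "emeasure M A \<le> emeasure M (\<Union>i. V i)" by (intro emeasure_mono) (auto intro: V_sets)
    also have "\<dots> \<le> (\<Sum>i. emeasure M (V i))" by (intro emeasure_subadditive_countably) (auto intro: V_sets)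
    also have "\<dots> \<le> (\<Sum>i. ennreal 2 * ennreal (diameter (Us i) powr \<delta>))" by (intro suminf_le V_mass) auto
    also have "\<dots> = ennreal 2 * (\<Sum>i. ennreal (diameter (Us i) powr \<delta>))" by (rule ennreal_suminf_cmult)
    finally have "ennreal (1/2) * emeasure M A \<le> ennreal (1/2) * (ennreal 2 * (\<Sum>i. ennreal (diameter (Us i) powr \<delta>)))"
      by (intro mult_left_mono) auto
    then show "ennreal (1/2) * emeasure M A \<le> (\<Sum>i. ennreal (diameter (Us i) powr \<delta>))"
      by (simp add: mult.assoc[symmetric] ennreal_mult[symmetric] del: ennreal_half ennreal_numeral)
  qed
  also have "\<dots> \<le> hausdorff_measure \<delta> A" unfolding hausdorff_measure_def by (rule SUP_upper) simp
  finally show ?thesis by (rule ennreal_half_le)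
qed

text \<open>Conversely, a neighbourhood of almost the same mass as \<open>A\<close> is a disjoint union of small
  cylinders, and the diameter of a cylinder of mass \<open>1 / 2 ^ n\<close> is at most \<open>2 * r ^ n\<close>.\<close>

lemma hausdorff_le_mass:
  assumes A: "A \<in> sets M"
  shows "hausdorff_measure \<delta> A \<le> ennreal 2 * emeasure M A"
  unfolding hausdorff_measure_def
proof (rule SUP_least)
  fix \<epsilon> :: real assume "\<epsilon> \<in> {0<..}"
  then have eps: "\<epsilon> > 0" by simp
  have AK: "A \<subseteq> K" using A sets.sets_into_space by fastforce
  have A_borel: "A \<in> sets borel" using A AK by (auto simp: sets_M sets_restrict_space)
  have "(\<lambda>n. 2 * r ^ n) \<longlonglongrightarrow> 2 * 0" by (intro tendsto_mult_left r_pow_tendsto_0)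
  then have "\<forall>\<^sub>F n in sequentially. 2 * r ^ n < \<epsilon>" using eps by (intro order_tendstoD(2)[of _ 0]) auto
  then obtain m where m: "2 * r ^ m < \<epsilon>" by (auto simp: eventually_sequentially)
  define N where "N = distr M borel (\<lambda>w. w)"
  have N: "emeasure N S = emeasure M (S \<inter> K)" if "S \<in> sets borel" for S
    unfolding N_def using emeasure_distr[OF id_measurable_M that] by simp
  have cover: "hausdorff_pre \<delta> \<epsilon> A \<le> ennreal 2 * emeasure N S" if S: "A \<subseteq> S" "open S" for S
  proof -
    have diam: "bounded (piece m S i) \<and> diameter (piece m S i) \<le> \<epsilon> \<and>
      ennreal (diameter (piece m S i) powr \<delta>) \<le> ennreal 2 * emeasure M (piece m S i)" for i
    proof (cases "piece m S i = {}")
      case False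
      then obtain w where "w \<in> piece m S i" by blast
      then obtain n where n: "m \<le> n" "w \<in> K" "piece m S i = cylinder n (idx n w)"
        by (rule piece_cases)
      have d: "dist u v \<le> 2 * r ^ n" if "u \<in> piece m S i" "v \<in> piece m S i" for u v
        using that same_cell_dist[of u v n] unfolding n(3) by (auto simp: cylinder_def)
      have "bounded (piece m S i)" using K_subset_cball n(3) by (auto simp: cylinder_def intro: bounded_subset[OF bounded_cball])
      moreover have diam: "diameter (piece m S i) \<le> 2 * r ^ n"
        by (rule diameter_le) (use d in \<open>auto simp: dist_norm\<close>)
      moreover have "2 * r ^ n \<le> 2 * r ^ m" using n(1) r_small by (intro mult_left_mono power_decreasing) auto
      moreover have "diameter (piece m S i) powr \<delta> \<le> 2 * (1 / 2 ^ n)"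
      proof -
        have "diameter (piece m S i) powr \<delta> \<le> (2 * r ^ n) powr \<delta>"
          using diam diameter_ge_0[OF \<open>bounded (piece m S i)\<close>] delta_pos by (intro powr_mono2) auto
        also have "\<dots> = 2 powr \<delta> * (1 / 2 ^ n)" by (simp add: powr_mult r_pow_powr)
        also have "\<dots> \<le> 2 * (1 / 2 ^ n)" using two_powr_delta by (intro mult_right_mono) auto
        finally show ?thesis .
      qed
      moreover have "emeasure M (piece m S i) = ennreal (1 / 2 ^ n)"
        using cylinder_emeasure[of n "idx n w"] False by (simp add: n(3))
      ultimately show ?thesis using m
        by (auto simp: ennreal_mult[symmetric] ennreal_leI simp del: ennreal_numeral)
    qed (use eps in simp)
    have "hausdorff_pre \<delta> \<epsilon> A \<le> (\<Sum>i. ennreal (diameter (piece m S i) powr \<delta>))"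
      unfolding hausdorff_pre_def
      by (rule INF_lower) (use diam piece_Union[OF S(2), of m] S(1) AK in auto)
    also have "\<dots> \<le> (\<Sum>i. ennreal 2 * emeasure M (piece m S i))" using diam by (intro suminf_le) auto
    also have "\<dots> = ennreal 2 * (\<Sum>i. emeasure M (piece m S i))" by (rule ennreal_suminf_cmult)
    also have "(\<Sum>i. emeasure M (piece m S i)) = emeasure M (S \<inter> K)"
      unfolding piece_Union[OF S(2), of m, symmetric]
      by (rule suminf_emeasure) (auto simp: piece_sets piece_disjoint)
    also have "\<dots> = emeasure N S" using N[of S] S(2) by simp
    finally show ?thesis .
  qed
  have "ennreal (1/2) * hausdorff_pre \<delta> \<epsilon> A \<le> (INF S \<in> {S. A \<subseteq> S \<and> open S}. emeasure N S)"
  proof (rule INF_greatest)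
    fix S assume "S \<in> {S. A \<subseteq> S \<and> open S}"
    then have "ennreal (1/2) * hausdorff_pre \<delta> \<epsilon> A \<le> ennreal (1/2) * (ennreal 2 * emeasure N S)"
      using cover[of S] by (intro mult_left_mono) auto
    then show "ennreal (1/2) * hausdorff_pre \<delta> \<epsilon> A \<le> emeasure N S"
      by (simp add: mult.assoc[symmetric] ennreal_mult[symmetric] del: ennreal_half ennreal_numeral)
  qed
  also have "\<dots> = emeasure N A"
  proof (rule outer_regular[symmetric])
    show "sets N = sets borel" by (simp add: N_def)
    show "emeasure N (space N) \<noteq> \<infinity>" using N[of UNIV] by (simp add: N_def M.emeasure_eq_measure)
  qed (rule A_borel)
  also have "\<dots> = emeasure M A" using N[OF A_borel] AK by (simp add: Int_absorb2)
  finally show "hausdorff_pre \<delta> \<epsilon> A \<le> ennreal 2 * emeasure M A" by (rule ennreal_half_le)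
qed

lemma harm_measure_comparable:
  assumes x: "x \<notin> K"
  obtains C where "C \<ge> 1" "\<And>A. A \<in> sets borel \<Longrightarrow> A \<subseteq> K \<Longrightarrow>
    ennreal (1 / C) * hausdorff_measure \<delta> A \<le> emeasure (harm_measure x) A \<and>
    emeasure (harm_measure x) A \<le> ennreal C * hausdorff_measure \<delta> A"
proof -
  obtain a where a: "a > 0" "\<And>w. w \<in> K \<Longrightarrow> a \<le> \<Phi> x w" using Phi_lower[OF x] by metis
  obtain B where B: "B \<ge> 0" "\<And>w. w \<in> K \<Longrightarrow> \<bar>\<Phi> x w\<bar> \<le> B" using Phi_bounded[OF x] by metis
  define C where "C = max 1 (max (2 * B) (2 / a))"
  have C: "C \<ge> 1" "2 * B \<le> C" "2 / a \<le> C" by (auto simp: C_def)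
  have C2: "1 / C \<le> a / 2"
  proof -
    have "2 \<le> C * a" using C(3) a(1) by (simp add: field_simps)
    then show ?thesis using C(1) by (simp add: field_simps)
  qed
  have "ennreal (1 / C) * hausdorff_measure \<delta> A \<le> emeasure (harm_measure x) A \<and>
      emeasure (harm_measure x) A \<le> ennreal C * hausdorff_measure \<delta> A" if A: "A \<in> sets borel" "A \<subseteq> K" for A
  proof -
    have AM: "A \<in> sets M" using borel_subset_sets_M[OF A(1)] A(2) by (simp add: Int_absorb1)
    have harm_measure: "emeasure (harm_measure x) A = (\<integral>\<^sup>+w. ennreal (\<Phi> x w) * indicator A w \<partial>M)"
      unfolding harm_measure_def by (rule emeasure_density) (use Phi_measurable[OF x] AM in auto)
    have "emeasure (harm_measure x) A \<le> (\<integral>\<^sup>+w. ennreal B * indicator A w \<partial>M)"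
      unfolding harm_measure using B(2) by (intro nn_integral_mono mult_right_mono ennreal_leI) (auto simp: abs_le_iff)
    also have "\<dots> = ennreal B * emeasure M A" using AM by (simp add: nn_integral_cmult)
    also have "\<dots> \<le> ennreal B * (ennreal 2 * hausdorff_measure \<delta> A)"
      by (intro mult_left_mono mass_le_hausdorff AM) auto
    also have "\<dots> = ennreal (2 * B) * hausdorff_measure \<delta> A"
      using B(1) by (simp add: mult.assoc[symmetric] ennreal_mult[symmetric] mult.commute del: ennreal_numeral)
    also have "\<dots> \<le> ennreal C * hausdorff_measure \<delta> A" using C by (intro mult_right_mono ennreal_leI) auto
    finally have up: "emeasure (harm_measure x) A \<le> ennreal C * hausdorff_measure \<delta> A" .
    have "ennreal (1 / C) * hausdorff_measure \<delta> A \<le> ennreal (a / 2) * hausdorff_measure \<delta> A"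
      using C2 by (intro mult_right_mono ennreal_leI) auto
    also have "\<dots> \<le> ennreal (a / 2) * (ennreal 2 * emeasure M A)"
      by (intro mult_left_mono hausdorff_le_mass AM) auto
    also have "\<dots> = ennreal a * emeasure M A"
      using a(1) by (simp add: mult.assoc[symmetric] ennreal_mult[symmetric] del: ennreal_numeral)
    also have "\<dots> = (\<integral>\<^sup>+w. ennreal a * indicator A w \<partial>M)" using AM by (simp add: nn_integral_cmult)
    also have "\<dots> \<le> emeasure (harm_measure x) A"
      unfolding harm_measure using a(2) by (intro nn_integral_mono mult_right_mono ennreal_leI) auto
    finally show ?thesis using up by simp
  qed
  with C(1) show ?thesis by (rule that)
qed

theorem K_properties:
  assumes x: "x \<in> - K"
  shows "(\<exists>\<omega>. is_harmonic_measure (- K) x \<omega>) \<and> (\<exists>G. is_green_function (- K) x G) \<and>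
    (\<exists>C\<ge>1 :: real.
      (\<forall>\<omega>. is_harmonic_measure (- K) x \<omega> \<longrightarrow>
        (\<forall>A \<in> sets borel. A \<subseteq> K \<longrightarrow>
          ennreal (1 / C) * hausdorff_measure \<delta> (A \<inter> K) \<le> emeasure \<omega> A \<and>
          emeasure \<omega> A \<le> ennreal C * hausdorff_measure \<delta> (A \<inter> K))) \<and>
      (\<exists>\<rho>>0. \<forall>G. is_green_function (- K) x G \<longrightarrow>
        (\<forall>y\<in>- K. infdist y K \<le> \<rho> \<longrightarrow>
          1 / C * infdist y K powr \<delta> \<le> G y \<and> G y \<le> C * infdist y K powr \<delta>)))"
proof -
  have xK: "x \<notin> K" using x by simp
  obtain c where pd: "pole_density x (\<Phi> x) c" by (rule Phi_density[OF xK])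
  let ?G = "Green x (\<Phi> x) c"
  have G: "is_green_function (- K) x ?G" by (rule Green_is_green_function[OF xK pd])
  obtain C1 where C1: "C1 \<ge> 1" "\<And>A. A \<in> sets borel \<Longrightarrow> A \<subseteq> K \<Longrightarrow>
    ennreal (1 / C1) * hausdorff_measure \<delta> A \<le> emeasure (harm_measure x) A \<and>
    emeasure (harm_measure x) A \<le> ennreal C1 * hausdorff_measure \<delta> A"
    by (rule harm_measure_comparable[OF xK]) (rule that)
  obtain a b \<rho> where ab: "a > 0" "b > 0" "\<rho> > 0" "\<rho> \<le> 1" "\<rho> < infdist x K"
    "\<forall>y. infdist y K \<le> \<rho> \<longrightarrow> a * green y \<le> ?G y \<and> ?G y \<le> b * green y"
    using Green_comparable[OF xK pd] by (elim exE conjE) (rule that)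
  define C where "C = max C1 (max (1 / a) (b * (8 * (L + 4))))"
  have C: "C \<ge> C1" "1 / a \<le> C" "b * (8 * (L + 4)) \<le> C" by (auto simp: C_def)
  have C0: "C > 0" using C(1) C1(1) by linarith
  have Ca: "1 / C \<le> a"
  proof -
    have "1 \<le> C * a" using C(2) ab(1) by (simp add: field_simps)
    then show ?thesis using C0 by (simp add: field_simps)
  qed
  have omega: "ennreal (1 / C) * hausdorff_measure \<delta> (A \<inter> K) \<le> emeasure \<omega> A \<and>
      emeasure \<omega> A \<le> ennreal C * hausdorff_measure \<delta> (A \<inter> K)"
    if om: "is_harmonic_measure (- K) x \<omega>" and A: "A \<in> sets borel" "A \<subseteq> K" for \<omega> A
  proof (rule conjI)
    have eq: "\<omega> = harm_measure x" by (rule harmonic_measure_unique[OF om xK])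
    have AK: "A \<inter> K = A" using A(2) by blast
    have "1 / C \<le> 1 / C1" using C(1) C1(1) by (intro divide_left_mono) auto
    then have "ennreal (1 / C) * hausdorff_measure \<delta> A \<le> ennreal (1 / C1) * hausdorff_measure \<delta> A"
      by (intro mult_right_mono ennreal_leI) auto
    then show "ennreal (1 / C) * hausdorff_measure \<delta> (A \<inter> K) \<le> emeasure \<omega> A"
      unfolding AK eq using C1(2)[OF A] by (meson order_trans)
    have "ennreal C1 * hausdorff_measure \<delta> A \<le> ennreal C * hausdorff_measure \<delta> A"
      using C(1) by (intro mult_right_mono ennreal_leI) auto
    then show "emeasure \<omega> A \<le> ennreal C * hausdorff_measure \<delta> (A \<inter> K)"
      unfolding AK eq using C1(2)[OF A] by (meson order_trans)
  qed
  have green: "1 / C * infdist y K powr \<delta> \<le> G' y \<and> G' y \<le> C * infdist y K powr \<delta>"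
    if G': "is_green_function (- K) x G'" and y: "y \<in> - K" and near: "infdist y K \<le> \<rho>" for G' y
  proof (rule conjI)
    have yx: "y \<noteq> x" using near ab(5) by auto
    have eq: "G' y = ?G y" by (rule green_function_unique[OF G' G xK _ yx]) (use y in simp)
    have cmp: "a * green y \<le> ?G y" "?G y \<le> b * green y" using ab(6) near by auto
    have gr: "infdist y K powr \<delta> \<le> green y" "green y \<le> 8 * (L + 4) * infdist y K powr \<delta>"
      using green_dist[of y] y near ab(4) by auto
    have "1 / C * infdist y K powr \<delta> \<le> a * infdist y K powr \<delta>" using Ca by (intro mult_right_mono) auto
    also have "\<dots> \<le> a * green y" using gr(1) ab(1) by (intro mult_left_mono) auto
    finally show "1 / C * infdist y K powr \<delta> \<le> G' y" using cmp eq by linarith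
    have "b * green y \<le> b * (8 * (L + 4) * infdist y K powr \<delta>)" using gr(2) ab(2) by (intro mult_left_mono) auto
    also have "\<dots> = b * (8 * (L + 4)) * infdist y K powr \<delta>" by simp
    also have "\<dots> \<le> C * infdist y K powr \<delta>" using C(3) by (intro mult_right_mono) auto
    finally show "G' y \<le> C * infdist y K powr \<delta>" using cmp eq by linarith
  qed
  have "C \<ge> 1" using C(1) C1(1) by linarith
  then show ?thesis
    using harm_measure_is_harmonic_measure[OF xK] G omega green ab(3)
    by (intro conjI exI[of _ "harm_measure x"] exI[of _ ?G]; (intro exI[of _ C] conjI exI[of _ \<rho>])?) auto
qed

end

theorem theorem1p1:
  shows "\<exists>\<delta>\<^sub>M :: real. 0 < \<delta>\<^sub>M \<and> \<delta>\<^sub>M \<le> 1 \<and>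
    (\<exists>\<delta>\<^sub>1 :: real. 0 < \<delta>\<^sub>1 \<and> \<delta>\<^sub>1 < 1 / 2 \<and>
      (\<forall>\<delta>. 0 < \<delta> \<and> \<delta> < \<delta>\<^sub>M \<longrightarrow>
        (\<exists>K :: (real^2) set. compact K \<and> ahlfors_regular \<delta> K \<and>
          (\<delta> < \<delta>\<^sub>1 \<longrightarrow> (\<exists>L. affine L \<and> aff_dim L = 1 \<and> K \<subseteq> L)) \<and>
          (let \<Omega> = - K; \<sigma> = (\<lambda>A. hausdorff_measure \<delta> (A \<inter> K)) in
            \<forall>x\<in>\<Omega>.
              (\<exists>\<omega>. is_harmonic_measure \<Omega> x \<omega>) \<and> (\<exists>G. is_green_function \<Omega> x G) \<and>
              (\<exists>C\<ge>1 :: real.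
                (\<forall>\<omega>. is_harmonic_measure \<Omega> x \<omega> \<longrightarrow>
                  (\<forall>A \<in> sets borel. A \<subseteq> K \<longrightarrow>
                    ennreal (1 / C) * \<sigma> A \<le> emeasure \<omega> A \<and> emeasure \<omega> A \<le> ennreal C * \<sigma> A)) \<and>
                (\<exists>\<rho>>0. \<forall>G. is_green_function \<Omega> x G \<longrightarrow>
                  (\<forall>y\<in>\<Omega>. infdist y K \<le> \<rho> \<longrightarrow>
                    1 / C * infdist y K powr \<delta> \<le> G y \<and> G y \<le> C * infdist y K powr \<delta>)))))))"
proof (rule exI[of _ "1/200"], intro conjI, simp, simp, rule exI[of _ "1/200"], intro conjI allI impI, simp, simp)
  fix \<delta> :: real assume d: "0 < \<delta> \<and> \<delta> < 1 / 200"
  define \<Lambda> where "\<Lambda> = ln 2 / \<delta>"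
  have "ln 2 \<ge> (1/2::real)"
  proof -
    have "exp (1/2::real) \<le> 1 + 1/2 + (1/2)\<^sup>2" by (rule exp_bound) auto
    also have "\<dots> \<le> 2" by (simp add: power2_eq_square)
    finally show ?thesis by (subst ln_ge_iff) auto
  qed
  moreover have "100 * \<delta> \<le> 1 / 2" using d by simp
  ultimately have "100 * \<delta> \<le> ln 2" by linarith
  then have "\<Lambda> \<ge> 100" using d by (simp add: \<Lambda>_def field_simps)
  then interpret C: cantor \<Lambda> by unfold_locales
  have "C.\<delta> = ln 2 / \<Lambda>" by (rule C.\<delta>_def)
  then have delta: "C.\<delta> = \<delta>" using d by (simp only: \<Lambda>_def) simp
  show "\<exists>K :: (real^2) set. compact K \<and> ahlfors_regular \<delta> K \<and>
          (\<delta> < 1 / 200 \<longrightarrow> (\<exists>L. affine L \<and> aff_dim L = 1 \<and> K \<subseteq> L)) \<and>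
          (let \<Omega> = - K; \<sigma> = (\<lambda>A. hausdorff_measure \<delta> (A \<inter> K)) in
            \<forall>x\<in>\<Omega>.
              (\<exists>\<omega>. is_harmonic_measure \<Omega> x \<omega>) \<and> (\<exists>G. is_green_function \<Omega> x G) \<and>
              (\<exists>C\<ge>1 :: real.
                (\<forall>\<omega>. is_harmonic_measure \<Omega> x \<omega> \<longrightarrow>
                  (\<forall>A \<in> sets borel. A \<subseteq> K \<longrightarrow>
                    ennreal (1 / C) * \<sigma> A \<le> emeasure \<omega> A \<and> emeasure \<omega> A \<le> ennreal C * \<sigma> A)) \<and>
                (\<exists>\<rho>>0. \<forall>G. is_green_function \<Omega> x G \<longrightarrow>
                  (\<forall>y\<in>\<Omega>. infdist y K \<le> \<rho> \<longrightarrow>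
                    1 / C * infdist y K powr \<delta> \<le> G y \<and> G y \<le> C * infdist y K powr \<delta>))))"
    unfolding Let_def
  proof (rule exI[of _ C.K], intro conjI impI)
    show "compact C.K" by (rule C.compact_K)
    show "ahlfors_regular \<delta> C.K" using C.K_ahlfors_regular by (simp only: delta)
    have "aff_dim (span {axis 1 1 :: real^2}) = 1"
      by (simp add: aff_dim_subspace axis_eq_0_iff)
    then show "\<exists>L. affine L \<and> aff_dim L = 1 \<and> C.K \<subseteq> L"
      using C.K_line subspace_imp_affine[OF subspace_span] by blast
  qed (rule ballI, rule C.K_properties[unfolded delta])
qed

end
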